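(* Let $0<|q|<1$ with a fixed choice of $q^{1/2}$, let $N\in\mathbb Z$ and $u,v\in\mathbb C\setminus\{0\}$. Define $$\Phi^*=\sum_{\lambda,\mu,\nu}\Big(\frac{(-u)^N}{q^{-\frac12}v}\Big)^{|\lambda|}f_\lambda^N\big(-q^{-\frac12}u\big)^{|\mu|}f_\mu^{-1}(q^{-\frac12}u)^{-|\nu|}\,C_{\nu'\mu\lambda}\,|\lambda\rangle\otimes|\mu\rangle\otimes\langle\nu|,$$ $$\Phi=\sum_{\lambda,\mu,\nu}\Big(-\frac{q^{-\frac12}u}{(-v)^N}\Big)^{|\lambda|}f_\lambda^{-N}\big(q^{-\frac12}v\big)^{-|\mu|}f_\mu(-q^{-\frac12}v)^{|\nu|}\,C_{\nu\mu'\lambda'}\,\langle\lambda|\otimes\langle\mu|\otimes|\nu\rangle ,$$ and $\alpha=q^{\frac12}u^Nv^{-1}$, $\beta=-q^{-\frac12}u$, $\tilde\alpha=q^{\frac12}u^{-1}v^N$, $\tilde\beta=-q^{-\frac12}v$. Then $$\Phi^*=\mathcal N_\varnothing^{-1}\;{}^3\langle0|\exp\Big[\sum_{n>0}\frac1n\Big(-\beta^{-n}q^{-\frac n2}b_n^{(1)}a_n^{(3)}+a_{-n}^{(2)}a_n^{(3)}+\beta^nq^{\frac n2}b_{-n}^{(1)}a_{-n}^{(2)}\Big)\Big]q^{\frac N2\hat w^{(1)}}(\alpha q^{\frac12})^{L_0^{(1)}}|0\rangle^1_{\mathcal S}|0\rangle^2,$$ $$\Phi=\mathcal N_\varnothing^{-1}\;{}^2\langle0|\;{}^1_{\mathcal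 S}\langle0|\,(-\tilde\alpha q^{\frac12})^{-L_0^{(1)}}q^{-\frac N2\hat w^{(1)}}\exp\Big[\sum_{n>0}\frac1n\Big(\tilde\beta^{-n}q^{-\frac n2}b_n^{(1)}a_n^{(2)}+a_n^{(2)}a_{-n}^{(3)}-\tilde\beta^nq^{\frac n2}b_{-n}^{(1)}a_{-n}^{(3)}\Big)\Big]|0\rangle^3 .$$
   Context: For a partition $\lambda$: $\lambda'$ is the conjugate, $|\lambda|$ the size, $\kappa_\lambda=\sum_i\lambda_i(\lambda_i-2i+1)$, $\rho=(-\tfrac12,-\tfrac32,\dots)$, $q^{-\lambda-\rho}=(q^{-\lambda_i+i-1/2})_{i\ge1}$; $s_{\lambda/\eta}$ are skew Schur functions. Sums run over all partitions. $f_\lambda=(-1)^{|\lambda|}q^{\kappa_\lambda/2}$. Topological vertex: $C_{\lambda\mu\nu}=q^{\kappa_\mu/2}s_{\nu'}(q^{-\rho})\sum_\eta s_{\lambda'/\eta}(q^{-\nu-\rho})s_{\mu/\eta}(q^{-\nu'-\rho})$. Free fermion modes $\psi_r,\psi_r^\dagger$ ($r\in\mathbb Z+\frac12$): $\{\psi_r,\psi^\dagger_s\}=\delta_{r+s,0}$, other anticommutators zero, vacuum $\psi_r|0\rangle=\psi^\dagger_r|0\rangle=0$ for $r>0$; $:\ :$ is fermionic normal ordering. Define $$a_n=-\sum_r:\psi_r\psi^\dagger_{n-r}:,\quad b_n=-\sum_rq^{n(r+1/2)}:\psi^\dagger_r\psi_{-r}:+\frac1{1-q^{-n}}\ (n\ne0),$$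 $$\hat w=\sum_rr^2:\psi^\dagger_r\psi_{-r}:,\quad L_0=\sum_{n>0}a_{-n}a_n .$$ One has $[a_m,a_n]=m\delta_{m+n,0}$. With $\mathrm{diag}(\lambda)=\#\{i:i\le\lambda_i\}$, $$|\lambda\rangle=\prod_{i=1}^{\mathrm{diag}(\lambda)}\big[(-1)^{-\lambda_i+i}\psi_{-\lambda'_i+i-1/2}\psi^\dagger_{-\lambda_i+i-1/2}\big]|0\rangle$$ is a basis of the charge-zero sector, on which everything acts; $\langle\lambda|$ is the dual basis, $\langle0|=\langle\varnothing|$. S-dual vacuum: $|0\rangle_{\mathcal S}=|\varnothing\rangle_{\mathcal S}=\mathcal N_\varnothing\exp\big[-\sum_{n>0}\frac{a_{-n}}n\sum_{l>0}q^{(l-1)n}\big]|0\rangle$ and ${}_{\mathcal S}\langle0|={}_{\mathcal S}\langle\varnothing|=\mathcal N_\varnothing\langle0|\exp\big[\sum_{n>0}\frac{a_n}n\sum_{l>0}q^{ln}\big]$, with $\mathcal N_\varnothing=\prod_{n\ge1}(1-q^n)^{-n/2}$. Superscripts $1,2,3$ label three copies of the Fock space, corresponding to the first, second and third tensor factors; an operator with superscript $(i)$ acts on the $i$-th copy. $\Phi^*$ has ket components in copies 1, 2 and a bra component in copy 3; $\Phi$ has bra components in copies 1, 2 and a ket component in copy 3. These are formal infinite sums, and the equalities mean equality of all coefficients of $|\lambda\rangle\otimes|\mu\rangle\otimes\langle\nu|$ (resp. $\langle\lambda|\otimes\langle\mu|\otimes|\nu\rangle$).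
   Formalization: In the formula for Φ the factor (−α̃ q^{1/2})^{−L_0} is replaced by (α̃ q^{1/2})^{−L_0}: as printed it fails for odd |λ|, e.g. N=0, λ=(1), μ=ν=∅, where the definition gives −u/(1−q) but the printed right side gives +u/(1−q). *)

theory Defs
  imports "HOL-Analysis.Analysis"
begin

section \<open>Partitions\<close>

text \<open>The parts are indexed from 1; index 0 is unused and carries the value 0.\<close>

typedef partition =
  "{p :: nat \<Rightarrow> nat. p 0 = 0 \<and> (\<forall>i j. 1 \<le> i \<longrightarrow> i \<le> j \<longrightarrow> p j \<le> p i) \<and> finite {i. p i \<noteq> 0}}"
  morphisms part Abs_partition
  by (rule exI[of _ "\<lambda>_. 0"]) auto

setup_lifting type_definition_partition

lift_definition empty_part :: partition is "\<lambda>_. 0"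
  by auto

lift_definition conj_part :: "partition \<Rightarrow> partition"
  is "\<lambda>p j. if j = 0 then 0 else card {i. 1 \<le> i \<and> j \<le> p i}"
proof -
  fix p :: "nat \<Rightarrow> nat"
  assume p: "p 0 = 0 \<and> (\<forall>i j. 1 \<le> i \<longrightarrow> i \<le> j \<longrightarrow> p j \<le> p i) \<and> finite {i. p i \<noteq> 0}"
  define c where "c = (\<lambda>j. if j = 0 then 0 else card {i. 1 \<le> i \<and> j \<le> p i})"
  have fin: "finite {i. 1 \<le> i \<and> j \<le> p i}" if "1 \<le> j" for j
    by (rule finite_subset[of _ "{i. p i \<noteq> 0}"]) (use p that in auto)
  have mono: "c j \<le> c i" if "1 \<le> i" "i \<le> j" for i j
    unfolding c_def using that fin[OF that(1)] by (auto intro!: card_mono)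
  have "{j. c j \<noteq> 0} \<subseteq> {..p 1}"
  proof
    fix j assume "j \<in> {j. c j \<noteq> 0}"
    hence "{i. 1 \<le> i \<and> j \<le> p i} \<noteq> {}"
      by (auto simp: c_def split: if_splits dest: card_gt_0_iff[THEN iffD1])
    then obtain i where "1 \<le> i" "j \<le> p i" by blast
    moreover have "p i \<le> p 1" using p \<open>1 \<le> i\<close> by blast
    ultimately show "j \<in> {..p 1}" by simp
  qed
  hence "finite {j. c j \<noteq> 0}" by (rule finite_subset) simp
  with mono show "(if (0::nat) = 0 then 0 else card {i. 1 \<le> i \<and> 0 \<le> p i}) = 0 \<and>
    (\<forall>i j. 1 \<le> i \<longrightarrow> i \<le> j \<longrightarrow>
       (if j = 0 then 0 else card {i. 1 \<le> i \<and> j \<le> p i})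
       \<le> (if i = 0 then 0 else card {ia. 1 \<le> ia \<and> i \<le> p ia})) \<and>
    finite {j. (if j = 0 then 0 else card {i. 1 \<le> i \<and> j \<le> p i}) \<noteq> 0}"
    by (simp add: c_def)
qed

definition psize :: "partition \<Rightarrow> nat" where
  "psize l = (\<Sum>i | part l i \<noteq> 0. part l i)"

definition kappa :: "partition \<Rightarrow> int" where
  "kappa l = (\<Sum>i | part l i \<noteq> 0. int (part l i) * (int (part l i) - 2 * int i + 1))"

definition pdiag :: "partition \<Rightarrow> nat" where
  "pdiag l = card {i. 1 \<le> i \<and> i \<le> part l i}"


section \<open>Skew Schur functions and the topological vertex\<close>

definition contained :: "partition \<Rightarrow> partition \<Rightarrow> bool" where
  "contained e l \<longleftrightarrow> (\<forall>i. part e i \<le> part l i)"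

definition skew_cells :: "partition \<Rightarrow> partition \<Rightarrow> (nat \<times> nat) set" where
  "skew_cells l e = {(i, j). 1 \<le> i \<and> part e i < j \<and> j \<le> part l i}"

definition ssyt :: "partition \<Rightarrow> partition \<Rightarrow> (nat \<times> nat \<Rightarrow> nat) set" where
  "ssyt l e = {T \<in> skew_cells l e \<rightarrow>\<^sub>E {1..}.
     (\<forall>i j j'. (i, j) \<in> skew_cells l e \<longrightarrow> (i, j') \<in> skew_cells l e \<longrightarrow> j < j' \<longrightarrow> T (i, j) \<le> T (i, j')) \<and>
     (\<forall>i i' j. (i, j) \<in> skew_cells l e \<longrightarrow> (i', j) \<in> skew_cells l e \<longrightarrow> i < i' \<longrightarrow> T (i, j) < T (i', j))}"

text \<open>The skew Schur function in the infinitely many variables \<open>x 1, x 2, \<dots>\<close>, evaluated at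
  complex numbers: the generating function of semistandard tableaux, absolutely convergent when
  \<open>x\<close> is absolutely summable.\<close>

definition skew_schur :: "partition \<Rightarrow> partition \<Rightarrow> (nat \<Rightarrow> complex) \<Rightarrow> complex" where
  "skew_schur l e x =
     (if contained e l then (\<Sum>\<^sub>\<infinity>T\<in>ssyt l e. \<Prod>c\<in>skew_cells l e. x (T c)) else 0)"

text \<open>Throughout, \<open>qh\<close> is the chosen square root of \<open>q\<close>, and a half-integral power of \<open>q\<close>
  is written as the corresponding integral power of \<open>qh\<close>. The sequence
  \<open>q_spec qh n\<close> is \<open>q\<close> to the power \<open>- n - \<rho>\<close>, where \<open>\<rho>\<^sub>i = 1/2 - i\<close>.\<close>

definition q_spec :: "complex \<Rightarrow> partition \<Rightarrow> nat \<Rightarrow> complex" where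
  "q_spec qh n i = qh powi (2 * (int i - int (part n i)) - 1)"

definition top_vertex :: "complex \<Rightarrow> partition \<Rightarrow> partition \<Rightarrow> partition \<Rightarrow> complex" where
  "top_vertex qh l m n =
     qh powi kappa m * skew_schur (conj_part n) empty_part (q_spec qh empty_part) *
     (\<Sum>\<^sub>\<infinity>e. skew_schur (conj_part l) e (q_spec qh n) * skew_schur m e (q_spec qh (conj_part n)))"

definition framing :: "complex \<Rightarrow> partition \<Rightarrow> complex" where
  "framing qh l = (-1) ^ psize l * qh powi kappa l"


section \<open>The fermionic Fock space\<close>

text \<open>The Fock space is realised on semi-infinite wedges. The half-integer \<open>k + 1/2\<close> is encoded by
  the integer \<open>k\<close>, so that \<open>-r\<close> corresponds to \<open>- k - 1\<close> and \<open>n - r\<close> to \<open>n - k - 1\<close>. A basis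
  state is the set of its occupied levels; it agrees with the Dirac sea of all negative levels up to
  finitely many levels. A vector is a formal, possibly infinite, linear combination of basis states,
  given by its coefficients.\<close>

typedef maya = "{S :: int set. finite {k \<in> S. 0 \<le> k} \<and> finite {k. k < 0 \<and> k \<notin> S}}"
  morphisms levels Abs_maya
  by (rule exI[of _ "{k. k < 0}"]) (auto intro: finite_subset[of _ "{}"])

setup_lifting type_definition_maya

lift_definition sea :: maya is "{k :: int. k < 0}"
  by (auto intro: finite_subset[of _ "{}"])

lift_definition add_level :: "int \<Rightarrow> maya \<Rightarrow> maya" is "\<lambda>k S. insert k S"
proof -
  fix k :: int and S :: "int set" assume "finite {k \<in> S. 0 \<le> k} \<and> finite {k. k < 0 \<and> k \<notin> S}"
  then show "finite {j \<in> insert k S. 0 \<le> j} \<and> finite {j. j < 0 \<and> j \<notin> insert k S}"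
    by (auto intro: finite_subset[of _ "insert k {k \<in> S. 0 \<le> k}"]
        finite_subset[of _ "{k. k < 0 \<and> k \<notin> S}"])
qed

lift_definition del_level :: "int \<Rightarrow> maya \<Rightarrow> maya" is "\<lambda>k S. S - {k}"
proof -
  fix k :: int and S :: "int set" assume "finite {k \<in> S. 0 \<le> k} \<and> finite {k. k < 0 \<and> k \<notin> S}"
  then show "finite {j \<in> S - {k}. 0 \<le> j} \<and> finite {j. j < 0 \<and> j \<notin> S - {k}}"
    by (auto intro: finite_subset[of _ "{k \<in> S. 0 \<le> k}"]
        finite_subset[of _ "insert k {k. k < 0 \<and> k \<notin> S}"])
qed

definition lsgn :: "int \<Rightarrow> maya \<Rightarrow> complex" where
  "lsgn k S = (-1) ^ card {j \<in> levels S. k < j}"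

type_synonym 's vec = "'s \<Rightarrow> complex"
type_synonym 's opr = "'s vec \<Rightarrow> 's vec"

text \<open>With \<open>r = k + 1/2\<close>, the mode \<open>psi k\<close> is exterior multiplication by the level \<open>-r\<close> and
  \<open>psid k\<close> is contraction with the level \<open>r\<close>.\<close>

definition psi :: "int \<Rightarrow> maya opr" where
  "psi k F S = (if - k - 1 \<in> levels S then lsgn (- k - 1) S * F (del_level (- k - 1) S) else 0)"

definition psid :: "int \<Rightarrow> maya opr" where
  "psid k F S = (if k \<notin> levels S then lsgn k S * F (add_level k S) else 0)"

definition vac :: "maya vec" where
  "vac S = (if S = sea then 1 else 0)"

lemma levels_finite_above: "finite {j \<in> levels S. k < j}"
proof -
  have "{j \<in> levels S. k < j} \<subseteq> {j \<in> levels S. 0 \<le> j} \<union> {k..0}" by auto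
  moreover have "finite {j \<in> levels S. 0 \<le> j}" using levels[of S] by simp
  ultimately show ?thesis by (meson finite_Un finite_atLeastAtMost_int finite_subset)
qed

lemma levels_sea [simp]: "levels sea = {k. k < 0}"
  by (rule sea.rep_eq)

lemma levels_add_level [simp]: "levels (add_level k S) = insert k (levels S)"
  by (rule add_level.rep_eq)

lemma levels_del_level [simp]: "levels (del_level k S) = levels S - {k}"
  by (rule del_level.rep_eq)

lemma maya_eqI: "levels S = levels T \<Longrightarrow> S = T"
  by (simp add: levels_inject)

lemma lsgn_add_level:
  assumes "k \<notin> levels S"
  shows "lsgn j (add_level k S) = (if j < k then - lsgn j S else lsgn j S)"
proof (cases "j < k")
  case True
  have "{i \<in> levels (add_level k S). j < i} = insert k {i \<in> levels S. j < i}"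
    using True by auto
  moreover have "k \<notin> {i \<in> levels S. j < i}" using assms by simp
  ultimately show ?thesis using True by (simp add: lsgn_def levels_finite_above)
next
  case False
  have "{i \<in> levels (add_level k S). j < i} = {i \<in> levels S. j < i}"
    using False by auto
  then show ?thesis using False unfolding lsgn_def by simp
qed

lemma lsgn_del_level:
  assumes "k \<in> levels S"
  shows "lsgn j (del_level k S) = (if j < k then - lsgn j S else lsgn j S)"
proof -
  have "S = add_level k (del_level k S)"
    by (rule maya_eqI) (use assms in auto)
  then have "lsgn j S = lsgn j (add_level k (del_level k S))" by simp
  also have "\<dots> = (if j < k then - lsgn j (del_level k S) else lsgn j (del_level k S))"
    by (rule lsgn_add_level) simp
  finally show ?thesis by (simp split: if_splits)
qed

lemma lsgn_square [simp]: "lsgn k S * lsgn k S = 1"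
  by (simp add: lsgn_def flip: power_add mult_2)

lemma lsgn_square' [simp]: "lsgn k S * (lsgn k S * x) = x"
  by (simp flip: mult.assoc)

text \<open>The canonical anticommutation relations, where \<open>k + l = - 1\<close> means \<open>r + s = 0\<close>, and the
  vacuum conditions.\<close>

lemma psi_psid_anticommute:
  "psi k (psid l F) S + psid l (psi k F) S = (if k + l = - 1 then F S else 0)"
proof (cases "- k - 1 = l")
  case True
  have "l \<in> levels S \<Longrightarrow> add_level l (del_level l S) = S"
    "l \<notin> levels S \<Longrightarrow> del_level l (add_level l S) = S"
    by (auto intro!: maya_eqI)
  then show ?thesis
    using True by (auto simp: psi_def psid_def lsgn_add_level lsgn_del_level)
next
  case False
  have "del_level (- k - 1) (add_level l S) = add_level l (del_level (- k - 1) S)"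
    using False by (auto intro!: maya_eqI)
  then show ?thesis
    using False by (auto simp: psi_def psid_def lsgn_add_level lsgn_del_level)
qed

lemma psi_psi_anticommute: "psi k (psi l F) S + psi l (psi k F) S = 0"
proof -
  have "del_level a (del_level b S) = del_level b (del_level a S)" for a b
    by (auto intro!: maya_eqI)
  then show ?thesis
    by (auto simp: psi_def lsgn_del_level)
qed

lemma psid_psid_anticommute: "psid k (psid l F) S + psid l (psid k F) S = 0"
proof -
  have "add_level a (add_level b S) = add_level b (add_level a S)" for a b
    by (auto intro!: maya_eqI)
  then show ?thesis
    by (auto simp: psid_def lsgn_add_level)
qed

lemma psi_vac: "0 \<le> k \<Longrightarrow> psi k vac = (\<lambda>_. 0)"
  by (rule ext) (auto simp: psi_def vac_def dest!: arg_cong[of _ _ levels])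

lemma psid_vac:
  assumes "0 \<le> k"
  shows "psid k vac = (\<lambda>_. 0)"
proof
  fix S
  have "add_level k S \<noteq> sea"
  proof
    assume "add_level k S = sea"
    then have "k \<in> levels sea" by (metis insertI1 levels_add_level)
    with assms show False by simp
  qed
  then show "psid k vac S = 0" by (simp add: psid_def vac_def)
qed

text \<open>Fermionic normal ordering of \<open>\<psi>\<^sub>r \<psi>\<^sup>\<dagger>\<^sub>t\<close> and of \<open>\<psi>\<^sup>\<dagger>\<^sub>r \<psi>\<^sub>t\<close>, for \<open>r = k + 1/2\<close> and
  \<open>t = l + 1/2\<close>: modes of positive index stand on the right.\<close>

definition nord_psi_psid :: "int \<Rightarrow> int \<Rightarrow> maya opr" where
  "nord_psi_psid k l F S = (if 0 \<le> l then psi k (psid l F) S else - psid l (psi k F) S)"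

definition nord_psid_psi :: "int \<Rightarrow> int \<Rightarrow> maya opr" where
  "nord_psid_psi k l F S = (if 0 \<le> l then psid k (psi l F) S else - psi l (psid k F) S)"

text \<open>Infinite sums of operators are taken coefficient by coefficient.\<close>

definition a_op :: "int \<Rightarrow> maya opr" where
  "a_op n F S = - (\<Sum>\<^sub>\<infinity>k. nord_psi_psid k (n - k - 1) F S)"

definition b_op :: "complex \<Rightarrow> int \<Rightarrow> maya opr" where
  "b_op q n F S =
     - (\<Sum>\<^sub>\<infinity>k. q powi (n * (k + 1)) * nord_psid_psi k (- k - 1) F S) + F S / (1 - q powi (- n))"

definition w_op :: "maya opr" where
  "w_op F S = (\<Sum>\<^sub>\<infinity>k. (of_int k + 1 / 2)\<^sup>2 * nord_psid_psi k (- k - 1) F S)"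

definition L0_op :: "maya opr" where
  "L0_op F S = (\<Sum>\<^sub>\<infinity>n\<in>{1..}. a_op (- n) (a_op n F) S)"

definition ket :: "partition \<Rightarrow> maya vec" where
  "ket l = foldr
     (\<lambda>i F S. (-1) powi (int i - int (part l i)) *
        psi (int i - int (part (conj_part l) i) - 1) (psid (int i - int (part l i) - 1) F) S)
     [1..<Suc (pdiag l)] vac"

text \<open>Each \<open>ket l\<close> is, up to sign, a single basis state, so the dual basis is given by the
  standard bilinear pairing; see \<open>bra_ket\<close> below.\<close>

definition bra :: "partition \<Rightarrow> maya vec \<Rightarrow> complex" where
  "bra l F = (\<Sum>\<^sub>\<infinity>S. ket l S * F S)"


subsection \<open>Duality of \<open>bra\<close> and \<open>ket\<close>\<close>

lemma part_mono: "1 \<le> i \<Longrightarrow> i \<le> j \<Longrightarrow> part l j \<le> part l i"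
  using part[of l] by blast

lemma part_eqI:
  assumes "\<And>i j. 1 \<le> i \<Longrightarrow> 1 \<le> j \<Longrightarrow> j \<le> part l i \<longleftrightarrow> j \<le> part m i"
  shows "l = m"
proof -
  have "part l i = part m i" for i
  proof (cases "i = 0")
    case True
    then show ?thesis using part[of l] part[of m] by simp
  next
    case False
    show ?thesis
    proof (rule antisym)
      show "part l i \<le> part m i"
        using assms[of i "part l i"] False by (cases "part l i = 0") auto
      show "part m i \<le> part l i"
        using assms[of i "part m i"] False by (cases "part m i = 0") auto
    qed
  qed
  then have "part l = part m" by (rule ext)
  then show ?thesis by (rule part_inject[THEN iffD1])
qed

lemma finite_initial_segment:
  fixes A :: "nat set"
  assumes "finite A" "\<And>i. i \<in> A \<Longrightarrow> 1 \<le> i" "\<And>i j. j \<in> A \<Longrightarrow> 1 \<le> i \<Longrightarrow> i \<le> j \<Longrightarrow> i \<in> A"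
  shows "A = {1..card A}"
proof (cases "A = {}")
  case False
  have "A = {1..Max A}"
  proof
    show "A \<subseteq> {1..Max A}" using assms(1,2) by auto
    show "{1..Max A} \<subseteq> A"
      using assms(3)[OF Max_in[OF assms(1) False]] by auto
  qed
  moreover from this have "card A = Max A"
    using card_atLeastAtMost[of 1 "Max A"] by (simp only: diff_Suc_1)
  ultimately show ?thesis by (simp only:)
qed simp

lemma finite_ge_part: "1 \<le> j \<Longrightarrow> finite {i. 1 \<le> i \<and> j \<le> part l i}"
  using part[of l] by (auto intro: finite_subset[of _ "{i. part l i \<noteq> 0}"])

lemma le_conj_part_iff:
  assumes "1 \<le> i" "1 \<le> j"
  shows "i \<le> part (conj_part l) j \<longleftrightarrow> j \<le> part l i"
proof -
  let ?A = "{i. 1 \<le> i \<and> j \<le> part l i}"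
  have "?A = {1..card ?A}"
  proof (rule finite_initial_segment)
    fix i k assume "k \<in> ?A" "1 \<le> i" "i \<le> k"
    then show "i \<in> ?A" using part_mono[of i k l] by simp
  qed (use finite_ge_part[OF assms(2)] in auto)
  then have "i \<in> ?A \<longleftrightarrow> i \<in> {1..card ?A}" by (rule arg_cong)
  moreover have "part (conj_part l) j = card ?A"
    using assms by (simp add: conj_part.rep_eq)
  ultimately show ?thesis using assms by simp
qed

lemma le_pdiag_iff:
  assumes "1 \<le> i"
  shows "i \<le> pdiag l \<longleftrightarrow> i \<le> part l i"
proof -
  let ?A = "{i. 1 \<le> i \<and> i \<le> part l i}"
  have "finite ?A"
    by (rule finite_subset[OF _ finite_ge_part[of 1 l]]) auto
  then have "?A = {1..card ?A}"
  proof (rule finite_initial_segment)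
    fix i j assume "j \<in> ?A" "1 \<le> i" "i \<le> j"
    then show "i \<in> ?A" using part_mono[of i j l] by simp
  qed simp
  then have "i \<in> ?A \<longleftrightarrow> i \<in> {1..card ?A}" by (rule arg_cong)
  then show ?thesis using assms by (simp add: pdiag_def)
qed

definition ket_levels :: "partition \<Rightarrow> nat set \<Rightarrow> int set" where
  "ket_levels l I = ({k. k < 0} - (\<lambda>i. int i - int (part l i) - 1) ` I)
     \<union> (\<lambda>i. int (part (conj_part l) i) - int i) ` I"

definition basis_vec :: "int set \<Rightarrow> complex \<Rightarrow> maya vec" where
  "basis_vec D c S = (if levels S = D then c else 0)"

lemma psid_basis_vec:
  assumes "c * c = 1" "k \<in> D"
  shows "\<exists>c'. c' * c' = 1 \<and> psid k (basis_vec D c) = basis_vec (D - {k}) c'"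
proof (cases "\<exists>T. levels T = D")
  case True
  then obtain T where T: "levels T = D" by blast
  have "psid k (basis_vec D c) S = basis_vec (D - {k}) (lsgn k (del_level k T) * c) S" for S
  proof (cases "levels S = D - {k}")
    case True
    then have "S = del_level k T" using T by (intro maya_eqI) simp
    then show ?thesis using assms T by (auto simp: psid_def basis_vec_def)
  next
    case False
    then show ?thesis by (auto simp: psid_def basis_vec_def)
  qed
  moreover have "(lsgn k (del_level k T) * c) * (lsgn k (del_level k T) * c) = 1"
    using assms(1) by (simp add: ac_simps)
  ultimately show ?thesis by blast
next
  case False
  then have "levels S \<noteq> D - {k}" for S
    using assms(2) by (metis insert_Diff levels_add_level)
  with False have "psid k (basis_vec D c) = basis_vec (D - {k}) 1"
    by (auto simp: psid_def basis_vec_def fun_eq_iff)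
  then show ?thesis by (intro exI[of _ 1]) simp
qed

lemma psi_basis_vec:
  assumes "c * c = 1" "- k - 1 \<notin> D"
  shows "\<exists>c'. c' * c' = 1 \<and> psi k (basis_vec D c) = basis_vec (insert (- k - 1) D) c'"
proof (cases "\<exists>T. levels T = D")
  case True
  then obtain T where T: "levels T = D" by blast
  let ?m = "- k - 1"
  have "psi k (basis_vec D c) S = basis_vec (insert ?m D) (lsgn ?m (add_level ?m T) * c) S" for S
  proof (cases "levels S = insert ?m D")
    case True
    then have "S = add_level ?m T" using T by (intro maya_eqI) simp
    then show ?thesis using assms T by (auto simp: psi_def basis_vec_def)
  next
    case False
    then show ?thesis by (auto simp: psi_def basis_vec_def)
  qed
  moreover have "(lsgn ?m (add_level ?m T) * c) * (lsgn ?m (add_level ?m T) * c) = 1"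
    using assms(1) by (simp add: ac_simps)
  ultimately show ?thesis by blast
next
  case False
  then have "levels S \<noteq> insert (- k - 1) D" for S
    using assms(2) by (metis Diff_insert_absorb levels_del_level)
  with False have "psi k (basis_vec D c) = basis_vec (insert (- k - 1) D) 1"
    by (auto simp: psi_def basis_vec_def fun_eq_iff)
  then show ?thesis by (intro exI[of _ 1]) simp
qed

lemma ket_steps:
  assumes "distinct xs" "set xs \<subseteq> {1..pdiag l}"
  shows "\<exists>c. c * c = 1 \<and> foldr
     (\<lambda>i F S. (-1) powi (int i - int (part l i)) *
        psi (int i - int (part (conj_part l) i) - 1) (psid (int i - int (part l i) - 1) F) S)
     xs vac = basis_vec (ket_levels l (set xs)) c"
  using assms
proof (induction xs)
  case Nil
  have "levels S = {k. k < 0} \<longleftrightarrow> S = sea" for S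
    by (metis levels_inject levels_sea)
  then have "vac = basis_vec (ket_levels l {}) 1"
    by (auto simp: vac_def basis_vec_def ket_levels_def fun_eq_iff)
  then show ?case by (intro exI[of _ 1]) simp
next
  case (Cons i xs)
  let ?f = "\<lambda>i F S. (-1) powi (int i - int (part l i)) *
        psi (int i - int (part (conj_part l) i) - 1) (psid (int i - int (part l i) - 1) F) S"
  let ?h = "\<lambda>i. int i - int (part l i) - 1"
  let ?p = "\<lambda>i. int (part (conj_part l) i) - int i"
  obtain c where c: "c * c = 1" "foldr ?f xs vac = basis_vec (ket_levels l (set xs)) c"
    using Cons by auto
  have rng: "1 \<le> j \<and> j \<le> part l j \<and> j \<le> part (conj_part l) j" if "j \<in> insert i (set xs)" for j
    using Cons.prems(2) that le_pdiag_iff[of j l] le_conj_part_iff[of j j l] by auto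
  have neg: "?h j < 0" "0 \<le> ?p j" if "j \<in> insert i (set xs)" for j
    using rng[OF that] by auto
  have inj: "?h j \<noteq> ?h i" "?p j \<noteq> ?p i" if "j \<in> set xs" for j
  proof -
    have "j \<noteq> i" using Cons.prems(1) that by auto
    moreover have "1 \<le> i" "1 \<le> j" using rng[of i] rng[of j] that by auto
    ultimately show "?h j \<noteq> ?h i" "?p j \<noteq> ?p i"
      using part_mono[of i j l] part_mono[of j i l]
        part_mono[of i j "conj_part l"] part_mono[of j i "conj_part l"]
      by linarith+
  qed
  have not_h: "?h i \<notin> ?h ` set xs"
    using inj(1) by (metis (no_types, lifting) imageE)
  have not_p': "?p i \<notin> ?p ` set xs"
    using inj(2) by (metis (no_types, lifting) imageE)
  have not_p: "?h i \<notin> ?p ` set xs"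
  proof
    assume "?h i \<in> ?p ` set xs"
    then obtain j where "j \<in> set xs" "?h i = ?p j" by (rule imageE)
    then show False using neg(1)[of i] neg(2)[of j] by simp
  qed
  have "?h i \<in> ket_levels l (set xs)"
    unfolding ket_levels_def using neg(1)[of i] not_h by blast
  then obtain c1 where c1: "c1 * c1 = 1"
    "psid (?h i) (basis_vec (ket_levels l (set xs)) c) = basis_vec (ket_levels l (set xs) - {?h i}) c1"
    using psid_basis_vec[OF c(1)] by blast
  have eq: "- (int i - int (part (conj_part l) i) - 1) - 1 = ?p i" by simp
  have "\<not> ?p i < 0" using neg(2)[of i] by simp
  then have new: "?p i \<notin> ket_levels l (set xs) - {?h i}"
    unfolding ket_levels_def using not_p' by blast
  obtain c2 where c2: "c2 * c2 = 1"
    "psi (int i - int (part (conj_part l) i) - 1) (basis_vec (ket_levels l (set xs) - {?h i}) c1)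
       = basis_vec (insert (?p i) (ket_levels l (set xs) - {?h i})) c2"
    using psi_basis_vec[OF c1(1), of "int i - int (part (conj_part l) i) - 1", unfolded eq, OF new]
    by (elim exE conjE)
  have lev: "insert (?p i) (ket_levels l (set xs) - {?h i}) = ket_levels l (set (i # xs))"
  proof -
    have "?h i \<notin> ?p ` set xs" using not_p .
    then have "(X \<union> ?p ` set xs) - {?h i} = (X - {?h i}) \<union> ?p ` set xs" for X
      by blast
    then show ?thesis unfolding ket_levels_def list.set image_insert by blast
  qed
  define s :: complex where "s = (-1) powi (int i - int (part l i))"
  have s: "s * s = 1"
    by (simp add: s_def power_int_minus_one_mult_self)
  have "foldr ?f (i # xs) vac = basis_vec (ket_levels l (set (i # xs))) (s * c2)"
    by (simp only: foldr.simps o_apply c(2) c1(2) c2(2) lev s_def[symmetric])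
      (simp add: basis_vec_def fun_eq_iff)
  moreover have "(s * c2) * (s * c2) = (s * s) * (c2 * c2)"
    by (simp only: ac_simps)
  then have "(s * c2) * (s * c2) = 1"
    using s c2(1) by simp
  ultimately show ?case by blast
qed

lemma ket_basis_vec: "\<exists>c. c * c = 1 \<and> ket l = basis_vec (ket_levels l {1..pdiag l}) c"
  using ket_steps[of "[1..<Suc (pdiag l)]" l]
  by (simp add: ket_def atLeastLessThanSuc_atLeastAtMost del: upt_Suc)

lemma strict_decreasing_eq:
  fixes f g :: "nat \<Rightarrow> int"
  assumes f: "\<And>i j. 1 \<le> i \<Longrightarrow> i < j \<Longrightarrow> f j < f i" and g: "\<And>i j. 1 \<le> i \<Longrightarrow> i < j \<Longrightarrow> g j < g i"
    and eq: "{f i | i. 1 \<le> i \<and> 0 \<le> f i} = {g i | i. 1 \<le> i \<and> 0 \<le> g i}"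
    and i: "1 \<le> i" "0 \<le> f i"
  shows "g i = f i"
proof -
  have count: "card {x \<in> {h i | i. 1 \<le> i \<and> 0 \<le> h i}. h j < x} = j - 1"
    if h: "\<And>i j. 1 \<le> i \<Longrightarrow> i < j \<Longrightarrow> h j < h i" and j: "1 \<le> j" "0 \<le> h j"
    for h :: "nat \<Rightarrow> int" and j
  proof -
    have "{x \<in> {h i | i. 1 \<le> i \<and> 0 \<le> h i}. h j < x} = h ` {1..<j}"
    proof (intro equalityI subsetI)
      fix x assume "x \<in> {x \<in> {h i | i. 1 \<le> i \<and> 0 \<le> h i}. h j < x}"
      then obtain k where k: "x = h k" "1 \<le> k" "h j < h k" by auto
      have "k < j" using h[of j k] k j by (cases k j rule: linorder_cases) auto
      with k show "x \<in> h ` {1..<j}" by simp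
    next
      fix x assume "x \<in> h ` {1..<j}"
      then obtain k where "x = h k" "1 \<le> k" "k < j" by auto
      with h[of k j] j show "x \<in> {x \<in> {h i | i. 1 \<le> i \<and> 0 \<le> h i}. h j < x}" by force
    qed
    moreover have "inj_on h {1..<j}"
      by (rule inj_onI) (metis atLeastLessThan_iff h less_irrefl linorder_neqE_nat)
    ultimately show ?thesis by (simp add: card_image)
  qed
  have "f i \<in> {g i | i. 1 \<le> i \<and> 0 \<le> g i}" using eq i by blast
  then obtain j where j: "f i = g j" "1 \<le> j" "0 \<le> g j" by auto
  have "i - 1 = card {x \<in> {f i | i. 1 \<le> i \<and> 0 \<le> f i}. f i < x}"
    by (rule count[of f i, OF f i, symmetric])
  also have "\<dots> = card {x \<in> {g i | i. 1 \<le> i \<and> 0 \<le> g i}. g j < x}"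
    by (simp only: eq j(1))
  also have "\<dots> = j - 1"
    by (rule count[of g j, OF g j(2,3)])
  finally have "i - 1 = j - 1" .
  then have "i = j" using i j by simp
  then show ?thesis using j by simp
qed

lemma diag_set: "{1..pdiag l} = {i. 1 \<le> i \<and> i \<le> part l i}"
  using le_pdiag_iff[of _ l] by auto

lemma le_conj_self_iff: "1 \<le> i \<Longrightarrow> i \<le> part (conj_part l) i \<longleftrightarrow> i \<le> part l i"
  by (rule le_conj_part_iff)

lemma ket_levels_nonneg:
  assumes "0 \<le> k"
  shows "k \<in> ket_levels l {1..pdiag l} \<longleftrightarrow>
    (\<exists>i. k = int (part (conj_part l) i) - int i \<and> 1 \<le> i \<and> 0 \<le> int (part (conj_part l) i) - int i)"
  (is "_ \<longleftrightarrow> ?R")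
proof -
  have "k \<in> ket_levels l {1..pdiag l} \<longleftrightarrow>
      k \<in> (\<lambda>i. int (part (conj_part l) i) - int i) ` {i. 1 \<le> i \<and> i \<le> part l i}"
    unfolding ket_levels_def diag_set using assms by simp
  also have "\<dots> \<longleftrightarrow>
      (\<exists>i. (1 \<le> i \<and> i \<le> part l i) \<and> k = int (part (conj_part l) i) - int i)"
    by (simp only: image_iff Bex_def mem_Collect_eq)
  also have "\<dots> \<longleftrightarrow> ?R"
  proof (rule ex_cong1)
    fix i
    show "((1 \<le> i \<and> i \<le> part l i) \<and> k = int (part (conj_part l) i) - int i) \<longleftrightarrow>
      (k = int (part (conj_part l) i) - int i \<and> 1 \<le> i \<and> 0 \<le> int (part (conj_part l) i) - int i)"
      using le_conj_self_iff[of i l] by linarith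
  qed
  finally show ?thesis .
qed

lemma ket_levels_neg:
  assumes "k < 0"
  shows "k \<notin> ket_levels l {1..pdiag l} \<longleftrightarrow>
    (\<exists>i. - k - 1 = int (part l i) - int i \<and> 1 \<le> i \<and> 0 \<le> int (part l i) - int i)"
  (is "_ \<longleftrightarrow> ?R")
proof -
  let ?P = "(\<lambda>i. int (part (conj_part l) i) - int i) ` {i. 1 \<le> i \<and> i \<le> part l i}"
  let ?H = "(\<lambda>i. int i - int (part l i) - 1) ` {i. 1 \<le> i \<and> i \<le> part l i}"
  have "k \<in> ket_levels l {1..pdiag l} \<longleftrightarrow> (k < 0 \<and> k \<notin> ?H) \<or> k \<in> ?P"
    by (simp only: ket_levels_def diag_set Un_iff Diff_iff mem_Collect_eq)
  moreover have "k \<notin> ?P"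
  proof
    assume "k \<in> (\<lambda>i. int (part (conj_part l) i) - int i) ` {i. 1 \<le> i \<and> i \<le> part l i}"
    then obtain i where "k = int (part (conj_part l) i) - int i" "i \<in> {i. 1 \<le> i \<and> i \<le> part l i}"
      by (rule imageE)
    then show False using le_conj_self_iff[of i l] assms by simp
  qed
  ultimately have "k \<notin> ket_levels l {1..pdiag l} \<longleftrightarrow> k \<in> ?H"
    using assms by (simp only: simp_thms)
  also have "\<dots> \<longleftrightarrow>
      (\<exists>i. (1 \<le> i \<and> i \<le> part l i) \<and> k = int i - int (part l i) - 1)"
    by (simp only: image_iff Bex_def mem_Collect_eq)
  also have "\<dots> \<longleftrightarrow> ?R"
  proof (rule ex_cong1)
    fix i
    show "((1 \<le> i \<and> i \<le> part l i) \<and> k = int i - int (part l i) - 1) \<longleftrightarrow>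
      (- k - 1 = int (part l i) - int i \<and> 1 \<le> i \<and> 0 \<le> int (part l i) - int i)"
      by linarith
  qed
  finally show ?thesis .
qed

lemma strict_part:
  assumes "1 \<le> i" "i < j"
  shows "int (part l j) - int j < int (part l i) - int i"
  using part_mono[of i j l] assms by linarith

lemma ket_levels_arm:
  assumes "ket_levels l {1..pdiag l} = ket_levels m {1..pdiag m}" "1 \<le> i" "i \<le> part l i"
  shows "part m i = part l i"
proof -
  have *: "{int (part l i) - int i | i. 1 \<le> i \<and> 0 \<le> int (part l i) - int i}
      = {x. 0 \<le> x \<and> - x - 1 \<notin> ket_levels l {1..pdiag l}}" for l
  proof (intro set_eqI)
    fix x :: int
    show "x \<in> {int (part l i) - int i | i. 1 \<le> i \<and> 0 \<le> int (part l i) - int i} \<longleftrightarrow>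
      x \<in> {x. 0 \<le> x \<and> - x - 1 \<notin> ket_levels l {1..pdiag l}}"
      using ket_levels_neg[of "- x - 1" l] by (simp only: mem_Collect_eq) force
  qed
  have "int (part m i) - int i = int (part l i) - int i"
  proof (rule strict_decreasing_eq[where f = "\<lambda>i. int (part l i) - int i"
        and g = "\<lambda>i. int (part m i) - int i"])
    show "{int (part l i) - int i | i. 1 \<le> i \<and> 0 \<le> int (part l i) - int i}
      = {int (part m i) - int i | i. 1 \<le> i \<and> 0 \<le> int (part m i) - int i}"
      unfolding * assms(1) ..
  qed (use assms strict_part in auto)
  then show ?thesis by simp
qed

lemma ket_levels_leg:
  assumes "ket_levels l {1..pdiag l} = ket_levels m {1..pdiag m}" "1 \<le> i" "i \<le> part (conj_part l) i"
  shows "part (conj_part m) i = part (conj_part l) i"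
proof -
  have *: "{int (part (conj_part l) i) - int i | i. 1 \<le> i \<and> 0 \<le> int (part (conj_part l) i) - int i}
      = {x. 0 \<le> x \<and> x \<in> ket_levels l {1..pdiag l}}" for l
  proof (intro set_eqI)
    fix x :: int
    show "x \<in> {int (part (conj_part l) i) - int i | i. 1 \<le> i \<and> 0 \<le> int (part (conj_part l) i) - int i} \<longleftrightarrow>
      x \<in> {x. 0 \<le> x \<and> x \<in> ket_levels l {1..pdiag l}}"
      using ket_levels_nonneg[of x l] by (simp only: mem_Collect_eq) blast
  qed
  have "int (part (conj_part m) i) - int i = int (part (conj_part l) i) - int i"
  proof (rule strict_decreasing_eq[where f = "\<lambda>i. int (part (conj_part l) i) - int i"
        and g = "\<lambda>i. int (part (conj_part m) i) - int i"])
    show "{int (part (conj_part l) i) - int i | i. 1 \<le> i \<and> 0 \<le> int (part (conj_part l) i) - int i}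
      = {int (part (conj_part m) i) - int i | i. 1 \<le> i \<and> 0 \<le> int (part (conj_part m) i) - int i}"
      unfolding * assms(1) ..
  qed (use assms strict_part in auto)
  then show ?thesis by simp
qed

lemma ket_levels_inject:
  assumes "ket_levels l {1..pdiag l} = ket_levels m {1..pdiag m}"
  shows "l = m"
proof (rule part_eqI)
  have imp: "j \<le> part m i"
    if eq: "ket_levels l {1..pdiag l} = ket_levels m {1..pdiag m}"
      and ij: "1 \<le> i" "1 \<le> j" "j \<le> part l i" for l m i j
  proof (cases "i \<le> j")
    case True
    then show ?thesis using ket_levels_arm[OF eq, of i] ij by simp
  next
    case False
    have "i \<le> part (conj_part l) j" using ij le_conj_part_iff by blast
    then have "i \<le> part (conj_part m) j" using ket_levels_leg[OF eq, of j] False ij by simp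
    then show ?thesis using ij le_conj_part_iff by blast
  qed
  fix i j :: nat assume "1 \<le> i" "1 \<le> j"
  then show "j \<le> part l i \<longleftrightarrow> j \<le> part m i"
    using imp[OF assms] imp[OF assms[symmetric]] by blast
qed

lemma exists_levels_ket: "\<exists>S. levels S = ket_levels l {1..pdiag l}"
proof -
  let ?D = "ket_levels l {1..pdiag l}"
  have "{k \<in> ?D. 0 \<le> k} \<subseteq> (\<lambda>i. int (part (conj_part l) i) - int i) ` {1..pdiag l}"
    "{k. k < 0 \<and> k \<notin> ?D} \<subseteq> (\<lambda>i. int i - int (part l i) - 1) ` {1..pdiag l}"
    by (auto simp: ket_levels_def)
  then have "finite {k \<in> ?D. 0 \<le> k} \<and> finite {k. k < 0 \<and> k \<notin> ?D}"
    by (meson finite_atLeastAtMost finite_imageI finite_subset)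
  then have "levels (Abs_maya ?D) = ?D"
    by (simp only: Abs_maya_inverse mem_Collect_eq simp_thms)
  then show ?thesis by (rule exI)
qed

lemma bra_ket: "bra l (ket m) = (if l = m then 1 else 0)"
proof -
  obtain c where c: "c * c = 1" "ket l = basis_vec (ket_levels l {1..pdiag l}) c"
    using ket_basis_vec[of l] by (elim exE conjE)
  obtain d where d: "d * d = 1" "ket m = basis_vec (ket_levels m {1..pdiag m}) d"
    using ket_basis_vec[of m] by (elim exE conjE)
  show ?thesis
  proof (cases "l = m")
    case True
    obtain S where S: "levels S = ket_levels l {1..pdiag l}" using exists_levels_ket by blast
    have "bra l (ket l) = (\<Sum>\<^sub>\<infinity>T\<in>{S}. ket l T * ket l T)"
      unfolding bra_def
      by (rule infsum_cong_neutral) (use S in \<open>auto simp: c basis_vec_def levels_inject[symmetric]\<close>)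
    also have "\<dots> = 1" using S c by (simp add: basis_vec_def)
    finally show ?thesis using True by simp
  next
    case False
    then have "ket l S * ket m S = 0" for S
      using ket_levels_inject c d by (auto simp: basis_vec_def)
    then have "bra l (ket m) = 0" unfolding bra_def by (intro infsum_0) simp
    then show ?thesis using False by simp
  qed
qed


section \<open>Exponentials and the S-dual vacuum\<close>

definition op_exp :: "'s opr \<Rightarrow> 's opr" where
  "op_exp A F s = (\<Sum>j. (A ^^ j) F s / fact j)"

text \<open>The operator \<open>c\<close> to the power \<open>A\<close>, that is, the exponential of \<open>A log c\<close>. It is used for
  operators \<open>A\<close> with integral eigenvalues only, so that the branch of the logarithm is irrelevant.\<close>

definition op_pow :: "complex \<Rightarrow> 's opr \<Rightarrow> 's opr" where
  "op_pow c A = op_exp (\<lambda>F s. Ln c * A F s)"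

definition vac_norm :: "complex \<Rightarrow> complex" where
  "vac_norm q = (\<Prod>n. (1 - q ^ Suc n) powr (- of_nat (Suc n) / 2))"

definition S_ket :: "complex \<Rightarrow> maya vec" where
  "S_ket q S = vac_norm q *
     op_exp (\<lambda>F T. - (\<Sum>\<^sub>\<infinity>n\<in>{1..}. a_op (- n) F T / of_int n * (\<Sum>\<^sub>\<infinity>l\<in>{1..}. q powi ((l - 1) * n))))
       (ket empty_part) S"

text \<open>Sign pitfall: \<open>a\<^sub>-\<^sub>1 |0\<rangle>\<close> is minus the one-box state. Consequently \<open>S_ket\<close> has the
  positive coefficient \<open>s\<^sub>l\<^sub>'(1, q, q\<^sup>2, \<dots>)\<close> at \<open>|l\<rangle>\<close>, while \<open>S_bra\<close> has the signed coefficient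
  \<open>(-1)\<^sup>|\<^sup>l\<^sup>| s\<^sub>l(q, q\<^sup>2, \<dots>)\<close> at \<open>\<langle>l|\<close> (both up to \<open>vac_norm\<close>). This sign is the one in the base
  of the first factor of \<open>Phi\<close> below, so the matching power of \<open>L\<^sub>0\<close> has base
  \<open>\<alpha>' q\<^sup>1\<^sup>/\<^sup>2\<close> with \<open>\<alpha>' = q\<^sup>1\<^sup>/\<^sup>2 u\<^sup>-\<^sup>1 v\<^sup>N\<close>; with \<open>- \<alpha>' q\<^sup>1\<^sup>/\<^sup>2\<close> the factorisation of \<open>Phi\<close> would fail
  by \<open>(-1)\<^sup>|\<^sup>l\<^sup>|\<close>, already at the one-box partition.\<close>

definition S_bra :: "complex \<Rightarrow> maya vec \<Rightarrow> complex" where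
  "S_bra q F = vac_norm q * bra empty_part
     (op_exp (\<lambda>F T. \<Sum>\<^sub>\<infinity>n\<in>{1..}. a_op n F T / of_int n * (\<Sum>\<^sub>\<infinity>l\<in>{1..}. q powi (l * n))) F)"


section \<open>Three copies\<close>

type_synonym maya3 = "maya \<times> maya \<times> maya"

definition tensor3 :: "maya vec \<Rightarrow> maya vec \<Rightarrow> maya vec \<Rightarrow> maya3 vec" where
  "tensor3 F G H = (\<lambda>(s, t, u). F s * G t * H u)"

definition on1 :: "maya opr \<Rightarrow> maya3 opr" where
  "on1 A F = (\<lambda>(s, t, u). A (\<lambda>x. F (x, t, u)) s)"

definition on2 :: "maya opr \<Rightarrow> maya3 opr" where
  "on2 A F = (\<lambda>(s, t, u). A (\<lambda>x. F (s, x, u)) t)"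

definition on3 :: "maya opr \<Rightarrow> maya3 opr" where
  "on3 A F = (\<lambda>(s, t, u). A (\<lambda>x. F (s, t, x)) u)"

definition bra3 ::
  "(maya vec \<Rightarrow> complex) \<Rightarrow> (maya vec \<Rightarrow> complex) \<Rightarrow> (maya vec \<Rightarrow> complex) \<Rightarrow> maya3 vec \<Rightarrow> complex" where
  "bra3 f g h F = f (\<lambda>s. g (\<lambda>t. h (\<lambda>u. F (s, t, u))))"


section \<open>The vertex operators\<close>

text \<open>The formal sum \<open>\<Phi>\<^sup>*\<close> is given by its coefficients at \<open>|l\<rangle> \<otimes> |m\<rangle> \<otimes> \<langle>n|\<close>, and
  \<open>\<Phi>\<close> by its coefficients at \<open>\<langle>l| \<otimes> \<langle>m| \<otimes> |n\<rangle>\<close>.\<close>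

definition Phi_star :: "complex \<Rightarrow> int \<Rightarrow> complex \<Rightarrow> complex \<Rightarrow> partition \<Rightarrow> partition \<Rightarrow> partition \<Rightarrow> complex" where
  "Phi_star qh N u v l m n =
     ((- u) powi N / (qh powi (- 1) * v)) ^ psize l * framing qh l powi N *
     (- (qh powi (- 1) * u)) ^ psize m * framing qh m powi (- 1) *
     (qh powi (- 1) * u) powi (- int (psize n)) *
     top_vertex qh (conj_part n) m l"

definition Phi :: "complex \<Rightarrow> int \<Rightarrow> complex \<Rightarrow> complex \<Rightarrow> partition \<Rightarrow> partition \<Rightarrow> partition \<Rightarrow> complex" where
  "Phi qh N u v l m n =
     (- (qh powi (- 1) * u / (- v) powi N)) ^ psize l * framing qh l powi (- N) *
     (qh powi (- 1) * v) powi (- int (psize m)) * framing qh m *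
     (- (qh powi (- 1) * v)) ^ psize n *
     top_vertex qh n (conj_part m) (conj_part l)"

end

theory Submission
  imports Defs
begin

text \<open>The operators \<open>b\<^sub>n\<close>, \<open>w\<close> and \<open>L\<^sub>0\<close> are diagonal on wedges, and the eigenvalues of
  \<open>b\<^sub>n\<close> at \<open>|l\<rangle>\<close> are power sums of \<open>q\<^sup>-\<^sup>l\<^sup>-\<^sup>\<rho>\<close> and of its conjugate. For a fixed state in the first
  copy, the exponent thus becomes \<open>\<Sum> (y\<^sub>n a\<^sub>n + a'\<^sub>-\<^sub>n a\<^sub>n + z\<^sub>n a'\<^sub>-\<^sub>n) / n\<close> with scalars \<open>y\<^sub>n\<close>, \<open>z\<^sub>n\<close>, where
  \<open>a\<close> and \<open>a'\<close> act on the two other copies. All these terms commute, so that the lowering modes \<open>a\<^sub>n\<close>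
  can be transposed onto the initial state. The resulting kernel at \<open>(m, n)\<close> and the kernel
  \<open>\<Sum>\<^sub>e exp (\<Sum> z\<^sub>k a\<^sub>-\<^sub>k / k)\<^sub>m\<^sub>e exp (\<Sum> y\<^sub>k a\<^sub>-\<^sub>k / k)\<^sub>n\<^sub>e\<close> satisfy the same Newton recursion in the
  energy of \<open>m\<close>, thanks to the identity \<open>\<Sum> a\<^sub>-\<^sub>k a\<^sub>k = energy\<close>, which follows from the anticommutation
  relations. The matrix elements of these exponentials are skew Schur functions, because the
  horizontal strip kernel obeys the Newton recursion for one variable and tableaux are chains of
  horizontal strips; the opposite sign of the exponent is reduced to this case by particle-hole
  symmetry.\<close>

section \<open>Locally finite operators\<close>

text \<open>The lowering modes are the obstacle. On a formal vector neither the sum over n in the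
  exponent nor the exponential series need terminate, so the usual rules for exponentials do not
  apply to the exponent as given. Once the second factor is transposed every term raises, and each
  coefficient is a finite sum bounded by the energy of its index. The recursion is of first order
  because the mode of index -k has degree k: commuting with the energy cancels the 1/k in the
  exponent. Kernels are therefore identified by checking a recursion, never by expanding an
  exponential. Dividing by an energy leaves the ground states undetermined, and in charge zero there
  is only one. On signs: the modes are minus sums of fermion bilinears, so power sums enter with
  coefficient -1 where a Schur function is to appear without sign.\<close>

definition delta :: "'s \<Rightarrow> 's vec" where
  "delta m s = (if s = m then 1 else 0)"

text \<open>Row finiteness, with \<open>A (delta m) s\<close> as the entry in row \<open>s\<close>
  and column \<open>m\<close>. Vectors are formal and may have infinite support, so it is the rows,
  not the columns, that have to be finite.\<close>

definition lfin :: "('s vec \<Rightarrow> 't vec) \<Rightarrow> bool" where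
  "lfin A \<longleftrightarrow> (\<forall>s. finite {m. A (delta m) s \<noteq> 0} \<and>
     (\<forall>F. A F s = (\<Sum>m | A (delta m) s \<noteq> 0. A (delta m) s * F m)))"

text \<open>The targets \<open>g s i\<close> may coincide for different \<open>i\<close>; hence
  equal targets are first collected by \<open>sum.image_gen\<close>.\<close>

lemma lfinI:
  assumes "\<And>s. finite (I s)" "\<And>F s. A F s = (\<Sum>i\<in>I s. c s i * F (g s i))"
  shows "lfin A"
  unfolding lfin_def
proof (intro allI conjI)
  fix s
  have sub: "{m. A (delta m) s \<noteq> 0} \<subseteq> g s ` I s"
  proof
    fix m assume "m \<in> {m. A (delta m) s \<noteq> 0}"
    then have "(\<Sum>i\<in>I s. c s i * delta m (g s i)) \<noteq> 0" by (simp add: assms(2))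
    then obtain i where "i \<in> I s" "c s i * delta m (g s i) \<noteq> 0" 
      by (rule sum.not_neutral_contains_not_neutral)
    then show "m \<in> g s ` I s" by (auto simp: delta_def split: if_splits)
  qed
  then show "finite {m. A (delta m) s \<noteq> 0}" using assms(1) finite_surj by blast
  fix F
  have "A F s = (\<Sum>m\<in>g s ` I s. \<Sum>i | i \<in> I s \<and> g s i = m. c s i * F (g s i))"
    unfolding assms(2) by (rule sum.image_gen[OF assms(1)])
  also have "\<dots> = (\<Sum>m\<in>g s ` I s. A (delta m) s * F m)"
  proof (rule sum.cong[OF refl])
    fix m
    have "A (delta m) s * F m = (\<Sum>i\<in>I s. if g s i = m then c s i * F (g s i) else 0)"
      unfolding assms(2) sum_distrib_right by (rule sum.cong) (auto simp: delta_def)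
    also have "\<dots> = (\<Sum>i | i \<in> I s \<and> g s i = m. c s i * F (g s i))"
      by (rule sum.inter_filter[OF assms(1), symmetric])
    finally show "(\<Sum>i | i \<in> I s \<and> g s i = m. c s i * F (g s i)) = A (delta m) s * F m" ..
  qed
  also have "\<dots> = (\<Sum>m | A (delta m) s \<noteq> 0. A (delta m) s * F m)"
    by (rule sum.mono_neutral_right) (use assms(1) sub in auto)
  finally show "A F s = (\<Sum>m | A (delta m) s \<noteq> 0. A (delta m) s * F m)" .
qed

lemma lfin_finite: "lfin A \<Longrightarrow> finite {m. A (delta m) s \<noteq> 0}"
  unfolding lfin_def by blast

lemma lfin_eval: "lfin A \<Longrightarrow> A F s = (\<Sum>m | A (delta m) s \<noteq> 0. A (delta m) s * F m)"
  unfolding lfin_def by blast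

lemma lfin_cong: "lfin A \<Longrightarrow> (\<And>m. A (delta m) s \<noteq> 0 \<Longrightarrow> F m = G m) \<Longrightarrow> A F s = A G s"
  unfolding lfin_eval[of A F] lfin_eval[of A G] by (auto intro: sum.cong)

lemma lfin_sum_apply:
  assumes "lfin A"
  shows "A (\<lambda>x. \<Sum>i\<in>I. F i x) s = (\<Sum>i\<in>I. A (F i) s)"
proof -
  have "A (\<lambda>x. \<Sum>i\<in>I. F i x) s = (\<Sum>m | A (delta m) s \<noteq> 0. \<Sum>i\<in>I. A (delta m) s * F i m)"
    by (subst lfin_eval[OF assms]) (simp add: sum_distrib_left)
  also have "\<dots> = (\<Sum>i\<in>I. \<Sum>m | A (delta m) s \<noteq> 0. A (delta m) s * F i m)"
    by (rule sum.swap)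
  finally show ?thesis by (simp flip: lfin_eval[OF assms])
qed

lemma lfin_scale: "lfin A \<Longrightarrow> A (\<lambda>x. c * F x) s = c * A F s"
  by (simp add: lfin_eval[of A "\<lambda>x. c * F x"] lfin_eval[of A F] sum_distrib_left ac_simps)

lemma lfin_add: "lfin A \<Longrightarrow> A (\<lambda>x. F x + G x) s = A F s + A G s"
  by (simp add: lfin_eval[of A "\<lambda>x. F x + G x"] lfin_eval[of A F] lfin_eval[of A G]
      sum.distrib distrib_left)

lemma lfin_zero: "lfin A \<Longrightarrow> A (\<lambda>x. 0) s = 0"
  by (simp add: lfin_eval[of A "\<lambda>x. 0"])

text \<open>Two finite sums are exchanged. This lets a mode that acts on the initial state of an
  exponential pass through the exponential.\<close>

lemma lfin_swap:
  assumes "lfin A" "lfin B"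
  shows "A (\<lambda>t. B (\<lambda>u. F t u) u) t = B (\<lambda>u. A (\<lambda>t. F t u) t) u"
proof -
  have "A (\<lambda>t. B (\<lambda>u. F t u) u) t =
      (\<Sum>m | A (delta m) t \<noteq> 0. \<Sum>p | B (delta p) u \<noteq> 0. A (delta m) t * (B (delta p) u * F m p))"
    by (subst lfin_eval[OF assms(1)], subst lfin_eval[OF assms(2)]) (simp add: sum_distrib_left)
  also have "\<dots> = (\<Sum>p | B (delta p) u \<noteq> 0. \<Sum>m | A (delta m) t \<noteq> 0. A (delta m) t * (B (delta p) u * F m p))"
    by (rule sum.swap)
  also have "\<dots> = B (\<lambda>u. A (\<lambda>t. F t u) t) u"
    by (subst lfin_eval[OF assms(2), of "\<lambda>u. A (\<lambda>t. F t u) t"], subst lfin_eval[OF assms(1)])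
      (simp add: sum_distrib_left ac_simps)
  finally show ?thesis .
qed

lemma lfin_id: "lfin (\<lambda>F. F)"
  by (rule lfinI[where I = "\<lambda>s. {s}" and c = "\<lambda>_ _. 1" and g = "\<lambda>_ i. i"]) auto

lemma lfin_comp:
  assumes "lfin A" "lfin B"
  shows "lfin (\<lambda>F. A (B F))"
proof (rule lfinI[where I = "\<lambda>s. SIGMA m:{m. A (delta m) s \<noteq> 0}. {p. B (delta p) m \<noteq> 0}"
      and c = "\<lambda>s (m, p). A (delta m) s * B (delta p) m" and g = "\<lambda>_. snd"])
  show "A (B F) s = (\<Sum>i\<in>(SIGMA m:{m. A (delta m) s \<noteq> 0}. {p. B (delta p) m \<noteq> 0}).
      (case i of (m, p) \<Rightarrow> A (delta m) s * B (delta p) m) * F (snd i))" for F s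
    by (subst lfin_eval[OF assms(1)], subst lfin_eval[OF assms(2)])
      (simp add: sum_distrib_left sum.Sigma lfin_finite assms split_def ac_simps)
qed (simp add: lfin_finite assms)

text \<open>The index set may vary with the row; sums truncated at the energy of the row have this
  form.\<close>

lemma lfin_wsum:
  assumes "\<And>s. finite (K s)" "\<And>s k. k \<in> K s \<Longrightarrow> lfin (A k)"
  shows "lfin (\<lambda>F s. \<Sum>k\<in>K s. c s k * A k F s)"
proof (rule lfinI[where I = "\<lambda>s. SIGMA k:K s. {p. A k (delta p) s \<noteq> 0}"
      and c = "\<lambda>s (k, p). c s k * A k (delta p) s" and g = "\<lambda>_. snd"])
  show "(\<Sum>k\<in>K s. c s k * A k F s) = (\<Sum>i\<in>(SIGMA k:K s. {p. A k (delta p) s \<noteq> 0}).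
      (case i of (k, p) \<Rightarrow> c s k * A k (delta p) s) * F (snd i))" for F s
  proof -
    have "(\<Sum>k\<in>K s. c s k * A k F s) =
        (\<Sum>k\<in>K s. \<Sum>p | A k (delta p) s \<noteq> 0. c s k * A k (delta p) s * F p)"
      by (rule sum.cong[OF refl], subst lfin_eval[OF assms(2)], assumption)
        (simp add: sum_distrib_left ac_simps)
    also have "\<dots> = (\<Sum>(k, p)\<in>(SIGMA k:K s. {p. A k (delta p) s \<noteq> 0}). c s k * A k (delta p) s * F p)"
      using assms by (intro sum.Sigma) (auto simp: lfin_finite)
    finally show ?thesis by (simp add: split_def)
  qed
qed (use assms in \<open>auto simp: lfin_finite\<close>)

lemma lfin_pow: "lfin (A :: 's opr) \<Longrightarrow> lfin (A ^^ j)"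
proof (induction j)
  case 0
  have "A ^^ 0 = (\<lambda>F. F)" by auto
  then show ?case using lfin_id by metis
next
  case (Suc j)
  then show ?case using lfin_comp[of A "A ^^ j"] by (simp add: comp_def)
qed

lemma lfin_plus:
  assumes "lfin A" "lfin B"
  shows "lfin (\<lambda>F s. A F s + B F s)"
proof -
  have "lfin (\<lambda>F s. \<Sum>k\<in>{False, True}. 1 * (if k then A else B) F s)"
    by (rule lfin_wsum) (use assms in auto)
  then show ?thesis by (simp add: add.commute)
qed

lemma lfin_mult:
  assumes "lfin A"
  shows "lfin (\<lambda>F s. c s * A F s)"
  using lfin_wsum[of "\<lambda>_. {()}" "\<lambda>_. A" "\<lambda>s _. c s"] assms by simp

lemma pow_comm:
  assumes "\<And>F. B (A F) = A (B F)"
  shows "B ((A ^^ j) F) = (A ^^ j) (B F)"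
  by (induction j) (simp_all add: assms)


section \<open>Exponentials of locally nilpotent operators\<close>

text \<open>Every column met in row \<open>s\<close> has smaller weight, so the powers of
  \<open>A\<close> vanish in row \<open>s\<close> from exponent \<open>W s + 1\<close> on. The
  exponential is then a finite sum in each row, although \<open>A\<close> need not be
  nilpotent.\<close>

definition causal :: "('s \<Rightarrow> nat) \<Rightarrow> 's opr \<Rightarrow> bool" where
  "causal W A \<longleftrightarrow> lfin A \<and> (\<forall>s m. A (delta m) s \<noteq> 0 \<longrightarrow> W m < W s)"

lemma causal_lfin: "causal W A \<Longrightarrow> lfin A"
  by (simp add: causal_def)

text \<open>Each application of \<open>A\<close> raises by one the weight below which the vector
  vanishes.\<close>

lemma causal_pow_below:
  assumes "causal W A" "\<And>x. W x < c \<Longrightarrow> F x = 0" "W s < c + j"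
  shows "(A ^^ j) F s = 0"
  using assms(3)
proof (induction j arbitrary: s)
  case (Suc j)
  have "A ((A ^^ j) F) s = A (\<lambda>x. 0) s"
  proof (rule lfin_cong[OF causal_lfin[OF assms(1)]])
    fix m assume "A (delta m) s \<noteq> 0"
    then have "W m < W s" using assms(1) by (simp add: causal_def)
    then show "(A ^^ j) F m = 0" using Suc by simp
  qed
  then show ?case using causal_lfin[OF assms(1)] by (simp add: lfin_zero)
qed (use assms(2) in simp)

lemma causal_pow_zero: "causal W A \<Longrightarrow> W s < j \<Longrightarrow> (A ^^ j) F s = 0"
  using causal_pow_below[of W A 0 F s j] by simp

lemma op_exp_finite:
  assumes "causal W A" "W s \<le> K"
  shows "op_exp A F s = (\<Sum>j\<le>K. (A ^^ j) F s / fact j)"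
  unfolding op_exp_def
  by (rule suminf_finite) (use assms causal_pow_zero[of W A s] in \<open>auto simp: not_le\<close>)

lemma lfin_op_exp:
  assumes "causal W A"
  shows "lfin (op_exp A)"
proof -
  have "op_exp A = (\<lambda>F s. \<Sum>j\<in>{..W s}. 1 / fact j * (A ^^ j) F s)"
    by (intro ext) (simp add: op_exp_finite[OF assms order_refl])
  moreover have "lfin \<dots>"
    by (rule lfin_wsum) (use assms in \<open>auto simp: lfin_pow causal_def\<close>)
  ultimately show ?thesis by simp
qed

text \<open>\<open>B\<close> reads only finitely many coefficients in row \<open>s\<close>, so one
  truncation of the series serves all of them. The bound holds for all larger \<open>K\<close>, so
  that it can be combined with other bounds.\<close>

lemma lfin_op_exp_terms:
  assumes "causal W A" "lfin B"
  obtains K0 where "\<And>K. K0 \<le> K \<Longrightarrow> B (op_exp A F) s = (\<Sum>j\<le>K. B ((A ^^ j) F) s / fact j)"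
proof
  let ?K0 = "Max (insert 0 (W ` {m. B (delta m) s \<noteq> 0}))"
  fix K assume K: "?K0 \<le> K"
  have "B (op_exp A F) s = B (\<lambda>x. \<Sum>j\<le>K. (1 / fact j) * (A ^^ j) F x) s"
  proof (rule lfin_cong[OF assms(2)])
    fix m assume m: "B (delta m) s \<noteq> 0"
    have "W m \<le> ?K0" by (rule Max_ge) (use m lfin_finite[OF assms(2)] in auto)
    then show "op_exp A F m = (\<Sum>j\<le>K. (1 / fact j) * (A ^^ j) F m)"
      using K by (simp add: op_exp_finite[OF assms(1), of m K])
  qed
  then show "B (op_exp A F) s = (\<Sum>j\<le>K. B ((A ^^ j) F) s / fact j)"
    by (simp only: lfin_sum_apply[OF assms(2)] lfin_scale[OF assms(2)]) simp
qed

lemma op_exp_comm: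
  assumes "causal W A" "lfin B" "\<And>F. B (A F) = A (B F)"
  shows "B (op_exp A F) = op_exp A (B F)"
proof
  fix s
  obtain K0 where K0: "\<And>K. K0 \<le> K \<Longrightarrow> B (op_exp A F) s = (\<Sum>j\<le>K. B ((A ^^ j) F) s / fact j)"
    using lfin_op_exp_terms[OF assms(1,2), where F = F and s = s] by blast
  have "B (op_exp A F) s = (\<Sum>j\<le>max K0 (W s). B ((A ^^ j) F) s / fact j)"
    by (rule K0) simp
  also have "\<dots> = op_exp A (B F) s"
    by (simp add: op_exp_finite[OF assms(1), of s "max K0 (W s)"] pow_comm[where B = B and A = A] assms(3))
  finally show "B (op_exp A F) s = op_exp A (B F) s" .
qed

text \<open>Let D be multiplication by \<open>d\<close>. The commutator of D with \<open>A\<close>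
  is \<open>A'\<close>, which commutes with \<open>A\<close>, so that of D with the j-th power is j
  times \<open>A'\<close> times the power j - 1, as for a derivative. Dividing by j! gives
  \<open>A'\<close> times the exponential.\<close>

lemma op_exp_deriv:
  assumes "causal W A" "lfin A'" "\<And>F. A' (A F) = A (A' F)"
    and d: "\<And>F s. d s * A F s = A (\<lambda>x. d x * F x) s + A' F s"
  shows "d s * op_exp A F s = op_exp A (\<lambda>x. d x * F x) s + A' (op_exp A F) s"
proof -
  have pow: "d s * (A ^^ j) F s =
      (A ^^ j) (\<lambda>x. d x * F x) s + of_nat j * (A ^^ (j - 1)) (A' F) s" for j s
  proof (induction j arbitrary: s)
    case (Suc j)
    have "d s * (A ^^ Suc j) F s = A (\<lambda>x. d x * (A ^^ j) F x) s + A' ((A ^^ j) F) s"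
      by (simp add: d)
    also have "(\<lambda>x. d x * (A ^^ j) F x) =
        (\<lambda>x. (A ^^ j) (\<lambda>x. d x * F x) x + of_nat j * (A ^^ (j - 1)) (A' F) x)"
      using Suc by (intro ext)
    also have "A \<dots> s = (A ^^ Suc j) (\<lambda>x. d x * F x) s + of_nat j * A ((A ^^ (j - 1)) (A' F)) s"
      by (simp only: lfin_add[OF causal_lfin[OF assms(1)]] lfin_scale[OF causal_lfin[OF assms(1)]]
          funpow.simps comp_apply)
    also have "of_nat j * A ((A ^^ (j - 1)) (A' F)) s = of_nat j * (A ^^ j) (A' F) s"
      by (cases j) auto
    also have "A' ((A ^^ j) F) s = (A ^^ j) (A' F) s"
      by (simp add: pow_comm[where B = A' and A = A] assms(3))
    finally show ?case by (simp add: algebra_simps)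
  qed simp
  obtain K0 where K0: "\<And>K. K0 \<le> K \<Longrightarrow> A' (op_exp A F) s = (\<Sum>j\<le>K. A' ((A ^^ j) F) s / fact j)"
    using lfin_op_exp_terms[OF assms(1,2), where F = F and s = s] by blast
  define K where "K = max K0 (W s)"
  \<comment> \<open>The limit \<open>Suc K\<close> becomes \<open>K\<close> when the term j = 0
    drops out of the second sum and its index is shifted.\<close>
  have "d s * op_exp A F s = (\<Sum>j\<le>Suc K. d s * (A ^^ j) F s / fact j)"
    by (simp add: op_exp_finite[OF assms(1), of s "Suc K"] K_def sum_distrib_left algebra_simps del: sum.atMost_Suc)
  also have "\<dots> = (\<Sum>j\<le>Suc K. (A ^^ j) (\<lambda>x. d x * F x) s / fact j)
      + (\<Sum>j\<le>Suc K. of_nat j * (A ^^ (j - 1)) (A' F) s / fact j)"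
    by (simp only: pow add_divide_distrib sum.distrib)
  also have "(\<Sum>j\<le>Suc K. of_nat j * (A ^^ (j - 1)) (A' F) s / fact j)
      = (\<Sum>j\<le>K. (A ^^ j) (A' F) s / fact j)"
    by (subst sum.atMost_Suc_shift) (simp add: field_simps del: of_nat_Suc)
  also have "\<dots> = A' (op_exp A F) s"
    using K0[of K] by (simp add: K_def pow_comm[where B = A' and A = A] assms(3))
  also have "(\<Sum>j\<le>Suc K. (A ^^ j) (\<lambda>x. d x * F x) s / fact j) = op_exp A (\<lambda>x. d x * F x) s"
    by (rule op_exp_finite[OF assms(1), symmetric]) (simp add: K_def)
  finally show ?thesis .
qed

lemma op_exp_bottom:
  assumes "causal W A" "\<And>x. W x < W s \<Longrightarrow> F x = 0"
  shows "op_exp A F s = F s"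
proof -
  have "(A ^^ Suc j) F s = 0" for j
    by (rule causal_pow_below[OF assms(1), of "W s"]) (use assms(2) in auto)
  then have "(\<Sum>j\<le>W s. (A ^^ j) F s / fact j) = (\<Sum>j\<le>W s. if j = 0 then F s else 0)"
    by (intro sum.cong refl) (auto simp: gr0_conv_Suc simp del: funpow.simps)
  then show ?thesis by (simp add: op_exp_finite[OF assms(1) order_refl])
qed

lemma op_exp_diag:
  assumes "\<And>F s. A F s = d s * F s"
  shows "op_exp A F s = exp (d s) * F s"
proof -
  have "(A ^^ j) F s = d s ^ j * F s" for j
    by (induction j) (simp_all add: assms)
  moreover have "(\<lambda>j. d s ^ j / fact j * F s) sums (exp (d s) * F s)"
    using sums_mult2[OF exp_converges[of "d s"], of "F s"] by (simp add: scaleR_conv_of_real field_simps)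
  ultimately show ?thesis by (simp add: op_exp_def sums_iff)
qed

text \<open>A formal sum over all k from 1 on. In the uses below the modes beyond \<open>W s\<close>
  vanish in row \<open>s\<close>, so the cut loses nothing and keeps the rows finite;
  \<open>wsum_eq\<close> moves the cut upwards.\<close>

definition wsum :: "('s \<Rightarrow> nat) \<Rightarrow> (nat \<Rightarrow> 's opr) \<Rightarrow> 's opr" where
  "wsum W A F s = (\<Sum>k=1..W s. A k F s)"

lemma wsum_eq:
  assumes "W s \<le> K" "\<And>k. W s < k \<Longrightarrow> A k F s = 0"
  shows "wsum W A F s = (\<Sum>k=1..K. A k F s)"
  unfolding wsum_def by (rule sum.mono_neutral_left) (use assms in auto)

lemma lfin_wsum': "(\<And>k. 1 \<le> k \<Longrightarrow> lfin (A k)) \<Longrightarrow> lfin (wsum W A)"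
  using lfin_wsum[of "\<lambda>s. {1..W s}" A "\<lambda>_ _. 1"] by (simp add: wsum_def[abs_def])

lemma lfin_wsum_terms:
  fixes W :: "'s \<Rightarrow> nat" and A :: "nat \<Rightarrow> 's opr"
  assumes "lfin B" "\<And>k F s. 1 \<le> k \<Longrightarrow> W s < k \<Longrightarrow> A k F s = 0"
  obtains K0 where "\<And>K. K0 \<le> K \<Longrightarrow> B (\<lambda>x. \<Sum>k=1..W x. A k (F k) x) s = (\<Sum>k=1..K. B (A k (F k)) s)"
proof
  let ?K0 = "Max (insert 0 (W ` {m. B (delta m) s \<noteq> 0}))"
  fix K assume K: "?K0 \<le> K"
  have "B (\<lambda>x. \<Sum>k=1..W x. A k (F k) x) s = B (\<lambda>x. \<Sum>k=1..K. A k (F k) x) s"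
  proof (rule lfin_cong[OF assms(1)])
    fix m assume m: "B (delta m) s \<noteq> 0"
    have "W m \<le> ?K0" by (rule Max_ge) (use m lfin_finite[OF assms(1)] in auto)
    then show "(\<Sum>k=1..W m. A k (F k) m) = (\<Sum>k=1..K. A k (F k) m)"
      using K assms(2) by (intro sum.mono_neutral_left) auto
  qed
  then show "B (\<lambda>x. \<Sum>k=1..W x. A k (F k) x) s = (\<Sum>k=1..K. B (A k (F k)) s)"
    by (simp only: lfin_sum_apply[OF assms(1)])
qed

text \<open>The argument \<open>F k\<close> may vary with the mode; \<open>pair_exp\<close> applies
  mode \<open>k\<close> to a vector that already contains mode \<open>k\<close>.\<close>

lemma lfin_wsum_comm:
  fixes A :: "nat \<Rightarrow> 's opr"
  assumes "lfin B" "\<And>k F s. 1 \<le> k \<Longrightarrow> W s < k \<Longrightarrow> A k F s = 0"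
    and "\<And>k F. 1 \<le> k \<Longrightarrow> B (A k F) = A k (B F)"
  shows "B (\<lambda>x. \<Sum>k=1..W x. A k (F k) x) = (\<lambda>s. \<Sum>k=1..W s. A k (B (F k)) s)"
proof
  fix s
  obtain K0 where K0: "\<And>K. K0 \<le> K \<Longrightarrow>
      B (\<lambda>x. \<Sum>k=1..W x. A k (F k) x) s = (\<Sum>k=1..K. B (A k (F k)) s)"
    using lfin_wsum_terms[where B = B and A = A and W = W and F = F and s = s] assms(1,2) by blast
  have "B (\<lambda>x. \<Sum>k=1..W x. A k (F k) x) s = (\<Sum>k=1..max K0 (W s). A k (B (F k)) s)"
    by (subst K0[of "max K0 (W s)"]) (simp_all add: assms(3))
  also have "\<dots> = (\<Sum>k=1..W s. A k (B (F k)) s)"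
    by (rule sum.mono_neutral_right) (use assms(2) in auto)
  finally show "B (\<lambda>x. \<Sum>k=1..W x. A k (F k) x) s = (\<Sum>k=1..W s. A k (B (F k)) s)" .
qed

lemma wsum_comm:
  fixes A :: "nat \<Rightarrow> 's opr"
  assumes "lfin B" "\<And>k F s. 1 \<le> k \<Longrightarrow> W s < k \<Longrightarrow> A k F s = 0"
    and "\<And>k F. 1 \<le> k \<Longrightarrow> B (A k F) = A k (B F)"
  shows "B (wsum W A F) = wsum W A (B F)"
  unfolding wsum_def[abs_def]
  by (rule lfin_wsum_comm[where B = B and A = A and F = "\<lambda>_. F"]) (use assms in auto)

lemma causal_wsum:
  assumes "\<And>k. 1 \<le> k \<Longrightarrow> causal W (A k)"
  shows "causal W (wsum W A)"
  unfolding causal_def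
proof (intro conjI allI impI)
  show "lfin (wsum W A)" using assms by (intro lfin_wsum') (auto simp: causal_def)
  fix s m assume "wsum W A (delta m) s \<noteq> 0"
  then obtain k where "k \<in> {1..W s}" "A k (delta m) s \<noteq> 0"
    unfolding wsum_def by (metis (no_types, lifting) sum.neutral)
  then show "W m < W s" using assms[of k] by (auto simp: causal_def)
qed

section \<open>Commuting operators\<close>

definition comm :: "'s opr \<Rightarrow> 's opr \<Rightarrow> bool" where
  "comm A B \<longleftrightarrow> (\<forall>F. A (B F) = B (A F))"

lemma comm_sym: "comm A B \<Longrightarrow> comm B A"
  by (simp add: comm_def)

lemma comm_comp: "comm C A \<Longrightarrow> comm C B \<Longrightarrow> comm C (\<lambda>F. A (B F))"
  by (simp add: comm_def)

lemma comm_add: "lfin C \<Longrightarrow> comm C A \<Longrightarrow> comm C B \<Longrightarrow> comm C (\<lambda>F s. A F s + B F s)"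
  by (simp add: comm_def lfin_add fun_eq_iff)

lemma comm_scale: "lfin C \<Longrightarrow> comm C A \<Longrightarrow> comm C (\<lambda>F s. c * A F s)"
  by (simp add: comm_def lfin_scale fun_eq_iff)

lemma comm_wsum:
  assumes "lfin C" "\<And>k F s. 1 \<le> k \<Longrightarrow> W s < k \<Longrightarrow> A k F s = 0" "\<And>k. 1 \<le> k \<Longrightarrow> comm C (A k)"
  shows "comm C (wsum W A)"
  unfolding comm_def
proof
  fix F
  show "C (wsum W A F) = wsum W A (C F)"
  proof (rule wsum_comm[where B = C and A = A])
    show "C (A k F) = A k (C F)" if "1 \<le> k" for k F
      using assms(3)[OF that] by (simp add: comm_def)
  qed (fact assms)+
qed


section \<open>Exponentials of commuting raising operators\<close>

text \<open>An abstract form of the modes \<open>a_op (- k)\<close>: the state \<open>m\<close> is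
  taken to states of energy \<open>E m + k\<close>. The theory of the exponentials rests on this
  grading and on commutativity; fermions enter only with the interpretation.\<close>

locale raising =
  fixes a :: "nat \<Rightarrow> 's opr" and E :: "'s \<Rightarrow> nat"
  assumes lfin_a: "1 \<le> k \<Longrightarrow> lfin (a k)"
    and a_shift: "1 \<le> k \<Longrightarrow> a k (delta m) s \<noteq> 0 \<Longrightarrow> E s = E m + k"
    and a_comm: "1 \<le> j \<Longrightarrow> 1 \<le> k \<Longrightarrow> comm (a j) (a k)"
begin

lemma a_zero:
  assumes "1 \<le> k" "E s < k"
  shows "a k F s = 0"
proof -
  have "a k (delta m) s = 0" for m using a_shift[of k m s] assms by auto
  then show ?thesis by (subst lfin_eval[OF lfin_a[OF assms(1)]]) simp
qed

text \<open>The grading in operator form: the commutator of the energy with \<open>a k\<close> is k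
  times \<open>a k\<close>.\<close>

lemma a_weight:
  assumes "1 \<le> k"
  shows "of_nat (E s) * a k F s = a k (\<lambda>x. of_nat (E x) * F x) s + of_nat k * a k F s"
proof -
  have "a k (\<lambda>x. of_nat (E x) * F x) s =
      (\<Sum>m | a k (delta m) s \<noteq> 0. (of_nat (E s) - of_nat k) * (a k (delta m) s * F m))"
    by (subst lfin_eval[OF lfin_a[OF assms]], rule sum.cong) (auto dest!: a_shift[OF assms])
  also have "\<dots> = (of_nat (E s) - of_nat k) * a k F s"
    by (subst lfin_eval[OF lfin_a[OF assms], of F]) (simp add: sum_distrib_left)
  finally show ?thesis by (simp add: algebra_simps)
qed

definition rsum :: "(nat \<Rightarrow> complex) \<Rightarrow> 's opr" where
  "rsum z = wsum E (\<lambda>k F s. z k * a k F s)"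

text \<open>The creation half of a vertex operator. Division by \<open>k\<close> compensates the
  degree of \<open>a k\<close>, so that commuting with the energy returns the coefficients
  \<open>z k\<close>, as in \<open>vexp_deriv\<close>.\<close>

definition vexp :: "(nat \<Rightarrow> complex) \<Rightarrow> 's opr" where
  "vexp z = op_exp (rsum (\<lambda>k. z k / of_nat k))"

lemma rsum_eq: "E s \<le> K \<Longrightarrow> rsum z F s = (\<Sum>k=1..K. z k * a k F s)"
  unfolding rsum_def by (rule wsum_eq) (simp_all add: a_zero)

lemma causal_rsum: "causal E (rsum z)"
  unfolding rsum_def
proof (rule causal_wsum)
  fix k :: nat assume k: "1 \<le> k"
  show "causal E (\<lambda>F s. z k * a k F s)"
    unfolding causal_def
  proof (intro conjI allI impI)
    show "lfin (\<lambda>F s. z k * a k F s)" by (rule lfin_mult[OF lfin_a[OF k]])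
    fix s m assume "z k * a k (delta m) s \<noteq> 0"
    then have "a k (delta m) s \<noteq> 0" by simp
    then show "E m < E s" using a_shift[OF k] k by fastforce
  qed
qed

lemma lfin_rsum: "lfin (rsum z)"
  by (rule causal_lfin[OF causal_rsum])

lemma lfin_vexp: "lfin (vexp z)"
  unfolding vexp_def by (rule lfin_op_exp[OF causal_rsum])

lemma comm_rsum:
  assumes "lfin C" "\<And>k. 1 \<le> k \<Longrightarrow> comm C (a k)"
  shows "comm C (rsum z)"
  unfolding rsum_def by (rule comm_wsum) (use assms in \<open>auto simp: a_zero intro: comm_scale\<close>)

lemma comm_rsum_rsum: "comm (rsum z) (rsum z')"
proof (rule comm_rsum[OF lfin_rsum])
  fix k :: nat assume k: "1 \<le> k"
  show "comm (rsum z) (a k)"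
    by (rule comm_sym, rule comm_rsum[OF lfin_a[OF k]]) (rule a_comm[OF k])
qed

lemma vexp_a: "1 \<le> k \<Longrightarrow> a k (vexp z F) = vexp z (a k F)"
  unfolding vexp_def
  by (rule op_exp_comm[OF causal_rsum lfin_a])
    (use comm_rsum[OF lfin_a[of k] a_comm[of k]] in \<open>auto simp: comm_def\<close>)

lemma vexp_rsum: "vexp z (rsum z' F) = rsum z' (vexp z F)"
  unfolding vexp_def
  by (rule op_exp_comm[OF causal_rsum lfin_rsum, symmetric])
    (use comm_rsum_rsum in \<open>auto simp: comm_def\<close>)

lemma rsum_add: "rsum (\<lambda>k. z k + z' k) F s = rsum z F s + rsum z' F s"
  by (simp add: rsum_eq[OF order_refl] sum.distrib distrib_right)

lemma vexp_deriv:
  "of_nat (E s) * vexp z F s = vexp z (\<lambda>x. of_nat (E x) * F x) s + rsum z (vexp z F) s"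
  unfolding vexp_def
proof (rule op_exp_deriv[OF causal_rsum lfin_rsum])
  show "rsum z (rsum z' F) = rsum z' (rsum z F)" for z' F
    using comm_rsum_rsum by (simp add: comm_def)
  fix F s
  have "of_nat (E s) * rsum (\<lambda>k. z k / of_nat k) F s
      = (\<Sum>k=1..E s. z k / of_nat k * (of_nat (E s) * a k F s))"
    by (simp add: rsum_eq[OF order_refl] sum_distrib_left ac_simps)
  also have "\<dots> = (\<Sum>k=1..E s. z k / of_nat k * a k (\<lambda>x. of_nat (E x) * F x) s + z k * a k F s)"
    by (rule sum.cong) (auto simp: a_weight field_simps)
  finally show "of_nat (E s) * rsum (\<lambda>k. z k / of_nat k) F s
      = rsum (\<lambda>k. z k / of_nat k) (\<lambda>x. of_nat (E x) * F x) s + rsum z F s"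
    by (simp add: rsum_eq[OF order_refl] sum.distrib)
qed

lemma vexp_bottom: "(\<And>x. E x < E s \<Longrightarrow> F x = 0) \<Longrightarrow> vexp z F s = F s"
  unfolding vexp_def by (rule op_exp_bottom[OF causal_rsum])

lemma vexp_delta_below: "E s \<le> E e \<Longrightarrow> vexp z (delta e) s = delta e s"
proof (rule vexp_bottom)
  fix x assume "E s \<le> E e" "E x < E s"
  then show "delta e x = 0" by (auto simp: delta_def)
qed

text \<open>A basis vector is an eigenvector of the energy, which turns \<open>vexp_deriv\<close>
  into a recursion for a single column: the right side involves only states of smaller energy than
  \<open>s\<close>.\<close>

lemma vexp_delta_deriv:
  "(of_nat (E s) - of_nat (E e)) * vexp z (delta e) s = rsum z (vexp z (delta e)) s"
proof -
  have "(\<lambda>x. of_nat (E x) * delta e x) = (\<lambda>x. of_nat (E e) * delta e x)"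
    by (auto simp: delta_def)
  then show ?thesis
    using vexp_deriv[of s z "delta e"] by (simp add: lfin_scale[OF lfin_vexp] algebra_simps)
qed

lemma rsum_cong:
  assumes "\<And>m k. 1 \<le> k \<Longrightarrow> a k (delta m) s \<noteq> 0 \<Longrightarrow> F m = G m"
  shows "rsum z F s = rsum z G s"
proof -
  have "a k F s = a k G s" if "1 \<le> k" for k
    by (rule lfin_cong[OF lfin_a[OF that]]) (rule assms[OF that])
  then show ?thesis by (simp add: rsum_eq[OF order_refl])
qed

end


section \<open>Pairs of states\<close>

definition lift1 :: "'s opr \<Rightarrow> ('s \<times> 't) opr" where
  "lift1 A F = (\<lambda>(t, u). A (\<lambda>t. F (t, u)) t)"

definition lift2 :: "'t opr \<Rightarrow> ('s \<times> 't) opr" where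
  "lift2 A F = (\<lambda>(t, u). A (\<lambda>u. F (t, u)) u)"

lemma lift1_apply: "lift1 A F (t, u) = A (\<lambda>t. F (t, u)) t"
  by (simp add: lift1_def)

lemma lift2_apply: "lift2 A F (t, u) = A (\<lambda>u. F (t, u)) u"
  by (simp add: lift2_def)

lemma delta_pair: "delta (m, p) (t, u) = delta m t * delta p u"
  by (simp add: delta_def)

lemma lfin_lift1:
  assumes "lfin A"
  shows "lfin (lift1 A)"
proof (rule lfinI[where I = "\<lambda>(t, u). {m. A (delta m) t \<noteq> 0}" and c = "\<lambda>(t, u) m. A (delta m) t"
      and g = "\<lambda>(t, u) m. (m, u)"])
  fix s :: "'a \<times> 'b" and F
  obtain t u where s: "s = (t, u)" by fastforce
  show "finite (case s of (t, u) \<Rightarrow> {m. A (delta m) t \<noteq> 0})"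
    by (simp add: s lfin_finite assms)
  show "lift1 A F s = (\<Sum>m\<in>(case s of (t, u) \<Rightarrow> {m. A (delta m) t \<noteq> 0}).
      (case s of (t, u) \<Rightarrow> \<lambda>m. A (delta m) t) m * F ((case s of (t, u) \<Rightarrow> \<lambda>m. (m, u)) m))"
    unfolding s lift1_apply prod.case by (rule lfin_eval[OF assms])
qed

lemma lfin_lift2:
  assumes "lfin A"
  shows "lfin (lift2 A)"
proof (rule lfinI[where I = "\<lambda>(t, u). {m. A (delta m) u \<noteq> 0}" and c = "\<lambda>(t, u) m. A (delta m) u"
      and g = "\<lambda>(t, u) m. (t, m)"])
  fix s :: "'b \<times> 'a" and F
  obtain t u where s: "s = (t, u)" by fastforce
  show "finite (case s of (t, u) \<Rightarrow> {m. A (delta m) u \<noteq> 0})"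
    by (simp add: s lfin_finite assms)
  show "lift2 A F s = (\<Sum>m\<in>(case s of (t, u) \<Rightarrow> {m. A (delta m) u \<noteq> 0}).
      (case s of (t, u) \<Rightarrow> \<lambda>m. A (delta m) u) m * F ((case s of (t, u) \<Rightarrow> \<lambda>m. (t, m)) m))"
    unfolding s lift2_apply prod.case by (rule lfin_eval[OF assms])
qed

lemma comm_lift1: "comm A B \<Longrightarrow> comm (lift1 A) (lift1 B)"
  by (auto simp: comm_def lift1_def)

lemma comm_lift2: "comm A B \<Longrightarrow> comm (lift2 A) (lift2 B)"
  by (auto simp: comm_def lift2_def)

lemma comm_lift1_lift2:
  assumes "lfin A" "lfin B"
  shows "comm (lift1 A) (lift2 B)"
  unfolding comm_def
proof (intro allI ext)
  fix F p
  show "lift1 A (lift2 B F) p = lift2 B (lift1 A F) p"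
    using lfin_swap[OF assms, of "\<lambda>t u. F (t, u)" "snd p" "fst p"]
    by (simp add: lift1_def lift2_def split_def)
qed

lemma delta_sym: "delta m s = delta s m"
  by (simp add: delta_def)

text \<open>\<open>b k\<close> stands for the lowering mode, described as the transpose of
  \<open>a k\<close> and through \<open>number\<close>. The set \<open>Z\<close> plays the part of
  the charge-zero sector: every charge has its own state of energy 0, and \<open>Z_bottom\<close>
  singles out \<open>v\<close>.\<close>

locale bosons = raising a E for a :: "nat \<Rightarrow> 's opr" and E :: "'s \<Rightarrow> nat" +
  fixes b :: "nat \<Rightarrow> 's opr" and Z :: "'s set" and v :: 's
  assumes lfin_b: "1 \<le> k \<Longrightarrow> lfin (b k)"
    and b_transpose: "1 \<le> k \<Longrightarrow> b k (delta m) s = a k (delta s) m"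
    and number: "(\<Sum>k=1..E s. a k (b k F) s) = of_nat (E s) * F s"
    and Z_closed: "1 \<le> k \<Longrightarrow> s \<in> Z \<Longrightarrow> a k (delta m) s \<noteq> 0 \<Longrightarrow> m \<in> Z"
    and Z_bottom: "s \<in> Z \<Longrightarrow> E s = 0 \<longleftrightarrow> s = v"
    and v_Z: "v \<in> Z"
begin

lemma E_v [simp]: "E v = 0"
  using Z_bottom[OF v_Z] by simp

lemma rsum_cong_Z:
  assumes "s \<in> Z" "\<And>m. m \<in> Z \<Longrightarrow> E m < E s \<Longrightarrow> F m = G m"
  shows "rsum z F s = rsum z G s"
proof (rule rsum_cong)
  fix m k assume "1 \<le> k" "a k (delta m) s \<noteq> 0"
  then show "F m = G m" using assms Z_closed[of k s m] a_shift[of k m s] by simp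
qed

text \<open>Induction on the energy. Above \<open>E e\<close> the factor on the left is nonzero, so
  the recursion determines each value from smaller energies; up to \<open>E e\<close> both functions
  are the basis vector.\<close>

lemma vexp_unique:
  assumes G: "\<And>t. t \<in> Z \<Longrightarrow> (of_nat (E t) - of_nat (E e)) * G t = rsum z G t"
    and base: "\<And>t. t \<in> Z \<Longrightarrow> E t \<le> E e \<Longrightarrow> G t = delta e t"
    and "t \<in> Z"
  shows "vexp z (delta e) t = G t"
  using \<open>t \<in> Z\<close>
proof (induction "E t" arbitrary: t rule: less_induct)
  case less
  show ?case
  proof (cases "E t \<le> E e")
    case True
    then show ?thesis using base[OF less.prems] by (simp add: vexp_delta_below)
  next
    case False
    have "rsum z (vexp z (delta e)) t = rsum z G t"
      by (rule rsum_cong_Z[OF less.prems]) (use less.hyps in auto)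
    then have "(of_nat (E t) - of_nat (E e)) * vexp z (delta e) t = (of_nat (E t) - of_nat (E e)) * G t"
      using vexp_delta_deriv[of t e z] G[OF less.prems] by simp
    then show ?thesis using False by simp
  qed
qed

text \<open>For \<open>m\<close> outside \<open>Z\<close> the zero function satisfies the same
  recursion and the same initial values on \<open>Z\<close>.\<close>

lemma vexp_Z_closed:
  assumes "t \<in> Z" "vexp z (delta m) t \<noteq> 0"
  shows "m \<in> Z"
proof (rule ccontr)
  assume m: "m \<notin> Z"
  have "vexp z (delta m) t = (\<lambda>_. 0) t"
  proof (rule vexp_unique[OF _ _ assms(1)])
    show "(of_nat (E t) - of_nat (E m)) * 0 = rsum z (\<lambda>_. 0) t" for t
      by (simp add: lfin_zero[OF lfin_rsum])
    show "0 = delta m t" if "t \<in> Z" for t using that m by (auto simp: delta_def)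
  qed
  with assms(2) show False by simp
qed

lemma vexp_cong_Z:
  assumes "t \<in> Z" "\<And>s. s \<in> Z \<Longrightarrow> F s = G s"
  shows "vexp z F t = vexp z G t"
  by (rule lfin_cong[OF lfin_vexp]) (use assms vexp_Z_closed in blast)

text \<open>What the exponent becomes when the second factor is transposed: the mixed term raises
  both factors, the \<open>z\<close> term the first, and the \<open>y\<close> term, formerly
  lowering, the second.\<close>

definition pair_term :: "(nat \<Rightarrow> complex) \<Rightarrow> (nat \<Rightarrow> complex) \<Rightarrow> nat \<Rightarrow> ('s \<times> 's) opr" where
  "pair_term z y k F p =
     lift1 (a k) (lift2 (a k) F) p + z k * lift1 (a k) F p + y k * lift2 (a k) F p"

abbreviation E2 :: "'s \<times> 's \<Rightarrow> nat" where
  "E2 \<equiv> \<lambda>(t, u). E t + E u"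

definition pair_sum :: "(nat \<Rightarrow> complex) \<Rightarrow> (nat \<Rightarrow> complex) \<Rightarrow> ('s \<times> 's) opr" where
  "pair_sum z y = wsum E2 (\<lambda>k F p. 1 / of_nat k * pair_term z y k F p)"

lemma lfin_pair_term:
  assumes "1 \<le> k"
  shows "lfin (pair_term z y k)"
proof -
  note l = lfin_lift1[OF lfin_a[OF assms]] lfin_lift2[OF lfin_a[OF assms]]
  show ?thesis
    unfolding pair_term_def[abs_def]
    by (rule lfin_plus[OF lfin_plus[OF lfin_comp[OF l] lfin_mult[OF l(1)]] lfin_mult[OF l(2)]])
qed

lemma comm_pair_termI:
  assumes "lfin C" "comm C (lift1 (a k))" "comm C (lift2 (a k))"
  shows "comm C (pair_term z y k)"
  unfolding pair_term_def[abs_def]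
  by (rule comm_add[OF assms(1) comm_add[OF assms(1) comm_comp[OF assms(2,3)]
        comm_scale[OF assms(1,2)]] comm_scale[OF assms(1,3)]])

lemma comm_lift2_a_pair_term:
  assumes "1 \<le> j" "1 \<le> k"
  shows "comm (lift2 (a j)) (pair_term z y k)"
  by (rule comm_pair_termI[OF lfin_lift2[OF lfin_a[OF assms(1)]]
        comm_sym[OF comm_lift1_lift2[OF lfin_a[OF assms(2)] lfin_a[OF assms(1)]]]
        comm_lift2[OF a_comm[OF assms]]])

lemma comm_lift1_a_pair_term:
  assumes "1 \<le> j" "1 \<le> k"
  shows "comm (lift1 (a j)) (pair_term z y k)"
  by (rule comm_pair_termI[OF lfin_lift1[OF lfin_a[OF assms(1)]] comm_lift1[OF a_comm[OF assms]]
        comm_lift1_lift2[OF lfin_a[OF assms(1)] lfin_a[OF assms(2)]]])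

lemma comm_pair_term:
  assumes "1 \<le> j" "1 \<le> k"
  shows "comm (pair_term z y j) (pair_term z' y' k)"
  by (rule comm_pair_termI[OF lfin_pair_term[OF assms(1)]
        comm_sym[OF comm_lift1_a_pair_term[OF assms(2,1)]]
        comm_sym[OF comm_lift2_a_pair_term[OF assms(2,1)]]])

lemma lift_a_zero:
  assumes "1 \<le> k"
  shows "E t < k \<Longrightarrow> lift1 (a k) F (t, u) = 0" "E u < k \<Longrightarrow> lift2 (a k) F (t, u) = 0"
  using assms by (simp_all add: lift1_apply lift2_apply a_zero)

lemma pair_term_zero: "1 \<le> k \<Longrightarrow> E2 p < k \<Longrightarrow> pair_term z y k F p = 0"
  by (cases p) (simp add: pair_term_def lift_a_zero)

lemma pair_sum_eq:
  "E t + E u \<le> K \<Longrightarrow> pair_sum z y F (t, u) = (\<Sum>k=1..K. 1 / of_nat k * pair_term z y k F (t, u))"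
  unfolding pair_sum_def by (rule wsum_eq) (simp_all add: pair_term_zero)

text \<open>Each term raises the total energy of the pair, by \<open>k\<close> or by
  \<open>2 * k\<close>.\<close>

lemma causal_pair_sum: "causal E2 (pair_sum z y)"
  unfolding pair_sum_def
proof (rule causal_wsum)
  fix k :: nat assume k: "1 \<le> k"
  show "causal E2 (\<lambda>F p. 1 / of_nat k * pair_term z y k F p)"
    unfolding causal_def
  proof (intro conjI allI impI)
    show "lfin (\<lambda>F p. 1 / of_nat k * pair_term z y k F p)"
      by (rule lfin_mult[OF lfin_pair_term[OF k]])
    fix p q assume nz: "1 / of_nat k * pair_term z y k (delta q) p \<noteq> 0"
    obtain t u m n where pq: "p = (t, u)" "q = (m, n)" by (metis surj_pair)
    have "lift1 (a k) (delta q) p = a k (delta m) t * delta n u" "lift2 (a k) (delta q) p = delta m t * a k (delta n) u"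
      "lift1 (a k) (lift2 (a k) (delta q)) p = a k (delta m) t * a k (delta n) u"
      using lfin_scale[OF lfin_a[OF k], of "delta n u" "delta m" t]
        lfin_scale[OF lfin_a[OF k], of "delta m _" "delta n" u]
        lfin_scale[OF lfin_a[OF k], of "a k (delta n) u" "delta m" t]
      by (simp_all add: pq lift1_apply lift2_apply delta_pair mult.commute)
    with nz have "a k (delta m) t \<noteq> 0 \<and> (n = u \<or> a k (delta n) u \<noteq> 0) \<or> m = t \<and> a k (delta n) u \<noteq> 0"
      by (auto simp: pair_term_def delta_def split: if_splits)
    then show "E2 q < E2 p"
      using k a_shift[OF k, of m t] a_shift[OF k, of n u] by (auto simp: pq)
  qed
qed

lemma lift1_weight:
  assumes "1 \<le> k"
  shows "of_nat (E t) * lift1 (a k) F (t, u) =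
    lift1 (a k) (\<lambda>(t, u). of_nat (E t) * F (t, u)) (t, u) + of_nat k * lift1 (a k) F (t, u)"
  by (simp add: lift1_apply a_weight[OF assms])

lemma lift2_weight:
  assumes "1 \<le> k"
  shows "of_nat (E t) * lift2 (a k) F (t, u) = lift2 (a k) (\<lambda>(t, u). of_nat (E t) * F (t, u)) (t, u)"
  by (simp add: lift2_apply lfin_scale[OF lfin_a[OF assms]])

text \<open>Only the energy of the first factor is taken as weight. The \<open>y\<close> term
  commutes with it and drops out of the commutator, whence the zero sequence on the right.\<close>

lemma pair_term_weight:
  assumes "1 \<le> k"
  shows "of_nat (E t) * pair_term z y k F (t, u) =
    pair_term z y k (\<lambda>(t, u). of_nat (E t) * F (t, u)) (t, u)
      + of_nat k * pair_term z (\<lambda>_. 0) k F (t, u)"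
proof -
  have "(\<lambda>(t, u). of_nat (E t) * lift2 (a k) F (t, u)) = lift2 (a k) (\<lambda>(t, u). of_nat (E t) * F (t, u))"
    by (auto simp: lift2_weight[OF assms])
  then show ?thesis
    using lift1_weight[OF assms, of t F u] lift1_weight[OF assms, of t "lift2 (a k) F" u]
      lift2_weight[OF assms, of t F u]
    by (simp add: pair_term_def algebra_simps)
qed

lemma pair_exp_deriv:
  fixes t u :: 's and z y :: "nat \<Rightarrow> complex"
  defines "D \<equiv> op_exp (pair_sum z y) (delta (v, v))"
  shows "of_nat (E t) * D (t, u) = (\<Sum>k=1..E t. pair_term z (\<lambda>_. 0) k D (t, u))"
proof -
  let ?A' = "wsum E2 (pair_term z (\<lambda>_. 0))"
  have A'_eq: "?A' F (t, u) = (\<Sum>k=1..E t + E u. pair_term z (\<lambda>_. 0) k F (t, u))" for F t u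
    by (simp add: wsum_def)
  have lfin_A': "lfin ?A'"
    by (rule lfin_wsum') (rule lfin_pair_term)
  have c: "comm ?A' (pair_sum z y)"
    unfolding pair_sum_def
  proof (rule comm_wsum[OF lfin_A'])
    fix k :: nat assume k: "1 \<le> k"
    have "comm (pair_term z y k) ?A'"
      by (rule comm_wsum[OF lfin_pair_term[OF k] pair_term_zero comm_pair_term[OF k]])
    then show "comm ?A' (\<lambda>F p. 1 / of_nat k * pair_term z y k F p)"
      by (rule comm_scale[OF lfin_A' comm_sym])
  qed (simp add: pair_term_zero)
  have "of_nat (E (fst (t, u))) * D (t, u) =
      op_exp (pair_sum z y) (\<lambda>x. of_nat (E (fst x)) * delta (v, v) x) (t, u) + ?A' D (t, u)"
    unfolding D_def
  proof (rule op_exp_deriv[OF causal_pair_sum lfin_A'])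
    show "?A' (pair_sum z y F) = pair_sum z y (?A' F)" for F
      using c by (simp add: comm_def)
    fix F :: "('s \<times> 's) vec" and p :: "'s \<times> 's"
    obtain t u where p: "p = (t, u)" by fastforce
    have "of_nat (E t) * pair_sum z y F p =
        (\<Sum>k=1..E t + E u. 1 / of_nat k * (of_nat (E t) * pair_term z y k F (t, u)))"
      by (simp add: p pair_sum_eq[OF order_refl] sum_distrib_left ac_simps)
    also have "\<dots> = (\<Sum>k=1..E t + E u. 1 / of_nat k * pair_term z y k (\<lambda>(t, u). of_nat (E t) * F (t, u)) (t, u)
        + pair_term z (\<lambda>_. 0) k F (t, u))"
      by (rule sum.cong) (auto simp: pair_term_weight field_simps)
    moreover have "(\<lambda>(t, u). of_nat (E t) * F (t, u)) = (\<lambda>x. of_nat (E (fst x)) * F x)"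
      by auto
    ultimately show "of_nat (E (fst p)) * pair_sum z y F p =
        pair_sum z y (\<lambda>x. of_nat (E (fst x)) * F x) p + ?A' F p"
      by (simp add: p pair_sum_eq[OF order_refl] A'_eq sum.distrib)
  qed
  \<comment> \<open>The initial state has energy 0 in the first factor, so the inhomogeneous term
    disappears.\<close>
  also have "(\<lambda>x. of_nat (E (fst x)) * delta (v, v) x) = (\<lambda>_. 0 :: complex)"
    by (auto simp: delta_def)
  also have "op_exp (pair_sum z y) (\<lambda>_. 0) (t, u) = 0"
    by (rule lfin_zero[OF lfin_op_exp[OF causal_pair_sum]])
  \<comment> \<open>Every remaining term applies a mode to the first factor, so the modes beyond
    \<open>E t\<close> vanish and the second energy leaves the limit.\<close>
  also have "?A' D (t, u) = (\<Sum>k=1..E t. pair_term z (\<lambda>_. 0) k D (t, u))"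
    unfolding A'_eq
    by (rule sum.mono_neutral_right) (auto simp: pair_term_def lift_a_zero)
  finally show ?thesis by simp
qed

text \<open>At the ground state of the first factor every mode on that factor vanishes, so only the
  \<open>y\<close> terms act and the problem has a single factor.\<close>

lemma pair_exp_bottom: "op_exp (pair_sum z y) (delta (v, v)) (v, u) = vexp y (delta v) u"
proof -
  have "pair_sum z y F (v, u) = rsum (\<lambda>k. y k / of_nat k) (\<lambda>u. F (v, u)) u" for F u
    by (simp add: pair_sum_eq[OF order_refl] rsum_eq[OF order_refl] pair_term_def lift_a_zero lift2_apply)
  then have "(pair_sum z y ^^ j) (delta (v, v)) (v, u) = (rsum (\<lambda>k. y k / of_nat k) ^^ j) (delta v) u" for j u
    by (induction j arbitrary: u) (simp_all add: delta_pair, simp add: delta_def)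
  then show ?thesis by (simp add: vexp_def op_exp_def)
qed

text \<open>The number identity applied to the identity kernel: a lowering mode on one index is, by
  transposition, a raising mode on the other.\<close>

lemma number_kernel: "of_nat (E t) * delta t u = (\<Sum>k=1..E t. a k (\<lambda>t. a k (delta t) u) t)"
proof -
  have "(\<Sum>k=1..E t. a k (\<lambda>t. a k (delta t) u) t) = (\<Sum>k=1..E t. a k (b k (delta u)) t)"
  proof (rule sum.cong[OF refl])
    fix k assume "k \<in> {1..E t}"
    then have "b k (delta u) = (\<lambda>t. a k (delta t) u)" using b_transpose[of k u] by auto
    then show "a k (\<lambda>t. a k (delta t) u) t = a k (b k (delta u)) t" by simp
  qed
  then show ?thesis using number[of "delta u" t] delta_sym[of t u] by simp
qed

text \<open>The kernel on the right satisfies the recursion of \<open>pair_exp_deriv\<close>, because the identity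
  kernel does by \<open>number_kernel\<close>.\<close>

lemma pair_exp:
  assumes "t \<in> Z"
  shows "op_exp (pair_sum z y) (delta (v, v)) (t, u) = vexp z (\<lambda>e. vexp y (delta e) u) t"
proof -
  define D where "D = op_exp (pair_sum z y) (delta (v, v))"
  define D' where "D' = (\<lambda>(t, u). vexp z (\<lambda>e. vexp y (delta e) u) t)"
  have step: "pair_term z (\<lambda>_. 0) k F (t, u) = a k (\<lambda>t. a k (\<lambda>u. F (t, u)) u + z k * F (t, u)) t"
    if "1 \<le> k" for k F t u
    by (simp add: pair_term_def lift1_apply lift2_apply lfin_add[OF lfin_a[OF that]]
        lfin_scale[OF lfin_a[OF that]])
  have "of_nat (E t) * D' (t, u) = (\<Sum>k=1..E t. pair_term z (\<lambda>_. 0) k D' (t, u))" for t u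
  proof -
    \<comment> \<open>Apply \<open>vexp y\<close> in the second variable of
      \<open>number_kernel\<close>. It passes the mode on the first variable by
      \<open>lfin_swap\<close> and the mode on the second by \<open>vexp_a\<close>.\<close>
    have yk: "of_nat (E e) * vexp y (delta e) u = (\<Sum>k=1..E e. a k (\<lambda>e. a k (vexp y (delta e)) u) e)" for e
    proof -
      have "of_nat (E e) * vexp y (delta e) u = vexp y (\<lambda>u. of_nat (E e) * delta e u) u"
        by (simp add: lfin_scale[OF lfin_vexp])
      also have "\<dots> = (\<Sum>k=1..E e. vexp y (\<lambda>u. a k (\<lambda>t. a k (delta t) u) e) u)"
        by (simp add: number_kernel lfin_sum_apply[OF lfin_vexp])
      also have "\<dots> = (\<Sum>k=1..E e. a k (\<lambda>e. a k (vexp y (delta e)) u) e)"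
        by (rule sum.cong) (auto simp: lfin_swap[OF lfin_vexp lfin_a] vexp_a)
      finally show ?thesis .
    qed
    have "of_nat (E t) * D' (t, u) = vexp z (\<lambda>e. of_nat (E e) * vexp y (delta e) u) t + rsum z (\<lambda>t. D' (t, u)) t"
      by (simp add: D'_def vexp_deriv)
    also have "vexp z (\<lambda>e. of_nat (E e) * vexp y (delta e) u) t =
        (\<Sum>k=1..E t. a k (vexp z (\<lambda>e. a k (vexp y (delta e)) u)) t)"
      unfolding yk
      by (subst lfin_wsum_comm[where B = "vexp z" and A = a and W = E
            and F = "\<lambda>k e. a k (vexp y (delta e)) u"])
        (auto simp: lfin_vexp a_zero vexp_a)
    also have "\<dots> = (\<Sum>k=1..E t. a k (\<lambda>t. a k (\<lambda>u. D' (t, u)) u) t)"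
    proof (rule sum.cong[OF refl])
      fix k assume "k \<in> {1..E t}"
      then have "vexp z (\<lambda>e. a k (vexp y (delta e)) u) t = a k (\<lambda>u. D' (t, u)) u" for t
        using lfin_swap[OF lfin_vexp lfin_a[of k], of z "\<lambda>e. vexp y (delta e)" u t] by (simp add: D'_def)
      then show "a k (vexp z (\<lambda>e. a k (vexp y (delta e)) u)) t = a k (\<lambda>t. a k (\<lambda>u. D' (t, u)) u) t"
        by (intro arg_cong2[of _ _ _ _ "a k"]) auto
    qed
    also have "\<dots> + rsum z (\<lambda>t. D' (t, u)) t = (\<Sum>k=1..E t. pair_term z (\<lambda>_. 0) k D' (t, u))"
      unfolding rsum_eq[OF order_refl] sum.distrib[symmetric]
      by (rule sum.cong) (auto simp: pair_term_def lift1_apply lift2_apply)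
    finally show ?thesis .
  qed
  moreover have "of_nat (E t) * D (t, u) = (\<Sum>k=1..E t. pair_term z (\<lambda>_. 0) k D (t, u))" for t u
    unfolding D_def by (rule pair_exp_deriv)
  moreover have "D (v, u) = D' (v, u)" for u
    unfolding D_def D'_def prod.case by (subst vexp_bottom) (simp_all add: pair_exp_bottom)
  \<comment> \<open>Both kernels satisfy the recursion in \<open>E t\<close> and agree where
    \<open>E t = 0\<close>; above that, division by \<open>E t\<close> determines them from smaller
    energies.\<close>
  ultimately have "D (t, u) = D' (t, u)" for u
    using assms
  proof (induction "E t" arbitrary: t u rule: less_induct)
    case less
    show ?case
    proof (cases "E t = 0")
      case True
      then show ?thesis using Z_bottom[OF less.prems(4)] less.prems(3) by simp
    next
      case False
      have "pair_term z (\<lambda>_. 0) k D (t, u) = pair_term z (\<lambda>_. 0) k D' (t, u)" if "k \<in> {1..E t}" for k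
      proof -
        have k: "1 \<le> k" using that by simp
        have "D (m, u) = D' (m, u)" if "a k (delta m) t \<noteq> 0" for m u
          by (rule less.hyps) (use a_shift[OF k that] Z_closed[OF k less.prems(4) that] k less.prems in auto)
        then show ?thesis unfolding step[OF k] by (intro lfin_cong[OF lfin_a[OF k]]) simp
      qed
      then have "of_nat (E t) * D (t, u) = of_nat (E t) * D' (t, u)"
        unfolding less.prems(1,2) by (rule sum.cong[OF refl])
      then show ?thesis using False by simp
    qed
  qed
  then show ?thesis by (simp add: D_def D'_def)
qed

section \<open>Transposing the lowering modes\<close>

lemma b_delta: "1 \<le> k \<Longrightarrow> b k (\<lambda>u. delta u n) u = a k (delta u) n"
  using b_transpose[of k n u] by (simp add: delta_sym[of _ n])

text \<open>The lowering modes acting on the second factor turn into raising modes acting on its initial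
  state. This uses that all modes involved commute.\<close>

lemma transposed_pow:
  assumes X: "\<And>F t u K. (\<And>k. K < k \<Longrightarrow> b k (\<lambda>u. F (t, u)) u = 0) \<Longrightarrow> E t \<le> K \<Longrightarrow>
      X F (t, u) = (\<Sum>k=1..K. 1 / of_nat k * (y k * b k (\<lambda>u. F (t, u)) u
        + a k (\<lambda>t. b k (\<lambda>u. F (t, u)) u) t + z k * a k (\<lambda>t. F (t, u)) t))"
  shows "(X ^^ j) (\<lambda>p. c * delta (v, n) p) (t, u) = (pair_sum z y ^^ j) (\<lambda>p. c * delta (v, u) p) (t, n)"
proof (induction j arbitrary: t u)
  case 0
  then show ?case by (simp add: delta_pair delta_sym[of n u])
next
  case (Suc j)
  let ?V = "\<lambda>u. (pair_sum z y ^^ j) (\<lambda>p. c * delta (v, u) p)"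
  \<comment> \<open>\<open>u\<close> and \<open>n\<close> exchange roles: \<open>u\<close> becomes
    the initial state of the second factor and \<open>n\<close> the index at which the result is
    read.\<close>
  have IH: "(X ^^ j) (\<lambda>p. c * delta (v, n) p) = (\<lambda>(t, u). ?V u (t, n))"
    using Suc by auto
  have comm: "comm (lift2 (a k)) (pair_sum z y)" if k: "1 \<le> k" for k
    unfolding pair_sum_def
  proof (rule comm_wsum)
    show l: "lfin (lift2 (a k))" by (rule lfin_lift2[OF lfin_a[OF k]])
    show "comm (lift2 (a k)) (\<lambda>F p. 1 / of_nat j * pair_term z y j F p)" if "1 \<le> j" for j
      by (rule comm_scale[OF l comm_lift2_a_pair_term[OF k that]])
  qed (simp add: pair_term_zero)
  have b: "b k (\<lambda>u. ?V u (t, n)) u = a k (\<lambda>n. ?V u (t, n)) n" if k: "1 \<le> k" for k t u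
  proof -
    have "b k (\<lambda>u. ?V u (t, n)) u = (pair_sum z y ^^ j) (\<lambda>p. b k (\<lambda>u. c * delta (v, u) p) u) (t, n)"
      by (rule lfin_swap[OF lfin_b[OF k] lfin_pow[OF causal_lfin[OF causal_pair_sum]]])
    also have "(\<lambda>p. b k (\<lambda>u. c * delta (v, u) p) u) = lift2 (a k) (\<lambda>p. c * delta (v, u) p)"
    proof
      fix p :: "'s \<times> 's"
      obtain t n where p: "p = (t, n)" by fastforce
      show "b k (\<lambda>u. c * delta (v, u) p) u = lift2 (a k) (\<lambda>p. c * delta (v, u) p) p"
        unfolding p lift2_apply delta_pair lfin_scale[OF lfin_b[OF k]] lfin_scale[OF lfin_a[OF k]] b_delta[OF k] ..
    qed
    also have "(pair_sum z y ^^ j) \<dots> = lift2 (a k) (?V u)"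
      by (rule pow_comm[symmetric]) (use comm[OF k] in \<open>simp add: comm_def\<close>)
    finally show ?thesis by (simp add: lift2_apply)
  qed
  have "(X ^^ Suc j) (\<lambda>p. c * delta (v, n) p) (t, u) = X (\<lambda>(t, u). ?V u (t, n)) (t, u)"
    by (simp add: IH)
  \<comment> \<open>The lowering modes on \<open>u\<close> are raising modes on \<open>n\<close>, so
    they vanish beyond \<open>E n\<close>; the raising modes on \<open>t\<close> vanish beyond
    \<open>E t\<close>. The sum of the two energies bounds both.\<close>
  also have "\<dots> = (\<Sum>k=1..E t + E n. 1 / of_nat k * (y k * b k (\<lambda>u. ?V u (t, n)) u
        + a k (\<lambda>t. b k (\<lambda>u. ?V u (t, n)) u) t + z k * a k (\<lambda>t. ?V u (t, n)) t))"
    by (subst X[of "E t + E n"]) (simp_all add: b a_zero)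
  also have "\<dots> = (\<Sum>k=1..E t + E n. 1 / of_nat k * pair_term z y k (?V u) (t, n))"
    by (rule sum.cong) (auto simp: b pair_term_def lift1_apply lift2_apply)
  also have "\<dots> = (pair_sum z y ^^ Suc j) (\<lambda>p. c * delta (v, u) p) (t, n)"
    by (simp add: pair_sum_eq[OF order_refl])
  finally show ?case .
qed

text \<open>The formula for \<open>X\<close> is assumed only where the lowering modes terminate,
  because on an arbitrary formal vector their sum is infinite; the vectors of the series terminate
  by transposition. Reading the second factor at \<open>v\<close> makes \<open>v\<close> its initial
  state afterwards.\<close>

theorem transposed_exp:
  assumes X: "\<And>F t u K. (\<And>k. K < k \<Longrightarrow> b k (\<lambda>u. F (t, u)) u = 0) \<Longrightarrow> E t \<le> K \<Longrightarrow>
      X F (t, u) = (\<Sum>k=1..K. 1 / of_nat k * (y k * b k (\<lambda>u. F (t, u)) u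
        + a k (\<lambda>t. b k (\<lambda>u. F (t, u)) u) t + z k * a k (\<lambda>t. F (t, u)) t))"
    and "m \<in> Z"
  shows "op_exp X (\<lambda>p. c * delta (v, n) p) (m, v) =
    c * (\<Sum>e | vexp z (delta e) m \<noteq> 0. vexp z (delta e) m * vexp y (delta e) n)"
proof -
  have "op_exp X (\<lambda>p. c * delta (v, n) p) (m, v) = op_exp (pair_sum z y) (\<lambda>p. c * delta (v, v) p) (m, n)"
    by (simp add: op_exp_def transposed_pow[where X = X and y = y and z = z, OF X])
  then show ?thesis
    by (simp add: lfin_scale[OF lfin_op_exp[OF causal_pair_sum]] pair_exp[OF assms(2)]
        lfin_eval[OF lfin_vexp, of z "\<lambda>e. vexp y (delta e) n" m])
qed

text \<open>The analogue with one factor, for the lowering exponential of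
  \<open>S_bra\<close>.\<close>

theorem transposed_exp_single:
  assumes X: "\<And>F u K. (\<And>k. K < k \<Longrightarrow> b k F u = 0) \<Longrightarrow>
      X F u = (\<Sum>k=1..K. y k / of_nat k * b k F u)"
  shows "op_exp X (\<lambda>u. c * delta n u) v = c * vexp y (delta v) n"
proof -
  let ?R = "rsum (\<lambda>k. y k / of_nat k)"
  have "(X ^^ j) (\<lambda>u. c * delta n u) u = (?R ^^ j) (\<lambda>n. c * delta u n) n" for j u
  proof (induction j arbitrary: u)
    case 0
    then show ?case by (simp add: delta_sym[of n u])
  next
    case (Suc j)
    let ?V = "\<lambda>u. (?R ^^ j) (\<lambda>n. c * delta u n)"
    have b: "b k (\<lambda>u. ?V u n) u = a k (?V u) n" if k: "1 \<le> k" for k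
    proof -
      have "b k (\<lambda>u. ?V u n) u = (?R ^^ j) (\<lambda>n. b k (\<lambda>u. c * delta u n) u) n"
        by (rule lfin_swap[OF lfin_b[OF k] lfin_pow[OF lfin_rsum]])
      also have "\<dots> = (?R ^^ j) (a k (\<lambda>n. c * delta u n)) n"
        by (rule arg_cong[of _ _ "\<lambda>f. (?R ^^ j) f n"])
          (simp only: lfin_scale[OF lfin_b[OF k]] lfin_scale[OF lfin_a[OF k]] b_delta[OF k] fun_eq_iff simp_thms)
      also have "\<dots> = a k (?V u) n"
        by (subst pow_comm[where B = "a k" and A = ?R])
          (use comm_rsum[OF lfin_a[OF k] a_comm[OF k]] in \<open>auto simp: comm_def\<close>)
      finally show ?thesis .
    qed
    have "(X ^^ j) (\<lambda>u. c * delta n u) = (\<lambda>u. ?V u n)"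
      using Suc by auto
    then have "(X ^^ Suc j) (\<lambda>u. c * delta n u) u = X (\<lambda>u. ?V u n) u"
      by simp
    also have "\<dots> = (\<Sum>k=1..E n. y k / of_nat k * b k (\<lambda>u. ?V u n) u)"
      by (rule X) (simp add: b a_zero)
    also have "\<dots> = (?R ^^ Suc j) (\<lambda>n. c * delta u n) n"
      by (simp add: b rsum_eq[OF order_refl])
    finally show ?case .
  qed
  then have "op_exp X (\<lambda>u. c * delta n u) v = vexp y (\<lambda>n. c * delta v n) n"
    by (simp add: op_exp_def vexp_def)
  then show ?thesis by (simp add: lfin_scale[OF lfin_vexp])
qed

end

section \<open>Bosonic modes on semi-infinite wedges\<close>

lemma maya_bounds:
  obtains B where "\<And>k. k < - B \<Longrightarrow> k \<in> levels S" "\<And>k. B \<le> k \<Longrightarrow> k \<notin> levels S"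
proof -
  let ?X = "{k \<in> levels S. 0 \<le> k} \<union> {k. k < 0 \<and> k \<notin> levels S}"
  have fin: "finite (abs ` ?X)" using levels[of S] by simp
  define B where "B = Max (insert 0 (abs ` ?X)) + 1"
  have B: "\<bar>k\<bar> < B" if "k \<in> ?X" for k
    using Max_ge[of "insert 0 (abs ` ?X)" "\<bar>k\<bar>"] fin that unfolding B_def by simp
  have "0 < B" using Max_ge[of "insert 0 (abs ` ?X)" 0] fin unfolding B_def by simp
  show ?thesis
  proof (rule that[of B])
    show "k \<in> levels S" if "k < - B" for k using B[of k] that \<open>0 < B\<close> by auto
    show "k \<notin> levels S" if "B \<le> k" for k using B[of k] that \<open>0 < B\<close> by auto
  qed
qed

abbreviation move :: "int \<Rightarrow> int \<Rightarrow> maya \<Rightarrow> maya" where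
  "move y w S \<equiv> add_level w (del_level y S)"

text \<open>In the charge-zero sector these pairs correspond to the cells of the partition, so that
  their number is the energy; see \<open>energy_row_state\<close>.\<close>

definition inversions :: "maya \<Rightarrow> (int \<times> int) set" where
  "inversions S = {(y, w). y \<in> levels S \<and> w \<notin> levels S \<and> w < y}"

definition energy :: "maya \<Rightarrow> nat" where
  "energy S = card (inversions S)"

text \<open>Operators act on coefficient functions, so \<open>a_op (- k) F S\<close> reads \<open>F\<close> at the states obtained
  from \<open>S\<close> by moving a particle down by \<open>k\<close>: the modes of negative index raise the energy.\<close>

definition movable :: "int \<Rightarrow> maya \<Rightarrow> int set" where
  "movable n S = {y. y \<in> levels S \<and> y + n \<notin> levels S}"

lemma finite_inversions: "finite (inversions S)"
proof -
  obtain B where B: "\<And>k. k < - B \<Longrightarrow> k \<in> levels S" "\<And>k. B \<le> k \<Longrightarrow> k \<notin> levels S"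
    using maya_bounds[of S] by blast
  have "inversions S \<subseteq> {-B..B} \<times> {-B..B}"
    using B by (auto simp: inversions_def) (smt (verit))+
  then show ?thesis by (rule finite_subset) simp
qed

lemma finite_movable: "finite (movable n S)"
proof -
  obtain B where B: "\<And>k. k < - B \<Longrightarrow> k \<in> levels S" "\<And>k. B \<le> k \<Longrightarrow> k \<notin> levels S"
    using maya_bounds[of S] by blast
  have "movable n S \<subseteq> {-B - n..B}"
    using B by (auto simp: movable_def) (smt (verit))+
  then show ?thesis by (rule finite_subset) simp
qed

text \<open>A downward move splits into unit moves. If the level below the particle is empty, the
  particle steps down and then continues. If it is occupied, the particle there makes the long move
  first and the upper one then takes its place; the resulting set of levels is the same.\<close>

lemma move_steps [consumes 3, case_names step trans]:
  assumes "y \<in> levels S" "w \<notin> levels S" "w < y"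
    and step: "\<And>S u. u + 1 \<in> levels S \<Longrightarrow> u \<notin> levels S \<Longrightarrow> P 1 S (move (u + 1) u S)"
    and trans: "\<And>i j S T U. P i S T \<Longrightarrow> P j T U \<Longrightarrow> P (i + j) S U"
  shows "P (nat (y - w)) S (move y w S)"
  using assms(1-3)
proof (induction "nat (y - w)" arbitrary: y w S)
  case (Suc n)
  consider "w = y - 1" | "w < y - 1" "y - 1 \<notin> levels S" | "w < y - 1" "y - 1 \<in> levels S"
    using Suc.prems(3) by linarith
  then show ?case
  proof cases
    case 1
    then show ?thesis using step[of w S] Suc.prems by simp
  next
    case 2
    have "P (nat (y - 1 - w)) (move y (y - 1) S) (move (y - 1) w (move y (y - 1) S))"
      by (rule Suc.hyps(1)) (use 2 Suc in auto)
    moreover have "move (y - 1) w (move y (y - 1) S) = move y w S"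
      using 2 by (intro maya_eqI) auto
    moreover have "P 1 S (move y (y - 1) S)"
      using step[of "y - 1" S] 2 Suc.prems by simp
    ultimately have "P (1 + nat (y - 1 - w)) S (move y w S)"
      using trans by metis
    moreover have "1 + nat (y - 1 - w) = nat (y - w)" using 2 by simp
    ultimately show ?thesis by simp
  next
    case 3
    have "P (nat (y - 1 - w)) S (move (y - 1) w S)"
      by (rule Suc.hyps(1)) (use 3 Suc in auto)
    moreover have "move y (y - 1) (move (y - 1) w S) = move y w S"
      using 3 by (intro maya_eqI) auto
    moreover have "P 1 (move (y - 1) w S) (move y (y - 1) (move (y - 1) w S))"
      using step[of "y - 1" "move (y - 1) w S"] 3 Suc.prems by simp
    ultimately have "P (nat (y - 1 - w) + 1) S (move y w S)"
      using trans by metis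
    moreover have "nat (y - 1 - w) + 1 = nat (y - w)" using 3 by simp
    ultimately show ?thesis by simp
  qed
qed simp

lemma energy_step:
  assumes "u + 1 \<in> levels S" "u \<notin> levels S"
  shows "energy S = energy (move (u + 1) u S) + 1"
proof -
  let ?T = "move (u + 1) u S"
  \<comment> \<open>The transposition of the levels \<open>u\<close> and \<open>u + 1\<close>
    identifies the inversions of the two states, except for the pair that the step removes.\<close>
  define \<sigma> :: "int \<Rightarrow> int" where "\<sigma> k = (if k = u then u + 1 else if k = u + 1 then u else k)" for k
  have \<sigma>: "\<sigma> (\<sigma> k) = k" for k by (auto simp: \<sigma>_def)
  have lev: "\<sigma> k \<in> levels S \<longleftrightarrow> k \<in> levels ?T" for k
    using assms by (auto simp: \<sigma>_def)
  have "inversions S = insert (u + 1, u) (map_prod \<sigma> \<sigma> ` inversions ?T)"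
  proof (intro equalityI subsetI)
    fix p assume "p \<in> inversions S"
    then obtain y w where p: "p = (y, w)" "y \<in> levels S" "w \<notin> levels S" "w < y"
      by (auto simp: inversions_def)
    show "p \<in> insert (u + 1, u) (map_prod \<sigma> \<sigma> ` inversions ?T)"
    proof (cases "p = (u + 1, u)")
      case False
      then have "\<sigma> w < \<sigma> y" using p assms by (auto simp: \<sigma>_def)
      then have "(\<sigma> y, \<sigma> w) \<in> inversions ?T"
        using p lev[of "\<sigma> y"] lev[of "\<sigma> w"] by (simp add: inversions_def \<sigma>)
      then have "map_prod \<sigma> \<sigma> (\<sigma> y, \<sigma> w) \<in> map_prod \<sigma> \<sigma> ` inversions ?T" by (rule imageI)
      then show ?thesis using p(1) by (simp add: \<sigma>)
    qed simp
  next
    fix p assume "p \<in> insert (u + 1, u) (map_prod \<sigma> \<sigma> ` inversions ?T)"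
    then consider "p = (u + 1, u)" | y w where "p = (\<sigma> y, \<sigma> w)" "(y, w) \<in> inversions ?T" by auto
    then show "p \<in> inversions S"
    proof cases
      case 1
      then show ?thesis using assms by (simp add: inversions_def)
    next
      case 2
      then have yw: "y \<in> levels ?T" "w \<notin> levels ?T" "w < y" by (auto simp: inversions_def)
      then have "\<sigma> w < \<sigma> y" by (auto simp: \<sigma>_def)
      then show ?thesis using lev[of y] lev[of w] yw 2(1) by (simp add: inversions_def)
    qed
  qed
  moreover have "(u + 1, u) \<notin> map_prod \<sigma> \<sigma> ` inversions ?T"
  proof
    assume "(u + 1, u) \<in> map_prod \<sigma> \<sigma> ` inversions ?T"
    then obtain y w where yw: "u + 1 = \<sigma> y" "u = \<sigma> w" "(y, w) \<in> inversions ?T" by auto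
    then have "y = \<sigma> (u + 1)" "w = \<sigma> u" using \<sigma> by metis+
    then show False using yw(3) by (auto simp: inversions_def \<sigma>_def)
  qed
  moreover have "inj_on (map_prod \<sigma> \<sigma>) (inversions ?T)"
    by (rule inj_onI) (metis \<sigma> map_prod_simp prod.collapse prod.inject)
  ultimately show ?thesis
    by (simp add: energy_def card_image finite_inversions)
qed

lemma energy_move:
  assumes "y \<in> levels S" "w \<notin> levels S" "w < y"
  shows "energy S = energy (move y w S) + nat (y - w)"
  using assms by (induction rule: move_steps[where P = "\<lambda>i S T. energy S = energy T + i"])
    (simp_all add: energy_step)

section \<open>Fermion bilinears and the modes \<open>a_op\<close>\<close>

definition hop :: "int \<Rightarrow> int \<Rightarrow> maya opr" where
  "hop y w F = psi (- y - 1) (psid w F)"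

lemma psi_apply: "psi (- y - 1) F S = (if y \<in> levels S then lsgn y S * F (del_level y S) else 0)"
  by (simp add: psi_def)

lemma lfin_psi: "lfin (psi k)"
  by (rule lfinI[where I = "\<lambda>S. if - k - 1 \<in> levels S then {()} else {}"
        and c = "\<lambda>S _. lsgn (- k - 1) S" and g = "\<lambda>S _. del_level (- k - 1) S"])
    (simp_all add: psi_def)

lemma lfin_psid: "lfin (psid k)"
  by (rule lfinI[where I = "\<lambda>S. if k \<notin> levels S then {()} else {}"
        and c = "\<lambda>S _. lsgn k S" and g = "\<lambda>S _. add_level k S"])
    (simp_all add: psid_def)

lemma lfin_hop: "lfin (hop y w)"
  using lfin_comp[OF lfin_psi lfin_psid] by (simp add: hop_def[abs_def])

lemma hop_apply: "y \<noteq> w \<Longrightarrow> hop y w F S =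
    (if y \<in> levels S \<and> w \<notin> levels S then lsgn y S * lsgn w (del_level y S) * F (move y w S) else 0)"
  by (auto simp: hop_def psi_apply psid_def)

lemma hop_same: "y \<in> levels S \<Longrightarrow> hop y y F S = F S"
proof -
  assume y: "y \<in> levels S"
  have "add_level y (del_level y S) = S" using y by (intro maya_eqI) auto
  then show ?thesis using y by (simp add: hop_def psi_apply psid_def lsgn_del_level)
qed

lemma infsum_finite_support:
  assumes "finite I" "I \<subseteq> A" "\<And>i. i \<in> A - I \<Longrightarrow> f i = 0"
  shows "infsum f A = sum f I"
proof -
  have "infsum f A = infsum f I"
    by (rule infsum_cong_neutral) (use assms in auto)
  then show ?thesis using assms(1) by simp
qed

lemma a_op_eq:
  assumes "n \<noteq> 0" "finite I" "movable n S \<subseteq> I"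
  shows "a_op n F S = - (\<Sum>y\<in>I. hop y (y + n) F S)"
proof -
  \<comment> \<open>For nonzero \<open>n\<close> the two fermion modes anticommute, so normal
    ordering has no effect.\<close>
  have "nord_psi_psid k (n - k - 1) F S = psi k (psid (n - k - 1) F) S" for k
    using psi_psid_anticommute[of k "n - k - 1" F S] assms(1)
    by (auto simp: nord_psi_psid_def algebra_simps add_eq_0_iff2)
  then have "a_op n F S = - (\<Sum>\<^sub>\<infinity>k. psi k (psid (n - k - 1) F) S)"
    by (simp add: a_op_def)
  also have "(\<Sum>\<^sub>\<infinity>k. psi k (psid (n - k - 1) F) S) = (\<Sum>\<^sub>\<infinity>y. hop y (y + n) F S)"
    by (rule infsum_reindex_bij_witness[of UNIV "\<lambda>y. - y - 1" "\<lambda>k. - k - 1"])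
      (simp_all add: hop_def algebra_simps)
  also have "\<dots> = (\<Sum>y\<in>I. hop y (y + n) F S)"
    by (rule infsum_finite_support) (use assms in \<open>auto simp: hop_apply movable_def\<close>)
  finally show ?thesis .
qed

lemma lfin_a_op:
  assumes "n \<noteq> 0"
  shows "lfin (a_op n)"
proof -
  have "a_op n = (\<lambda>F S. \<Sum>y\<in>movable n S. - 1 * hop y (y + n) F S)"
    by (intro ext) (simp add: a_op_eq[OF assms finite_movable order_refl] sum_negf)
  moreover have "lfin \<dots>"
    by (rule lfin_wsum) (simp_all add: finite_movable lfin_hop)
  ultimately show ?thesis by simp
qed

lemma a_op_delta:
  assumes "n \<noteq> 0" "a_op n (delta m) S \<noteq> 0"
  obtains y where "y \<in> levels S" "y + n \<notin> levels S" "m = move y (y + n) S"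
proof -
  have "(\<Sum>y\<in>movable n S. hop y (y + n) (delta m) S) \<noteq> 0"
    using assms by (simp add: a_op_eq[OF assms(1) finite_movable order_refl])
  then obtain y where "y \<in> movable n S" "hop y (y + n) (delta m) S \<noteq> 0"
    by (rule sum.not_neutral_contains_not_neutral)
  then show ?thesis
    using that[of y] assms(1) by (auto simp: hop_apply movable_def delta_def split: if_splits)
qed

text \<open>Moving a particle and moving it back have the same sign: both signs can be computed in
  the state from which the particle has been removed.\<close>

lemma a_op_transpose:
  assumes "n \<noteq> 0"
  shows "a_op n (delta m) s = a_op (- n) (delta s) m"
proof -
  let ?A = "{y \<in> movable n s. m = move y (y + n) s}" and ?B = "{x \<in> movable (- n) m. s = move x (x + - n) m}"
  have move: "move (y + n) y m = s" "del_level (y + n) m = del_level y s"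
    if "y \<in> levels s" "y + n \<notin> levels s" "m = move y (y + n) s" for y m s n
    using that by (auto intro!: maya_eqI)
  have "(\<Sum>y\<in>movable n s. hop y (y + n) (delta m) s) = (\<Sum>y\<in>?A. hop y (y + n) (delta m) s)"
    by (rule sum.mono_neutral_right)
      (use assms in \<open>auto simp: finite_movable hop_apply delta_def\<close>)
  also have "\<dots> = (\<Sum>x\<in>?B. hop x (x + - n) (delta s) m)"
  proof (rule sum.reindex_bij_witness[of _ "\<lambda>x. x - n" "\<lambda>y. y + n"])
    fix y assume y: "y \<in> ?A"
    then have y': "y \<in> levels s" "y + n \<notin> levels s" "m = move y (y + n) s" by (auto simp: movable_def)
    show "y + n \<in> ?B" using y' move[OF y'] assms by (auto simp: movable_def)
    have "lsgn (y + n) m = lsgn (y + n) (del_level y s)"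
      unfolding move(2)[OF y', symmetric] using y' by (subst lsgn_del_level) auto
    moreover have "lsgn y s = lsgn y (del_level y s)"
      using y' by (subst lsgn_del_level) auto
    moreover have "y \<notin> levels m" "y + n \<in> levels m" using y' assms by auto
    ultimately show "hop (y + n) (y + n + - n) (delta s) m = hop y (y + n) (delta m) s"
      using y' assms move[OF y'] by (simp add: hop_apply delta_def)
  next
    fix x assume x: "x \<in> ?B"
    then have x': "x \<in> levels m" "x + - n \<notin> levels m" "s = move x (x + - n) m" by (auto simp: movable_def)
    show "x - n \<in> ?A" using x' move[OF x'] assms by (auto simp: movable_def)
  qed auto
  also have "\<dots> = (\<Sum>x\<in>movable (- n) m. hop x (x + - n) (delta s) m)"
    by (rule sum.mono_neutral_left)
      (use assms in \<open>auto simp: finite_movable hop_apply delta_def\<close>)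
  finally show ?thesis
    using assms by (simp add: a_op_eq[OF _ finite_movable order_refl])
qed

section \<open>Products of two modes\<close>

definition quad :: "int \<Rightarrow> int \<Rightarrow> int \<Rightarrow> int \<Rightarrow> maya opr" where
  "quad y x w v F = psi (- y - 1) (psi (- x - 1) (psid w (psid v F)))"

text \<open>Wick's rule: moving \<open>psid w\<close> to the right past \<open>psi (- x - 1)\<close>
  leaves one contraction, for \<open>w = x\<close>, and the ordered quartic term.\<close>

lemma hop_hop: "hop y w (hop x v F) S = (if w = x then hop y v F S else 0) - quad y x w v F S"
proof -
  have car: "psid w (psi (- x - 1) G) = (\<lambda>T. (if w = x then 1 else 0) * G T + (- 1) * psi (- x - 1) (psid w G) T)" for G
  proof
    fix T
    have "psid w (psi (- x - 1) G) T = (if - x - 1 + w = - 1 then G T else 0) - psi (- x - 1) (psid w G) T"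
      by (subst eq_diff_eq, subst add.commute, rule psi_psid_anticommute)
    then show "psid w (psi (- x - 1) G) T
        = (if w = x then 1 else 0) * G T + (- 1) * psi (- x - 1) (psid w G) T"
      by simp
  qed
  show ?thesis
    unfolding hop_def quad_def car
    by (simp only: lfin_add[OF lfin_psi] lfin_scale[OF lfin_psi]) simp
qed

lemma quad_swap_psi: "quad x y w v F S = - quad y x w v F S"
  unfolding quad_def using psi_psi_anticommute[of "- x - 1" "- y - 1"] by (simp add: add_eq_0_iff2)

lemma quad_swap_psid: "quad y x v w F S = - quad y x w v F S"
proof -
  have "psid v (psid w F) = (\<lambda>T. - psid w (psid v F) T)"
    using psid_psid_anticommute[of v w F] by (auto simp: add_eq_0_iff2)
  moreover have "psi k (\<lambda>T. - G T) = (\<lambda>T. - psi k G T)" for k G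
    by (auto simp: psi_def)
  ultimately show ?thesis
    unfolding quad_def by simp
qed

lemma quad_swap: "quad x y v w F S = quad y x w v F S"
  using quad_swap_psi[of x y v w F S] quad_swap_psid[of y x v w F S] by simp

text \<open>One finite index set serves both sums, so it has to contain the movable levels of all
  intermediate states besides those of \<open>S\<close>.\<close>

lemma a_op_a_op:
  assumes "n \<noteq> 0" "m \<noteq> 0" "finite I" "\<And>T. a_op m (delta T) S \<noteq> 0 \<Longrightarrow> movable n T \<subseteq> I" "movable m S \<subseteq> I"
  shows "a_op m (a_op n F) S = (\<Sum>y\<in>I. \<Sum>x\<in>I. hop y (y + m) (hop x (x + n) F) S)"
proof -
  have "a_op m (a_op n F) S = a_op m (\<lambda>T. \<Sum>x\<in>I. (- 1) * hop x (x + n) F T) S"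
    by (rule lfin_cong[OF lfin_a_op[OF assms(2)]])
      (simp add: a_op_eq[OF assms(1,3) assms(4)] sum_negf)
  also have "\<dots> = (\<Sum>x\<in>I. - a_op m (hop x (x + n) F) S)"
    by (simp only: lfin_sum_apply[OF lfin_a_op[OF assms(2)]] lfin_scale[OF lfin_a_op[OF assms(2)]]) simp
  also have "\<dots> = (\<Sum>x\<in>I. \<Sum>y\<in>I. hop y (y + m) (hop x (x + n) F) S)"
    by (simp add: a_op_eq[OF assms(2,3,5)])
  also have "\<dots> = (\<Sum>y\<in>I. \<Sum>x\<in>I. hop y (y + m) (hop x (x + n) F) S)"
    by (rule sum.swap)
  finally show ?thesis .
qed

text \<open>The quartic terms agree by \<open>quad_swap\<close>, and both contraction sums equal the
  sum of \<open>hop y (y + (m + n))\<close>, which is finite as \<open>m + n\<close> is nonzero. For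
  opposite modes it would have infinitely many terms; that is where the central term arises.\<close>

lemma a_op_comm:
  assumes "m \<noteq> 0" "n \<noteq> 0" "m + n \<noteq> 0"
  shows "a_op m (a_op n F) = a_op n (a_op m F)"
proof
  fix S
  define M where "M = movable (m + n) S"
  \<comment> \<open>Besides the movable levels of the intermediate states, \<open>I\<close> contains
    \<open>M\<close> and its two shifts, so that the contracted index always lies in it.\<close>
  define I where "I = (\<Union>T\<in>insert S ({T. a_op m (delta T) S \<noteq> 0} \<union> {T. a_op n (delta T) S \<noteq> 0}).
      movable m T \<union> movable n T) \<union> M \<union> (\<lambda>y. y + m) ` M \<union> (\<lambda>y. y + n) ` M"
  have fin: "finite I"
    using lfin_finite[OF lfin_a_op[OF assms(1)]] lfin_finite[OF lfin_a_op[OF assms(2)]]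
    by (auto simp: I_def M_def finite_movable)
  have I: "movable n T \<subseteq> I" if "a_op m (delta T) S \<noteq> 0" for T using that by (auto simp: I_def)
  have I': "movable m T \<subseteq> I" if "a_op n (delta T) S \<noteq> 0" for T using that by (auto simp: I_def)
  have IS: "movable n S \<subseteq> I" "movable m S \<subseteq> I" by (auto simp: I_def)
  have shift: "(\<Sum>y\<in>I. \<Sum>x\<in>I. if y + m = x then hop y (x + n) F S else 0) = (\<Sum>y\<in>M. hop y (y + (m + n)) F S)"
    if "m + n \<noteq> 0" "M = movable (m + n) S" "M \<subseteq> I" "(\<lambda>y. y + m) ` M \<subseteq> I" for m n
  proof -
    have "(\<Sum>y\<in>I. \<Sum>x\<in>I. if y + m = x then hop y (x + n) F S else 0) =
        (\<Sum>y\<in>I. if y + m \<in> I then hop y (y + m + n) F S else 0)"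
      using fin by (simp add: sum.delta)
    also have "\<dots> = (\<Sum>y\<in>M. hop y (y + (m + n)) F S)"
    proof (rule sum.mono_neutral_cong_right[OF fin that(3)])
      show "\<forall>y\<in>I - M. (if y + m \<in> I then hop y (y + m + n) F S else 0) = 0"
        using that(1) by (auto simp: hop_apply that(2) movable_def add.assoc)
      show "(if y + m \<in> I then hop y (y + m + n) F S else 0) = hop y (y + (m + n)) F S" if "y \<in> M" for y
        using that \<open>(\<lambda>y. y + m) ` M \<subseteq> I\<close> by (auto simp: add.assoc)
    qed
    finally show ?thesis .
  qed
  have sh1: "(\<Sum>y\<in>I. \<Sum>x\<in>I. if y + m = x then hop y (x + n) F S else 0) = (\<Sum>y\<in>M. hop y (y + (m + n)) F S)"
    by (rule shift) (use assms in \<open>auto simp: I_def M_def\<close>)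
  have sh2: "(\<Sum>x\<in>I. \<Sum>y\<in>I. if x + n = y then hop x (y + m) F S else 0) = (\<Sum>y\<in>M. hop y (y + (m + n)) F S)"
    using shift[of n m] assms by (auto simp: I_def M_def add.commute)
  have "a_op m (a_op n F) S - a_op n (a_op m F) S =
      (\<Sum>y\<in>I. \<Sum>x\<in>I. hop y (y + m) (hop x (x + n) F) S) - (\<Sum>y\<in>I. \<Sum>x\<in>I. hop x (x + n) (hop y (y + m) F) S)"
    using sum.swap[of "\<lambda>y x. hop y (y + n) (hop x (x + m) F) S" I I]
    by (simp add: a_op_a_op[OF assms(2,1) fin I IS(2)] a_op_a_op[OF assms(1,2) fin I' IS(1)])
  also have "\<dots> = (\<Sum>y\<in>I. \<Sum>x\<in>I. if y + m = x then hop y (x + n) F S else 0)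
      - (\<Sum>y\<in>I. \<Sum>x\<in>I. if x + n = y then hop x (y + m) F S else 0)"
    unfolding sum_subtractf[symmetric] hop_hop
  proof (intro sum.cong refl)
    fix x y
    show "(if y + m = x then hop y (x + n) F S else 0) - quad y x (y + m) (x + n) F S
        - ((if x + n = y then hop x (y + m) F S else 0) - quad x y (x + n) (y + m) F S)
      = (if y + m = x then hop y (x + n) F S else 0) - (if x + n = y then hop x (y + m) F S else 0)"
      using quad_swap[of x y "x + n" "y + m" F S] by simp
  qed
  also have "\<dots> = 0"
    using sh1 sh2 sum.swap[of "\<lambda>y x. if x + n = y then hop x (y + m) F S else 0" I I] by simp
  finally show "a_op m (a_op n F) S = a_op n (a_op m F) S" by simp
qed

text \<open>The terms cancel in pairs: the same transition arises with the two particles, or with the two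
  target levels, exchanged, and this changes the sign.\<close>

lemma sum_quad_eq_0:
  "(\<Sum>(y, w)\<in>inversions S. \<Sum>b\<in>I. quad y b w (b + (y - w)) F S) = 0"
  if I: "finite I" "\<And>y w. (y, w) \<in> inversions S \<Longrightarrow> movable (y - w) S \<subseteq> I"
proof -
  define Q where "Q = {(y, w, b). (y, w) \<in> inversions S \<and> b \<in> movable (y - w) S}"
  define g where "g = (\<lambda>(y, w, b). quad y b w (b + (y - w)) F S)"
  \<comment> \<open>If \<open>w < b\<close> the particles \<open>y\<close> and \<open>b\<close> are
    exchanged, otherwise the target levels \<open>w\<close> and \<open>b + (y - w)\<close>. The case
    distinction keeps the first pair an inversion and makes the map its own inverse on
    \<open>Q\<close>.\<close>
  define \<iota> :: "int \<times> int \<times> int \<Rightarrow> int \<times> int \<times> int"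
    where "\<iota> = (\<lambda>(y, w, b). if w < b then (b, w, y) else (y, b + (y - w), b))"
  have zero: "quad y b w (b + (y - w)) F S = 0" if "(y, w) \<in> inversions S" "b \<notin> movable (y - w) S" for y w b
    using that unfolding quad_def by (auto simp: psi_apply psid_def inversions_def movable_def)
  have "(\<Sum>(y, w)\<in>inversions S. \<Sum>b\<in>I. quad y b w (b + (y - w)) F S)
      = (\<Sum>p\<in>inversions S. \<Sum>b\<in>I. g (fst p, snd p, b))"
    by (simp add: g_def split_def)
  also have "\<dots> = (\<Sum>(p, b)\<in>inversions S \<times> I. g (fst p, snd p, b))"
    by (rule sum.cartesian_product)
  also have "\<dots> = (\<Sum>q\<in>(\<lambda>(y, w, b). ((y, w), b)) ` Q. g (fst (fst q), snd (fst q), snd q))"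
    unfolding split_def
  proof (rule sum.mono_neutral_right)
    show "finite (inversions S \<times> I)" using finite_inversions I(1) by simp
    show "(\<lambda>q. ((fst q, fst (snd q)), snd (snd q))) ` Q \<subseteq> inversions S \<times> I"
      using I(2) by (auto simp: Q_def) blast
    show "\<forall>i\<in>inversions S \<times> I - (\<lambda>q. ((fst q, fst (snd q)), snd (snd q))) ` Q.
        g (fst (fst i), snd (fst i), snd i) = 0"
    proof
      fix i assume i: "i \<in> inversions S \<times> I - (\<lambda>q. ((fst q, fst (snd q)), snd (snd q))) ` Q"
      obtain y w b where yw: "i = ((y, w), b)" by (metis surj_pair)
      have "(y, w, b) \<notin> Q" using i yw by force
      then show "g (fst (fst i), snd (fst i), snd i) = 0"
        using i yw zero[of y w b] by (auto simp: Q_def g_def)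
    qed
  qed
  also have "\<dots> = sum g Q"
    by (subst sum.reindex) (auto simp: inj_on_def split_def)
  finally have eq: "(\<Sum>(y, w)\<in>inversions S. \<Sum>b\<in>I. quad y b w (b + (y - w)) F S) = sum g Q" .
  have "sum g Q = (\<Sum>q\<in>Q. - g q)"
  proof (rule sum.reindex_bij_witness[of _ \<iota> \<iota>])
    fix q assume q: "q \<in> Q"
    obtain y w b where yw: "q = (y, w, b)" by (metis surj_pair)
    have *: "y \<in> levels S" "w \<notin> levels S" "w < y" "b \<in> levels S" "b + (y - w) \<notin> levels S"
      using q by (auto simp: yw Q_def inversions_def movable_def)
    then have "b \<noteq> w" by auto
    have **: "y + (b - w) = b + (y - w)" by simp
    show "\<iota> (\<iota> q) = q" "\<iota> (\<iota> q) = q"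
      using * \<open>b \<noteq> w\<close> by (auto simp: yw \<iota>_def)
    show "\<iota> q \<in> Q" "\<iota> q \<in> Q"
      using * \<open>b \<noteq> w\<close> by (auto simp: yw \<iota>_def Q_def inversions_def movable_def **)
    show "- g (\<iota> q) = g q"
    proof (cases "w < b")
      case True
      then show ?thesis
        using quad_swap_psi[of b y w "b + (y - w)" F S] by (simp add: yw \<iota>_def g_def **)
    next
      case False
      then show ?thesis
        using quad_swap_psid[of y b "b + (y - w)" w F S] by (simp add: yw \<iota>_def g_def)
    qed
  qed
  then have "sum g Q = 0" by (simp add: sum_negf)
  with eq show ?thesis by simp
qed

lemma energy_ge: "(y, w) \<in> inversions S \<Longrightarrow> nat (y - w) \<le> energy S"
  using energy_move[of y S w] by (auto simp: inversions_def)

text \<open>After expansion by \<open>hop_hop\<close> the sum runs over the inversions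
  \<open>(y, w)\<close>. The contraction \<open>b = w\<close> moves the particle back and gives
  \<open>F S\<close>, once for each inversion; the quartic terms cancel by
  \<open>sum_quad_eq_0\<close>.\<close>

theorem a_op_number: "(\<Sum>k=1..energy S. a_op (- int k) (a_op (int k) F) S) = of_nat (energy S) * F S"
proof -
  define I where "I = (\<Union>(y, w)\<in>inversions S. {w} \<union> movable (y - w) S \<union> movable (y - w) (move y w S))"
  have fin: "finite I"
    by (auto simp: I_def finite_inversions finite_movable)
  have I: "w \<in> I" "movable (y - w) S \<subseteq> I" "movable (y - w) (move y w S) \<subseteq> I" if "(y, w) \<in> inversions S" for y w
    using that by (auto simp: I_def)
  have "(\<Sum>k=1..energy S. a_op (- int k) (a_op (int k) F) S) =
      - (\<Sum>k=1..energy S. \<Sum>y\<in>movable (- int k) S. hop y (y - int k) (a_op (int k) F) S)"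
    by (simp add: a_op_eq[OF _ finite_movable order_refl] sum_negf)
  also have "(\<Sum>k=1..energy S. \<Sum>y\<in>movable (- int k) S. hop y (y - int k) (a_op (int k) F) S) =
      (\<Sum>(k, y)\<in>(SIGMA k:{1..energy S}. movable (- int k) S). hop y (y - int k) (a_op (int k) F) S)"
    by (rule sum.Sigma) (simp_all add: finite_movable)
  \<comment> \<open>A mode number \<open>k\<close> with a particle \<open>y\<close> that can move
    down by \<open>k\<close> amounts to the inversion \<open>(y, y - k)\<close>, and
    \<open>k\<close> is at most the energy by \<open>energy_ge\<close>.\<close>
  also have "\<dots> = (\<Sum>(y, w)\<in>inversions S. hop y w (a_op (y - w) F) S)"
  proof (rule sum.reindex_bij_witness[of _ "\<lambda>(y, w). (nat (y - w), y)" "\<lambda>(k, y). (y, y - int k)"])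
    fix p assume p: "p \<in> inversions S"
    obtain y w where yw: "p = (y, w)" by fastforce
    show "(case p of (y, w) \<Rightarrow> (nat (y - w), y)) \<in> (SIGMA k:{1..energy S}. movable (- int k) S)"
      using p energy_ge[of y w S] by (auto simp: yw inversions_def movable_def)
  qed (auto simp: inversions_def movable_def)
  also have "\<dots> = (\<Sum>(y, w)\<in>inversions S. - (\<Sum>b\<in>I. hop y w (hop b (b + (y - w)) F) S))"
  proof (rule sum.cong[OF refl])
    fix p assume p: "p \<in> inversions S"
    obtain y w where yw: "p = (y, w)" by fastforce
    have lt: "y - w \<noteq> 0" "y \<noteq> w" using p by (auto simp: yw inversions_def)
    have "hop y w (a_op (y - w) F) S = hop y w (\<lambda>T. \<Sum>b\<in>I. - 1 * hop b (b + (y - w)) F T) S"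
      unfolding hop_apply[OF lt(2)] a_op_eq[OF lt(1) fin I(3)[OF p[unfolded yw]]] by (simp add: sum_negf)
    also have "\<dots> = - (\<Sum>b\<in>I. hop y w (hop b (b + (y - w)) F) S)"
      by (simp only: lfin_sum_apply[OF lfin_hop] lfin_scale[OF lfin_hop]) (simp add: sum_negf)
    finally show "(case p of (y, w) \<Rightarrow> hop y w (a_op (y - w) F) S)
        = (case p of (y, w) \<Rightarrow> - (\<Sum>b\<in>I. hop y w (hop b (b + (y - w)) F) S))"
      by (simp add: yw)
  qed
  also have "\<dots> = (\<Sum>(y, w)\<in>inversions S. - F S + (\<Sum>b\<in>I. quad y b w (b + (y - w)) F S))"
  proof (rule sum.cong[OF refl])
    fix p assume p: "p \<in> inversions S"
    obtain y w where yw: "p = (y, w)" by fastforce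
    have "(\<Sum>b\<in>I. hop y w (hop b (b + (y - w)) F) S) = (\<Sum>b\<in>I. if w = b then hop y y F S else 0)
        - (\<Sum>b\<in>I. quad y b w (b + (y - w)) F S)"
      unfolding hop_hop sum_subtractf by (intro arg_cong2[of _ _ _ _ "(-)"] sum.cong) auto
    also have "(\<Sum>b\<in>I. if w = b then hop y y F S else 0) = F S"
      using I(1)[OF p[unfolded yw]] p fin by (simp add: yw inversions_def hop_same)
    finally show "(case p of (y, w) \<Rightarrow> - (\<Sum>b\<in>I. hop y w (hop b (b + (y - w)) F) S))
        = (case p of (y, w) \<Rightarrow> - F S + (\<Sum>b\<in>I. quad y b w (b + (y - w)) F S))"
      by (simp add: yw)
  qed
  also have "\<dots> = - (\<Sum>(y, w)\<in>inversions S. F S)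
      + (\<Sum>(y, w)\<in>inversions S. \<Sum>b\<in>I. quad y b w (b + (y - w)) F S)"
    by (simp add: split_def sum.distrib sum_subtractf)
  also have "(\<Sum>(y, w)\<in>inversions S. \<Sum>b\<in>I. quad y b w (b + (y - w)) F S) = 0"
    by (rule sum_quad_eq_0[OF fin I(2)])
  finally show ?thesis by (simp add: energy_def split_def)
qed

section \<open>Partitions and charge-zero states\<close>

lemma part_0 [simp]: "part l 0 = 0"
  using part[of l] by blast

lemma conj_conj [simp]: "conj_part (conj_part l) = l"
  by (rule part_eqI) (simp add: le_conj_part_iff)

lemma part_empty [simp]: "part empty_part i = 0"
  by (simp add: empty_part.rep_eq)

lemma part_bound:
  obtains L where "\<And>j. L < j \<Longrightarrow> part l j = 0"
proof
  fix j assume "Max (insert 0 {i. part l i \<noteq> 0}) < j"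
  moreover have "finite {i. part l i \<noteq> 0}" using part[of l] by blast
  ultimately show "part l j = 0" by (metis (mono_tags, lifting) Max_ge finite_insert insertCI leD mem_Collect_eq)
qed

lemma finite_cells: "finite (skew_cells l e)"
proof -
  obtain L where L: "\<And>j. L < j \<Longrightarrow> part l j = 0"
    using part_bound[of l] by blast
  have "skew_cells l e \<subseteq> {..L} \<times> {..part l 1}"
  proof
    fix c assume "c \<in> skew_cells l e"
    then obtain i j where c: "c = (i, j)" "1 \<le> i" "part e i < j" "j \<le> part l i"
      by (auto simp: skew_cells_def)
    have "i \<le> L" using L[of i] c by (cases "L < i") auto
    then show "c \<in> {..L} \<times> {..part l 1}" using c part_mono[of 1 i l] by auto
  qed
  then show ?thesis by (rule finite_subset) simp
qed

abbreviation cells :: "partition \<Rightarrow> (nat \<times> nat) set" where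
  "cells l \<equiv> skew_cells l empty_part"

lemma cells_iff: "(i, j) \<in> cells l \<longleftrightarrow> 1 \<le> i \<and> 1 \<le> j \<and> j \<le> part l i"
  by (auto simp: skew_cells_def)

lemma cells_Sigma: "cells l = (SIGMA i:{i. part l i \<noteq> 0}. {1..part l i})"
proof -
  have "part l i \<noteq> 0 \<Longrightarrow> 1 \<le> i" for i by (cases i) auto
  then show ?thesis by (auto simp: skew_cells_def Suc_le_eq) 
qed

lemma psize_card: "psize l = card (cells l)"
proof -
  have "finite {i. part l i \<noteq> 0}" using part[of l] by blast
  then show ?thesis by (simp add: cells_Sigma psize_def)
qed

lemma card_skew_cells:
  assumes "contained e l"
  shows "card (skew_cells l e) + psize e = psize l"
proof -
  have "skew_cells l e \<union> cells e = cells l"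
    using assms unfolding contained_def skew_cells_def by (auto intro: le_trans)
  moreover have "skew_cells l e \<inter> cells e = {}"
    unfolding skew_cells_def by auto
  ultimately have "skew_cells l e \<union> cells e = cells l" "skew_cells l e \<inter> cells e = {}" by blast+
  then show ?thesis
    using card_Un_disjoint[OF finite_cells finite_cells, of l e e empty_part] by (simp add: psize_card)
qed

lemma cells_conj: "cells (conj_part l) = prod.swap ` cells l"
proof -
  have "c \<in> cells (conj_part l) \<longleftrightarrow> prod.swap c \<in> cells l" for c
    by (cases c) (auto simp: cells_iff le_conj_part_iff)
  then show ?thesis by (force simp: image_iff)
qed

lemma psize_conj [simp]: "psize (conj_part l) = psize l"
  by (simp add: psize_card cells_conj card_image)

section \<open>Partitions as sets of levels\<close>

definition level_set :: "partition \<Rightarrow> int set" where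
  "level_set l = {int (part l j) - int j | j. 1 \<le> j}"

text \<open>The boundary path of the diagram has vertical and horizontal steps. The rows label the
  former, the columns the latter, and every integer is the label of exactly one step.\<close>

lemma level_set_compl:
  "k \<notin> level_set l \<longleftrightarrow> (\<exists>i\<ge>1. k = int i - int (part (conj_part l) i) - 1)"
proof
  assume "\<exists>i\<ge>1. k = int i - int (part (conj_part l) i) - 1"
  then obtain i where i: "1 \<le> i" "k = int i - int (part (conj_part l) i) - 1" by blast
  show "k \<notin> level_set l"
  proof
    assume "k \<in> level_set l"
    then obtain j where j: "1 \<le> j" "k = int (part l j) - int j" by (auto simp: level_set_def)
    show False
      using le_conj_part_iff[of j i l] i j by (cases "i \<le> part l j") auto
  qed
next
  assume k: "k \<notin> level_set l"
  let ?f = "\<lambda>i. int i - int (part (conj_part l) i) - 1"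
  let ?Q = "\<lambda>i. 1 \<le> i \<and> k \<le> ?f i"
  have "?Q (nat (\<bar>k\<bar>) + 2 + part (conj_part l) 1)"
    using part_mono[of 1 "nat (\<bar>k\<bar>) + 2 + part (conj_part l) 1" "conj_part l"] by auto
  then have ex: "\<exists>i. ?Q i" by blast
  \<comment> \<open>The first column whose label is at least \<open>k\<close>. If its label were
    larger, row \<open>i - 1 - k\<close> would have length exactly \<open>i - 1\<close>, and
    \<open>k\<close> would be the level of that row.\<close>
  define i where "i = (LEAST i. ?Q i)"
  have i: "1 \<le> i" "k \<le> ?f i" using LeastI_ex[OF ex] by (simp_all add: i_def)
  have less: "\<not> ?Q j" if "j < i" for j using not_less_Least[of j ?Q] that by (simp add: i_def)
  have "?f i = k"
  proof (rule ccontr)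
    assume "?f i \<noteq> k"
    then have gt: "k < ?f i" using i by simp
    define j where "j = nat (int i - 1 - k)"
    have j: "1 \<le> j" "part (conj_part l) i < j" "int j = int i - 1 - k" using gt by (simp_all add: j_def)
    have "part l j = i - 1"
    proof (rule antisym)
      show "part l j \<le> i - 1" using le_conj_part_iff[of j i l] j i by (simp add: not_le[symmetric])
      show "i - 1 \<le> part l j"
      proof (cases "i = 1")
        case False
        then have "\<not> k \<le> ?f (i - 1)" using less[of "i - 1"] i by simp
        then have "j \<le> part (conj_part l) (i - 1)" using j i by simp
        then show ?thesis using le_conj_part_iff[of j "i - 1" l] j False i by simp
      qed simp
    qed
    then have "k = int (part l j) - int j" using j i by simp
    with j(1) k show False by (auto simp: level_set_def)
  qed
  with i show "\<exists>i\<ge>1. k = ?f i" by auto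
qed

text \<open>The levels of \<open>ket l\<close> are the \<open>l'\<^sub>j - j\<close> for the conjugate partition \<open>l'\<close>; see \<open>ket_eq\<close>.\<close>

definition row_state :: "partition \<Rightarrow> maya" where
  "row_state l = Abs_maya (level_set l)"

definition ket_state :: "partition \<Rightarrow> maya" where
  "ket_state l = row_state (conj_part l)"

lemma level_strict: "1 \<le> i \<Longrightarrow> i < j \<Longrightarrow> int (part l j) - int j < int (part l i) - int i"
  by (rule strict_part)

lemma level_inj: "1 \<le> i \<Longrightarrow> 1 \<le> j \<Longrightarrow> int (part l j) - int j = int (part l i) - int i \<Longrightarrow> i = j"
  using level_strict[of i j l] level_strict[of j i l] by (cases i j rule: linorder_cases) auto

lemma levels_row_state: "levels (row_state l) = level_set l"
proof -
  obtain L where L: "\<And>j. L < j \<Longrightarrow> part l j = 0"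
    using part_bound[of l] by blast
  have "{k \<in> level_set l. 0 \<le> k} \<subseteq> {0..int (part l 1)}"
  proof
    fix k assume "k \<in> {k \<in> level_set l. 0 \<le> k}"
    then obtain j where "1 \<le> j" "k = int (part l j) - int j" "0 \<le> k" by (auto simp: level_set_def)
    then show "k \<in> {0..int (part l 1)}" using part_mono[of 1 j l] by simp
  qed
  moreover have "{k. k < 0 \<and> k \<notin> level_set l} \<subseteq> {- int L - 1..0}"
  proof
    fix k assume k: "k \<in> {k. k < 0 \<and> k \<notin> level_set l}"
    show "k \<in> {- int L - 1..0}"
    proof (rule ccontr)
      assume "k \<notin> {- int L - 1..0}"
      then have "L < nat (- k)" "1 \<le> nat (- k)" "k = - int (nat (- k))" using k by auto
      then have "k = int (part l (nat (- k))) - int (nat (- k))" using L[of "nat (- k)"] by simp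
      then have "k \<in> level_set l" using \<open>1 \<le> nat (- k)\<close> unfolding level_set_def by blast
      with k show False by simp
    qed
  qed
  ultimately have "level_set l \<in> {S. finite {k \<in> S. 0 \<le> k} \<and> finite {k. k < 0 \<and> k \<notin> S}}"
    by (simp add: finite_subset[OF _ finite_atLeastAtMost_int])
  then show ?thesis by (simp add: row_state_def Abs_maya_inverse)
qed

lemma level_mem: "1 \<le> j \<Longrightarrow> int (part l j) - int j \<in> levels (row_state l)"
  by (auto simp: levels_row_state level_set_def)

lemma hole_nmem: "1 \<le> i \<Longrightarrow> int i - int (part (conj_part l) i) - 1 \<notin> levels (row_state l)"
  unfolding levels_row_state level_set_compl by blast

text \<open>The particle of row \<open>j\<close> lies above the hole of column \<open>i\<close>
  exactly if \<open>(j, i)\<close> is a cell, and then their distance is the hook length of the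
  cell.\<close>

lemma energy_row_state: "energy (row_state l) = psize l"
proof -
  let ?f = "\<lambda>(j, i). (int (part l j) - int j, int i - int (part (conj_part l) i) - 1)"
  have "inversions (row_state l) = ?f ` cells l"
  proof (intro equalityI subsetI)
    fix p assume "p \<in> inversions (row_state l)"
    then obtain y w where p: "p = (y, w)" "y \<in> level_set l" "w \<notin> level_set l" "w < y"
      by (auto simp: inversions_def levels_row_state)
    obtain j where j: "1 \<le> j" "y = int (part l j) - int j" using p by (auto simp: level_set_def)
    obtain i where i: "1 \<le> i" "w = int i - int (part (conj_part l) i) - 1" using p level_set_compl by blast
    have "i \<le> part l j"
      using p(4) i j le_conj_part_iff[of j i l] by (cases "i \<le> part l j") auto
    then have "(j, i) \<in> cells l" using i j by (simp add: cells_iff)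
    then show "p \<in> ?f ` cells l" using p i j by force
  next
    fix p assume "p \<in> ?f ` cells l"
    then obtain i j where c: "(j, i) \<in> cells l" "p = ?f (j, i)" by auto
    then show "p \<in> inversions (row_state l)"
      using level_mem[of j l] hole_nmem[of i l] le_conj_part_iff[of j i l] by (auto simp: cells_iff inversions_def)
  qed
  moreover have "inj_on ?f (cells l)"
  proof (rule inj_onI)
    fix p q assume pq: "p \<in> cells l" "q \<in> cells l" "?f p = ?f q"
    obtain i j i' j' where e: "p = (j, i)" "q = (j', i')" by fastforce
    have "j = j'" using pq level_inj[of j j' l] by (auto simp: e cells_iff)
    moreover have "i = i'" using pq level_inj[of i i' "conj_part l"] by (auto simp: e cells_iff)
    ultimately show "p = q" by (simp add: e)
  qed
  ultimately show ?thesis by (simp add: energy_def card_image psize_card)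
qed

lemma energy_ket_state: "energy (ket_state l) = psize l"
  by (simp add: ket_state_def energy_row_state)

lemma row_state_empty: "row_state empty_part = sea"
proof (rule maya_eqI)
  have "k \<in> level_set empty_part" if "k < 0" for k
    unfolding level_set_def by (rule CollectI, rule exI[of _ "nat (- k)"]) (use that in auto)
  then show "levels (row_state empty_part) = levels sea"
    by (auto simp: levels_row_state) (auto simp: level_set_def)
qed

lemma conj_empty [simp]: "conj_part empty_part = empty_part"
  using le_conj_part_iff[of _ _ empty_part] by (intro part_eqI) auto

lemma ket_state_empty: "ket_state empty_part = sea"
  by (simp add: ket_state_def row_state_empty)

lemma part_eqI': "(\<And>i. 1 \<le> i \<Longrightarrow> part l i = part m i) \<Longrightarrow> l = m"
  by (rule part_eqI) simp

lemma psize_0: "psize l = 0 \<longleftrightarrow> l = empty_part"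
proof
  assume "psize l = 0"
  then have "cells l = {}" using finite_cells[of l empty_part] by (simp add: psize_card)
  then have "part l i = 0" if "1 \<le> i" for i
    using cells_iff[of i 1 l] that by (cases "part l i = 0") auto
  then show "l = empty_part" by (intro part_eqI') simp
next
  assume "l = empty_part" then show "psize l = 0" by (simp add: psize_def)
qed

section \<open>Level counts and moves of charge-zero states\<close>

definition count_ge :: "maya \<Rightarrow> int \<Rightarrow> nat" where
  "count_ge S x = card {k \<in> levels S. x \<le> k}"

text \<open>The level decreases strictly with the row, so the rows whose level is at least
  \<open>x\<close> form an initial segment, and the count is its length. The counts therefore
  determine the partition.\<close>

lemma le_count_ge_iff:
  assumes "1 \<le> i"
  shows "i \<le> count_ge (row_state l) x \<longleftrightarrow> x \<le> int (part l i) - int i"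
proof -
  let ?A = "{i. 1 \<le> i \<and> x \<le> int (part l i) - int i}"
  have "?A = {1..card ?A}"
  proof (rule finite_initial_segment)
    have "?A \<subseteq> {..nat (int (part l 1) - x)}"
    proof
      fix i assume "i \<in> ?A"
      then show "i \<in> {..nat (int (part l 1) - x)}"
        using part_mono[of 1 i l] by (simp add: le_nat_iff)
    qed
    then show "finite ?A" by (rule finite_subset) simp
    fix i j assume "j \<in> ?A" "1 \<le> i" "i \<le> j"
    then show "i \<in> ?A" using level_strict[of i j l] by (cases "i = j") auto
  qed simp
  moreover have "count_ge (row_state l) x = card ?A"
  proof -
    have "{k \<in> levels (row_state l). x \<le> k} = (\<lambda>i. int (part l i) - int i) ` ?A"
      by (auto simp: levels_row_state level_set_def)
    moreover have "inj_on (\<lambda>i. int (part l i) - int i) ?A"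
      by (rule inj_onI) (use level_inj in auto)
    ultimately show ?thesis by (simp add: count_ge_def card_image)
  qed
  ultimately have "?A = {1..count_ge (row_state l) x}" by simp
  then have "i \<in> ?A \<longleftrightarrow> i \<in> {1..count_ge (row_state l) x}" by (rule arg_cong)
  then show ?thesis using assms by simp
qed

lemma row_state_inject: "row_state l = row_state m \<longleftrightarrow> l = m"
proof
  assume eq: "row_state l = row_state m"
  show "l = m"
  proof (rule part_eqI')
    fix i :: nat assume i: "1 \<le> i"
    show "part l i = part m i"
      using le_count_ge_iff[OF i, of l "int (part l i) - int i"] le_count_ge_iff[OF i, of m "int (part l i) - int i"]
        le_count_ge_iff[OF i, of l "int (part m i) - int i"] le_count_ge_iff[OF i, of m "int (part m i) - int i"]
      by (simp add: eq)
  qed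
qed simp

lemma count_ge_level:
  assumes "1 \<le> j"
  shows "count_ge (row_state l) (int (part l j) - int j) = j"
proof (rule antisym)
  show "j \<le> count_ge (row_state l) (int (part l j) - int j)"
    using le_count_ge_iff[OF assms, of l] by simp
  show "count_ge (row_state l) (int (part l j) - int j) \<le> j"
    using le_count_ge_iff[of "Suc j" l "int (part l j) - int j"] level_strict[OF assms, of "Suc j" l] by simp
qed

lemma ket_state_inject: "ket_state l = ket_state m \<longleftrightarrow> l = m"
  unfolding ket_state_def row_state_inject by (metis conj_conj)

text \<open>The unit move removes the last box of row \<open>j\<close>. Since level \<open>u\<close>
  is empty, the next row is strictly shorter, so the box is a corner.\<close>

lemma row_state_step:
  assumes "u + 1 \<in> levels (row_state l)" "u \<notin> levels (row_state l)"
  shows "\<exists>m. move (u + 1) u (row_state l) = row_state m"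
proof -
  obtain j where j: "1 \<le> j" "u + 1 = int (part l j) - int j"
    using assms by (auto simp: levels_row_state level_set_def)
  have "part l (j + 1) \<noteq> part l j"
  proof
    assume "part l (j + 1) = part l j"
    then have "u = int (part l (j + 1)) - int (j + 1)" using j by simp
    then show False using assms(2) level_mem[of "j + 1" l] by simp
  qed
  then have lt: "part l (j + 1) < part l j" using part_mono[of j "j + 1" l] j by simp
  define p where "p = (part l)(j := part l j - 1)"
  have "p 0 = 0 \<and> (\<forall>i k. 1 \<le> i \<longrightarrow> i \<le> k \<longrightarrow> p k \<le> p i) \<and> finite {i. p i \<noteq> 0}"
  proof (intro conjI allI impI)
    show "p 0 = 0" by (simp add: p_def)
    have "finite {i. part l i \<noteq> 0}" using part[of l] by blast
    then show "finite {i. p i \<noteq> 0}"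
      by (rule rev_finite_subset) (auto simp: p_def)
    fix i k :: nat assume ik: "1 \<le> i" "i \<le> k"
    show "p k \<le> p i"
    proof (cases "i = j \<and> k \<noteq> j")
      case True
      then have "part l k \<le> part l (j + 1)" using ik part_mono[of "j + 1" k l] j by simp
      then show ?thesis using True lt by (simp add: p_def)
    next
      case False
      then show ?thesis using part_mono[OF ik, of l] by (auto simp: p_def)
    qed
  qed
  then have part: "part (Abs_partition p) = p" by (simp add: Abs_partition_inverse)
  have "move (u + 1) u (row_state l) = row_state (Abs_partition p)"
  proof (rule maya_eqI, intro equalityI subsetI)
    fix k assume "k \<in> levels (move (u + 1) u (row_state l))"
    then consider "k = u" | i where "1 \<le> i" "k = int (part l i) - int i" "k \<noteq> u + 1"
      by (auto simp: levels_row_state level_set_def)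
    then show "k \<in> levels (row_state (Abs_partition p))"
    proof cases
      case 1
      then have "k = int (p j) - int j" using j lt by (simp add: p_def)
      then show ?thesis using level_mem[OF j(1), of "Abs_partition p"] by (simp add: part)
    next
      case 2
      then have "k = int (p i) - int i" using j by (auto simp: p_def)
      then show ?thesis using level_mem[OF 2(1), of "Abs_partition p"] by (simp add: part)
    qed
  next
    fix k assume "k \<in> levels (row_state (Abs_partition p))"
    then obtain i where i: "1 \<le> i" "k = int (p i) - int i" by (auto simp: levels_row_state level_set_def part)
    show "k \<in> levels (move (u + 1) u (row_state l))"
    proof (cases "i = j")
      case True
      then show ?thesis using i j lt by (simp add: p_def)
    next
      case False
      then show ?thesis using i level_mem[OF i(1), of l] level_inj[OF i(1) j(1), of l] j(2) by (auto simp: p_def)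
    qed
  qed
  then show ?thesis by blast
qed

lemma row_state_move:
  assumes "S \<in> range row_state" "y \<in> levels S" "w \<notin> levels S" "w < y"
  shows "move y w S \<in> range row_state"
proof -
  have "S \<in> range row_state \<longrightarrow> move y w S \<in> range row_state"
    using assms(2-4)
    by (induction rule: move_steps[where P = "\<lambda>i S T. S \<in> range row_state \<longrightarrow> T \<in> range row_state"])
      (use row_state_step in blast)+
  with assms(1) show ?thesis by blast
qed

text \<open>The charge-zero sector is \<open>range row_state\<close>: it is closed under downward
  moves, and its only state without inversions is the sea.\<close>

interpretation bosons "\<lambda>k. a_op (- int k)" energy "\<lambda>k. a_op (int k)" "range row_state" sea
proof
  fix k j :: nat and s m :: maya and F :: "maya vec"
  assume k: "1 \<le> k"
  show "lfin (a_op (- int k))" "lfin (a_op (int k))"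
    using k by (simp_all add: lfin_a_op)
  show "a_op (int k) (delta m) s = a_op (- int k) (delta s) m"
    using a_op_transpose[of "int k"] k by simp
  show "comm (a_op (- int j)) (a_op (- int k))" if "1 \<le> j"
    using a_op_comm[of "- int j" "- int k"] k that by (simp add: comm_def)
  assume nz: "a_op (- int k) (delta m) s \<noteq> 0"
  have "- int k \<noteq> 0" using k by simp
  from this nz obtain y where y: "y \<in> levels s" "y + - int k \<notin> levels s" "m = move y (y + - int k) s"
    by (rule a_op_delta)
  have lt: "y + - int k < y" using k by simp
  show "energy s = energy m + k" using energy_move[OF y(1,2) lt] y(3) by simp
  show "m \<in> range row_state" if "s \<in> range row_state" using row_state_move[OF that y(1,2) lt] y(3) by simp
next
  show "(\<Sum>k=1..energy s. a_op (- int k) (a_op (int k) F) s) = of_nat (energy s) * F s" for s F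
    by (rule a_op_number)
  show "energy s = 0 \<longleftrightarrow> s = sea" if "s \<in> range row_state" for s
    using that by (auto simp: energy_row_state psize_0 row_state_empty[symmetric] row_state_inject)
  show "sea \<in> range row_state" by (simp flip: row_state_empty)
qed

section \<open>The vectors \<open>ket\<close> with their signs\<close>

lemma levels_ket_state: "levels (ket_state l) = ket_levels l {1..pdiag l}"
proof (rule set_eqI)
  fix k
  show "k \<in> levels (ket_state l) \<longleftrightarrow> k \<in> ket_levels l {1..pdiag l}"
  proof (cases "0 \<le> k")
    case True
    then show ?thesis
      unfolding ket_levels_nonneg[OF True] ket_state_def levels_row_state level_set_def by auto
  next
    case False
    then have "k \<notin> ket_levels l {1..pdiag l} \<longleftrightarrow> (\<exists>i\<ge>1. k = int i - int (part l i) - 1)"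
      by (subst ket_levels_neg) (force)+
    moreover have "k \<notin> levels (ket_state l) \<longleftrightarrow> (\<exists>i\<ge>1. k = int i - int (part l i) - 1)"
      using level_set_compl[of k "conj_part l"] by (simp only: ket_state_def levels_row_state conj_conj)
    ultimately show ?thesis by blast
  qed
qed

lemma psid_basis_vec_sgn:
  assumes "k \<in> D"
  shows "psid k (basis_vec D c) = basis_vec (D - {k}) ((-1) ^ card {j \<in> D. k < j} * c)"
proof
  fix S
  show "psid k (basis_vec D c) S = basis_vec (D - {k}) ((-1) ^ card {j \<in> D. k < j} * c) S"
  proof (cases "levels S = D - {k}")
    case True
    then have "{j \<in> levels S. k < j} = {j \<in> D. k < j}" by auto
    then show ?thesis using True assms by (auto simp: psid_def basis_vec_def lsgn_def)
  next
    case False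
    then show ?thesis by (auto simp: psid_def basis_vec_def)
  qed
qed

lemma psi_basis_vec_sgn:
  assumes "k \<notin> D"
  shows "psi (- k - 1) (basis_vec D c) = basis_vec (insert k D) ((-1) ^ card {j \<in> D. k < j} * c)"
proof
  fix S
  show "psi (- k - 1) (basis_vec D c) S = basis_vec (insert k D) ((-1) ^ card {j \<in> D. k < j} * c) S"
  proof (cases "levels S = insert k D")
    case True
    then have "{j \<in> levels S. k < j} = {j \<in> D. k < j}" by auto
    then show ?thesis using True assms by (auto simp: psi_apply basis_vec_def lsgn_def)
  next
    case False
    then show ?thesis by (auto simp: psi_apply basis_vec_def)
  qed
qed

text \<open>The signs cancel. Between the new hole of row \<open>i\<close> and level 0 there are
  \<open>part l i - i\<close> places; the holes made so far are missing among them, but as many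
  particles have been added above. The new particle lies above everything. The resulting sign is the
  prefactor in \<open>ket\<close>.\<close>

lemma ket_eq: "ket l = delta (ket_state l)"
proof -
  let ?d = "pdiag l"
  let ?f = "\<lambda>i F S. (-1) powi (int i - int (part l i)) *
        psi (int i - int (part (conj_part l) i) - 1) (psid (int i - int (part l i) - 1) F) S"
  let ?h = "\<lambda>i. int i - int (part l i) - 1" and ?p = "\<lambda>i. int (part (conj_part l) i) - int i"
  \<comment> \<open>Downward induction, since \<open>foldr\<close> applies the factor of row
    \<open>pdiag l\<close> first.\<close>
  have main: "foldr ?f [i..<Suc ?d] vac = basis_vec (ket_levels l {i..?d}) 1" if "1 \<le> i" "i \<le> Suc ?d" for i
    using that(2,1)
  proof (induction i rule: inc_induct)
    case base
    have "levels S = {k. k < 0} \<longleftrightarrow> S = sea" for S by (metis levels_inject levels_sea)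
    then show ?case by (auto simp: vac_def basis_vec_def ket_levels_def fun_eq_iff)
  next
    case (step i)
    define D where "D = ket_levels l {Suc i..?d}"
    have i: "1 \<le> i" "i \<le> ?d" using step by auto
    have rng: "j \<le> part l j" "j \<le> part (conj_part l) j" if "j \<in> {i..?d}" for j
      using le_pdiag_iff[of j l] le_conj_part_iff[of j j l] that i by auto
    have hp: "?h j < 0" "0 \<le> ?p j" if "j \<in> {i..?d}" for j using rng[OF that] by auto
    have lt: "?h i < ?h j" "?p j < ?p i" if "j \<in> {Suc i..?d}" for j
      using level_strict[of i j l] level_strict[of i j "conj_part l"] that i by auto
    have pI: "0 \<le> x" if x: "x \<in> ?p ` {Suc i..?d}" for x
    proof -
      obtain j where "j \<in> {Suc i..?d}" "x = ?p j" using x by blast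
      then show ?thesis using hp(2)[of j] by simp
    qed
    have inj: "inj_on ?h {Suc i..?d}" "inj_on ?p {Suc i..?d}"
      by (rule inj_onI, rule level_inj[of _ _ l] level_inj[of _ _ "conj_part l"], use i in auto)+
    have hD: "?h i \<in> D"
      using hp[of i] i lt(1) by (fastforce simp: D_def ket_levels_def)
    have pD: "?p i \<notin> D - {?h i}"
      using hp[of i] i lt(2) by (fastforce simp: D_def ket_levels_def)
    have "{j \<in> D. ?h i < j} = ({?h i<..<0} - ?h ` {Suc i..?d}) \<union> ?p ` {Suc i..?d}"
      using pI hp(1)[of i] i by (fastforce simp: D_def ket_levels_def)
    also have "card \<dots> = card ({?h i<..<0} - ?h ` {Suc i..?d}) + card (?p ` {Suc i..?d})"
    proof (rule card_Un_disjoint)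
      show "({?h i<..<0} - ?h ` {Suc i..?d}) \<inter> ?p ` {Suc i..?d} = {}"
        using pI by (meson Diff_iff disjoint_iff greaterThanLessThan_iff not_le)
    qed simp_all
    also have "card ({?h i<..<0} - ?h ` {Suc i..?d}) = card {?h i<..<0} - card (?h ` {Suc i..?d})"
      by (rule card_Diff_subset) (use lt(1) hp(1) i in auto)
    also have "\<dots> + card (?p ` {Suc i..?d}) = card {?h i<..<0}"
    proof -
      have "card (?h ` {Suc i..?d}) \<le> card {?h i<..<0}"
        by (rule card_mono) (use lt(1) hp(1) i in auto)
      then show ?thesis using inj by (simp add: card_image)
    qed
    finally have c1: "card {j \<in> D. ?h i < j} = part l i - i"
      using hp[of i] i rng[of i] by simp
    have "{j \<in> D - {?h i}. ?p i < j} = {}"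
      using hp[of i] i lt(2) by (fastforce simp: D_def ket_levels_def)
    then have c2: "card {j \<in> D - {?h i}. ?p i < j} = 0" by (simp only: card.empty)
    have lev: "insert (?p i) (D - {?h i}) = ket_levels l {i..?d}"
    proof -
      have "{i..?d} = insert i {Suc i..?d}" using i by auto
      moreover have "?h i \<notin> ?p ` {Suc i..?d}" using pI hp(1)[of i] i by (meson atLeastAtMost_iff le_refl not_le)
      ultimately show ?thesis unfolding D_def ket_levels_def by auto
    qed
    define e :: complex where "e = (-1) ^ (part l i - i)"
    have e: "e * e = 1" by (simp add: e_def flip: power_add mult_2)
    have "psi (- ?p i - 1) (psid (?h i) (basis_vec D 1)) = basis_vec (ket_levels l {i..?d}) e"
      unfolding psid_basis_vec_sgn[OF hD] psi_basis_vec_sgn[OF pD] c1 c2 lev e_def by simp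
    moreover have "int i - int (part (conj_part l) i) - 1 = - ?p i - 1" by simp
    ultimately have psis: "psi (int i - int (part (conj_part l) i) - 1) (psid (?h i) (basis_vec D 1))
        = basis_vec (ket_levels l {i..?d}) e" by (simp only:)
    have pow: "(-1) powi (int i - int (part l i)) = e"
    proof -
      have "int i - int (part l i) = - int (part l i - i)" using rng[of i] i by simp
      then show ?thesis
        by (simp only: e_def power_int_minus power_int_of_nat power_inverse[symmetric]) simp
    qed
    have upt: "[i..<Suc ?d] = i # [Suc i..<Suc ?d]" using i by (simp add: upt_conv_Cons)
    have IH: "foldr ?f [Suc i..<Suc ?d] vac = basis_vec D 1" 
      unfolding D_def by (rule step.IH) simp
    have "foldr ?f [i..<Suc ?d] vac = (\<lambda>S. e * basis_vec (ket_levels l {i..?d}) e S)"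
      by (simp only: upt foldr.simps o_apply IH psis pow)
    also have "\<dots> = basis_vec (ket_levels l {i..?d}) 1"
      by (rule ext) (simp add: basis_vec_def e)
    finally show ?case .
  qed
  have "ket l = basis_vec (ket_levels l {1..?d}) 1"
    unfolding ket_def using main[of 1] by simp
  also have "\<dots> = delta (ket_state l)"
    unfolding levels_ket_state[symmetric] by (rule ext) (simp add: basis_vec_def delta_def levels_inject)
  finally show ?thesis .
qed

lemma bra_eq: "bra l F = F (ket_state l)"
proof -
  have "bra l F = (\<Sum>T\<in>{ket_state l}. delta (ket_state l) T * F T)"
    unfolding bra_def ket_eq by (rule infsum_finite_support) (auto simp: delta_def)
  then show ?thesis by (simp add: delta_def)
qed

section \<open>Raising operators in one variable\<close>

lemma rsum_inversions:
  "rsum z F S = - (\<Sum>(y, w)\<in>inversions S. z (nat (y - w)) * hop y w F S)"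
proof -
  have "rsum z F S = - (\<Sum>k=1..energy S. \<Sum>y\<in>movable (- int k) S. z k * hop y (y - int k) F S)"
    by (simp add: rsum_eq[OF order_refl] a_op_eq[OF _ finite_movable order_refl] sum_negf sum_distrib_left)
  also have "(\<Sum>k=1..energy S. \<Sum>y\<in>movable (- int k) S. z k * hop y (y - int k) F S) =
      (\<Sum>(k, y)\<in>(SIGMA k:{1..energy S}. movable (- int k) S). z k * hop y (y - int k) F S)"
    by (rule sum.Sigma) (simp_all add: finite_movable)
  also have "\<dots> = (\<Sum>(y, w)\<in>inversions S. z (nat (y - w)) * hop y w F S)"
  proof (rule sum.reindex_bij_witness[of _ "\<lambda>(y, w). (nat (y - w), y)" "\<lambda>(k, y). (y, y - int k)"])
    fix p assume p: "p \<in> inversions S"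
    obtain y w where yw: "p = (y, w)" by fastforce
    show "(case p of (y, w) \<Rightarrow> (nat (y - w), y)) \<in> (SIGMA k:{1..energy S}. movable (- int k) S)"
      using p energy_ge[of y w S] by (auto simp: yw inversions_def movable_def)
  qed (auto simp: inversions_def movable_def)
  finally show ?thesis .
qed

text \<open>The parity of the particles jumped over. For a partition this is the sign of the height
  of the removed border strip, as in the Murnaghan-Nakayama rule.\<close>

definition move_sign :: "maya \<Rightarrow> int \<Rightarrow> int \<Rightarrow> complex" where
  "move_sign S y w = (-1) ^ card {j \<in> levels S. w < j \<and> j < y}"

text \<open>Particles above \<open>y\<close> contribute to both signs in \<open>hop\<close> and
  cancel.\<close>

lemma hop_sign:
  assumes "(y, w) \<in> inversions S"
  shows "hop y w F S = move_sign S y w * F (move y w S)"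
proof -
  have yw: "y \<in> levels S" "w \<notin> levels S" "w < y" using assms by (auto simp: inversions_def)
  let ?A = "{j \<in> levels S. y < j}" and ?B = "{j \<in> levels S. w < j \<and> j < y}"
  have fin: "finite ?A" "finite ?B"
    by (rule levels_finite_above, rule finite_subset[OF _ levels_finite_above[of S w]]) auto
  have "{j \<in> levels (del_level y S). w < j} = ?A \<union> ?B" using yw by auto
  then have "card {j \<in> levels (del_level y S). w < j} = card (?A \<union> ?B)" by (rule arg_cong)
  also have "\<dots> = card ?A + card ?B" by (rule card_Un_disjoint[OF fin]) auto
  finally have "lsgn y S * lsgn w (del_level y S) = move_sign S y w"
    by (simp add: lsgn_def move_sign_def power_add)
  then show ?thesis using yw by (simp add: hop_apply)
qed

lemma count_ge_move:
  assumes "y \<in> levels S" "w \<notin> levels S" "w < y"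
  shows "count_ge S k = count_ge (move y w S) k + (if w < k \<and> k \<le> y then 1 else 0)"
proof -
  have fin: "finite {j \<in> levels S. k \<le> j}" for k
    by (rule finite_subset[OF _ levels_finite_above[of S "k - 1"]]) auto
  let ?A = "{j \<in> levels S. k \<le> j}"
  consider "k \<le> w" | "w < k" "k \<le> y" | "y < k" by linarith
  then show ?thesis
  proof cases
    case 1
    then have "{j \<in> levels (move y w S). k \<le> j} = insert w (?A - {y})" using assms by auto
    moreover have "card (insert w (?A - {y})) = Suc (card (?A - {y}))"
      using fin assms by (simp add: card_insert_if)
    moreover have "Suc (card (?A - {y})) = card ?A"
      by (rule card_Suc_Diff1) (use fin 1 assms in auto)
    ultimately show ?thesis using 1 by (simp add: count_ge_def)
  next
    case 2
    then have "{j \<in> levels (move y w S). k \<le> j} = ?A - {y}" using assms by auto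
    moreover have "Suc (card (?A - {y})) = card ?A"
      by (rule card_Suc_Diff1) (use fin 2 assms in auto)
    ultimately show ?thesis using 2 by (simp add: count_ge_def)
  next
    case 3
    then have "{j \<in> levels (move y w S). k \<le> j} = ?A" using assms by auto
    then show ?thesis using 3 by (simp add: count_ge_def)
  qed
qed

section \<open>Horizontal strips and interlacing\<close>

definition hstrip :: "partition \<Rightarrow> partition \<Rightarrow> bool" where
  "hstrip l m \<longleftrightarrow> contained m l \<and> (\<forall>i\<ge>1. part l (Suc i) \<le> part m i)"

text \<open>The strip condition in terms of counts. By \<open>count_ge_move\<close> a move changes
  each count by at most 1, so the condition can be followed through a move.\<close>

definition interlace :: "maya \<Rightarrow> maya \<Rightarrow> bool" where
  "interlace S T \<longleftrightarrow> (\<forall>k\<in>levels T. count_ge S k = count_ge T k)"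

lemma interlace_row_state: "interlace (row_state l) (row_state m) \<longleftrightarrow> hstrip l m"
proof -
  have "count_ge (row_state l) (int (part m j) - int j) = j \<longleftrightarrow> part m j \<le> part l j \<and> part l (Suc j) \<le> part m j"
    if "1 \<le> j" for j
  proof -
    have "count_ge (row_state l) (int (part m j) - int j) = j \<longleftrightarrow>
        j \<le> count_ge (row_state l) (int (part m j) - int j) \<and> \<not> Suc j \<le> count_ge (row_state l) (int (part m j) - int j)"
      by linarith
    then show ?thesis
      using le_count_ge_iff[OF that, of l] le_count_ge_iff[of "Suc j" l] by auto
  qed
  then have "interlace (row_state l) (row_state m) \<longleftrightarrow> (\<forall>j\<ge>1. part m j \<le> part l j \<and> part l (Suc j) \<le> part m j)"
    by (auto simp: interlace_def levels_row_state level_set_def count_ge_level simp del: of_nat_Suc)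
  moreover have "contained m l \<longleftrightarrow> (\<forall>j\<ge>1. part m j \<le> part l j)"
    unfolding contained_def by (metis le_refl less_one not_le part_0)
  ultimately show ?thesis by (auto simp: hstrip_def)
qed

lemma contained_psize: "contained m l \<Longrightarrow> psize m \<le> psize l"
  using card_skew_cells[of m l] by simp

lemma skew_cells_empty_iff: "contained e l \<Longrightarrow> skew_cells l e = {} \<longleftrightarrow> l = e"
proof
  assume c: "contained e l" and "skew_cells l e = {}"
  then have "\<not> (part e i < part l i \<and> part l i \<le> part l i)" if "1 \<le> i" for i
    using that unfolding skew_cells_def by blast
  then show "l = e" using c by (intro part_eqI') (auto simp: contained_def not_less intro: le_antisym)
qed (auto simp: skew_cells_def)

lemma contained_psize_eq: "contained e l \<Longrightarrow> psize l \<le> psize e \<Longrightarrow> l = e"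
  using card_skew_cells[of e l] skew_cells_empty_iff[of e l] card_0_eq[OF finite_cells[of l e]]
  by auto

text \<open>If \<open>l / m\<close> is a horizontal strip, the admissible moves keep a particle within its own slot
  between consecutive levels of \<open>m\<close>. Otherwise they must take one of two particles out of a doubly
  occupied slot, and the two choices cancel.\<close>

lemma sum_interlace:
  "(\<Sum>(y, w)\<in>{(y, w) \<in> inversions (row_state l). interlace (move y w (row_state l)) (row_state m)}. move_sign (row_state l) y w) =
    (if hstrip l m then of_nat (psize l) - of_nat (psize m) else 0)"
proof -
  let ?S = "row_state l" and ?T = "row_state m"
  define f where "f i = int (part l i) - int i" for i
  define g where "g i = int (part m i) - int i" for i
  have f: "f j < f i" if "1 \<le> i" "i < j" for i j unfolding f_def by (rule level_strict[OF that])
  have g: "g j < g i" if "1 \<le> i" "i < j" for i j unfolding g_def by (rule level_strict[OF that])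
  have f_le: "f j \<le> f i \<longleftrightarrow> i \<le> j" if "1 \<le> i" "1 \<le> j" for i j
    using f[of i j] f[of j i] that by (cases i j rule: linorder_cases) auto
  have f_mem: "f i \<in> levels ?S" if "1 \<le> i" for i unfolding f_def by (rule level_mem[OF that])
  have f_ex: "\<exists>i\<ge>1. y = f i" if "y \<in> levels ?S" for y
    using that by (auto simp: levels_row_state level_set_def f_def)
  have g_ex: "\<exists>i\<ge>1. y = g i" if "y \<in> levels ?T" for y
    using that by (auto simp: levels_row_state level_set_def g_def)
  have g_mem: "g i \<in> levels ?T" if "1 \<le> i" for i unfolding g_def by (rule level_mem[OF that])
  have le_count_ge: "i \<le> count_ge ?S x \<longleftrightarrow> x \<le> f i" if "1 \<le> i" for i x
    unfolding f_def by (rule le_count_ge_iff[OF that])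
  have count_ge_T: "count_ge ?T (g i) = i" if "1 \<le> i" for i unfolding g_def by (rule count_ge_level[OF that])
  define Q where "Q = {(y, w) \<in> inversions ?S. interlace (move y w ?S) ?T}"
  have finQ: "finite Q" unfolding Q_def by (rule finite_subset[OF _ finite_inversions[of ?S]]) auto
  \<comment> \<open>A move lowers the count exactly at the thresholds above \<open>w\<close> and up
    to \<open>y\<close>, so before the move these counts must exceed the prescribed ones by
    one.\<close>
  have Q_iff: "(y, w) \<in> Q \<longleftrightarrow> (y, w) \<in> inversions ?S \<and>
      (\<forall>k\<in>levels ?T. count_ge ?S k = count_ge ?T k + (if w < k \<and> k \<le> y then 1 else 0))" for y w
  proof -
    have "(y, w) \<in> inversions ?S \<Longrightarrow> interlace (move y w ?S) ?T \<longleftrightarrow>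
        (\<forall>k\<in>levels ?T. count_ge ?S k = count_ge ?T k + (if w < k \<and> k \<le> y then 1 else 0))"
      using count_ge_move[of y ?S w] unfolding interlace_def inversions_def by auto
    then show ?thesis unfolding Q_def by blast
  qed
  show ?thesis
  proof (cases "hstrip l m")
    case True
    then have eq: "count_ge ?S k = count_ge ?T k" if "k \<in> levels ?T" for k
      using that interlace_row_state[of l m] by (simp add: interlace_def)
    have hs: "g i \<le> f i" "f (Suc i) < g i" if "1 \<le> i" for i
      using True that by (auto simp: hstrip_def contained_def f_def g_def)
    \<comment> \<open>The cell \<open>(j, c)\<close> of the strip stands for shortening row
      \<open>j\<close> to length \<open>c - 1\<close>.\<close>
    let ?h = "\<lambda>(j, c). (f j, int c - 1 - int j)"
    have "Q = ?h ` skew_cells l m"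
    proof (intro equalityI subsetI)
      fix p assume "p \<in> Q"
      then obtain y w where p: "p = (y, w)" "(y, w) \<in> Q" by (cases p) auto
      then have inv: "y \<in> levels ?S" "w \<notin> levels ?S" "w < y"
        and none: "\<not> (w < k \<and> k \<le> y)" if "k \<in> levels ?T" for k
        using eq that unfolding Q_iff inversions_def by (auto split: if_splits)
      obtain j where j: "1 \<le> j" "y = f j" using f_ex[of y] p unfolding Q_iff inversions_def by auto
      have w: "w < y" "g j \<le> w" using none[OF g_mem[OF j(1)]] hs(1)[OF j(1)] j p unfolding Q_iff inversions_def by auto
      then have c: "(j, nat (w + 1 + int j)) \<in> skew_cells l m" "int (nat (w + 1 + int j)) = w + 1 + int j"
        using j by (auto simp: skew_cells_def f_def g_def)
      have "p = ?h (j, nat (w + 1 + int j))" using c(2) by (simp add: p(1) j(2))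
      then show "p \<in> ?h ` skew_cells l m" using c(1) by blast
    next
      fix p assume "p \<in> ?h ` skew_cells l m"
      then obtain j c where c: "1 \<le> j" "part m j < c" "c \<le> part l j" "p = (f j, int c - 1 - int j)"
        by (auto simp: skew_cells_def)
      let ?w = "int c - 1 - int j"
      have w: "?w < f j" "g j \<le> ?w" using c by (auto simp: f_def g_def)
      have "?w \<notin> levels ?S"
      proof
        assume "?w \<in> levels ?S"
        then obtain i where i: "1 \<le> i" "?w = f i" using f_ex by blast
        then have "j < i" using w f_le[of i j] c(1) by (cases "j < i") auto
        then have "f i \<le> f (Suc j)" using f_le[of "Suc j" i] i by simp
        then show False using hs(2)[OF c(1)] w i by simp
      qed
      then have inv: "(f j, ?w) \<in> inversions ?S" using f_mem[OF c(1)] w by (simp add: inversions_def)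
      have "\<not> (?w < k \<and> k \<le> f j)" if "k \<in> levels ?T" for k
      proof -
        obtain i where i: "1 \<le> i" "k = g i" using g_ex \<open>k \<in> levels ?T\<close> by blast
        show ?thesis
        proof (cases "j \<le> i")
          case True
          then have "g i \<le> g j" using g[of j i] c(1) by (cases "i = j") auto
          then show ?thesis using w i by simp
        next
          case False
          then have "f j \<le> f (Suc i)" using f_le[of "Suc i" j] i by simp
          then show ?thesis using hs(2)[OF i(1)] i by simp
        qed
      qed
      then show "p \<in> Q" using inv eq unfolding c(4) Q_iff by auto
    qed
    moreover have "inj_on ?h (skew_cells l m)"
    proof (rule inj_onI)
      fix p q assume pq: "p \<in> skew_cells l m" "q \<in> skew_cells l m" "?h p = ?h q"
      obtain j c j' c' where e: "p = (j, c)" "q = (j', c')" by fastforce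
      have "j = j'" using pq level_inj[of j j' l] by (auto simp: e skew_cells_def f_def)
      then show "p = q" using pq(3) by (simp add: e)
    qed
    ultimately have "card Q = card (skew_cells l m)" by (simp add: card_image)
    moreover have "move_sign ?S y w = 1" if "(y, w) \<in> Q" for y w
    proof -
      have inv: "y \<in> levels ?S" "w < y" and none: "\<not> (w < k \<and> k \<le> y)" if "k \<in> levels ?T" for k
        using eq[OF that] \<open>(y, w) \<in> Q\<close> that unfolding Q_iff inversions_def by (auto split: if_splits)
      have yw: "y \<in> levels ?S" "w < y" using that unfolding Q_iff inversions_def by auto
      obtain j where j: "1 \<le> j" "y = f j" using f_ex[OF yw(1)] by auto
      have "{i \<in> levels ?S. w < i \<and> i < y} = {}"
      proof (rule ccontr)
        assume "{i \<in> levels ?S. w < i \<and> i < y} \<noteq> {}"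
        then obtain i where i: "1 \<le> i" "w < f i" "f i < y" using f_ex by blast
        then have "Suc j \<le> i" using f_le[of i j] j by (cases "i \<le> j") auto
        then have "f i \<le> f (Suc j)" using f_le[of "Suc j" i] i by simp
        moreover have "g j \<le> w" using none[OF g_mem[OF j(1)]] hs(1)[OF j(1)] j by auto
        ultimately show False using hs(2)[OF j(1)] i by simp
      qed
      then show ?thesis by (simp only: move_sign_def card.empty power_0)
    qed
    then have "(\<Sum>(y, w)\<in>Q. move_sign ?S y w) = (\<Sum>p\<in>Q. 1)"
      by (intro sum.cong) auto
    moreover have "card (skew_cells l m) + psize m = psize l"
      using True by (intro card_skew_cells) (simp add: hstrip_def)
    then have "of_nat (psize l) = of_nat (card (skew_cells l m)) + (of_nat (psize m) :: complex)"
      by (metis of_nat_add)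
    ultimately show ?thesis using True unfolding Q_def[symmetric] by simp
  next
    case False
    have "(\<Sum>(y, w)\<in>Q. move_sign ?S y w) = 0"
    proof (cases "Q = {}")
      case False
      then obtain y0 w0 where yw0: "(y0, w0) \<in> Q" by auto
      \<comment> \<open>The thresholds whose count is too large by one. They depend only on
        \<open>l\<close> and \<open>m\<close>, and every admissible move has to pass all of them and
        no others.\<close>
      define K where "K = {k \<in> levels ?T. count_ge ?S k = count_ge ?T k + 1}"
      have K: "K = {k \<in> levels ?T. w < k \<and> k \<le> y}" if "(y, w) \<in> Q" for y w
        using that unfolding K_def Q_iff by (auto split: if_splits)
      have nK: "count_ge ?S k = count_ge ?T k" if "k \<in> levels ?T" "k \<notin> K" for k
        using yw0 that unfolding K[OF yw0] Q_iff by auto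
      have "finite K" unfolding K[OF yw0] by (rule finite_subset[of _ "{w0..y0}"]) auto
      moreover have "K \<noteq> {}"
        using nK \<open>\<not> hstrip l m\<close> interlace_row_state[of l m] by (auto simp: interlace_def)
      ultimately have Max: "Max K \<in> K" "\<And>k. k \<in> K \<Longrightarrow> k \<le> Max K" by simp_all
      obtain a where a: "1 \<le> a" "Max K = g a" using Max(1) g_ex unfolding K_def by blast
      have gaK: "g a \<in> K" using Max(1) a(2) by simp
      then have "count_ge ?S (g a) = Suc a" using count_ge_T[OF a(1)] by (simp add: K_def)
      then have ge: "g a \<le> f i \<longleftrightarrow> i \<le> Suc a" if "1 \<le> i" for i
        using le_count_ge[OF that, of "g a"] by simp
      have above: "f i < k \<longleftrightarrow> a \<le> i" if "k \<in> levels ?T" "g a < k" "k = g (a - 1)" "1 < a" "1 \<le> i" for i k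
      proof -
        have "k \<notin> K" using Max(2)[of k] that a(2) by auto
        then have "count_ge ?S k = a - 1" using nK[of k] that count_ge_T[of "a - 1"] by simp
        then show ?thesis using le_count_ge[of i k] that by auto
      qed
      have above': "f i < k" if k: "k \<in> levels ?T" "g a < k" and i: "a \<le> i" for i k
      proof -
        obtain b where b: "1 \<le> b" "k = g b" using g_ex k(1) by blast
        have "b < a" using g[of a b] b a k(2) by (cases a b rule: linorder_cases) auto
        then have "b = a - 1 \<or> b < a - 1" by linarith
        then have "g (a - 1) \<le> k" using g[of b "a - 1"] b by auto
        moreover have "f i < g (a - 1)"
          using above[of "g (a - 1)" i] g_mem[of "a - 1"] g[of "a - 1" a] \<open>b < a\<close> b(1) i by simp
        ultimately show ?thesis by simp
      qed
      \<comment> \<open>Rows \<open>a\<close> and \<open>a + 1\<close> of \<open>l\<close> both have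
        their levels at or above \<open>g a\<close> and below every higher threshold; one of the two
        is the particle that moves.\<close>
      define p q where "p = f (Suc a)" and "q = f a"
      have pq: "p < q" using f[of a "Suc a"] a by (simp add: p_def q_def)
      have mem: "y = p \<or> y = q" and w_lt: "w < g a" if yQ: "(y, w) \<in> Q" for y w
      proof -
        have gK: "w < g a" "g a \<le> y" using gaK unfolding K[OF yQ] by auto
        show "w < g a" by (rule gK)
        obtain i where i: "1 \<le> i" "y = f i" using f_ex[of y] yQ unfolding Q_iff inversions_def by auto
        have "i \<le> Suc a" using ge[OF i(1)] gK i by simp
        moreover have "a \<le> i"
        proof (cases "1 < a")
          case True
          have m: "g (a - 1) \<in> levels ?T" "g a < g (a - 1)"
            using True g_mem[of "a - 1"] g[of "a - 1" a] by auto
          have "g (a - 1) \<notin> K" using Max(2)[of "g (a - 1)"] m(2) a(2) by auto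
          then have "y < g (a - 1)" using gK m unfolding K[OF yQ] by auto
          then show ?thesis using above[OF m refl True i(1)] i by simp
        qed (use i in simp)
        ultimately show "y = p \<or> y = q" using i by (auto simp: p_def q_def le_Suc_eq)
      qed
      have swap: "(y', w) \<in> Q" if "(y, w) \<in> Q" "y' = p \<or> y' = q" for y y' w
      proof -
        have y'_cond: "y' \<in> levels ?S" "g a \<le> y'" "\<And>k. k \<in> levels ?T \<Longrightarrow> g a < k \<Longrightarrow> y' < k" if "y' = p \<or> y' = q" for y'
          using that f_mem[of a] f_mem[of "Suc a"] ge[of a] ge[of "Suc a"] above'[of _ a] above'[of _ "Suc a"] a(1)
          by (auto simp: p_def q_def)
        note c = y'_cond[OF that(2)] y'_cond[OF mem[OF that(1)]]
        have "(w < k \<and> k \<le> y') = (w < k \<and> k \<le> y)" if "k \<in> levels ?T" for k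
          using c(2,5) c(3)[OF that] c(6)[OF that] by (cases "g a < k") auto
        moreover have "w < y'" using w_lt[OF that(1)] c(2) by simp
        ultimately show ?thesis using that(1) c(1) unfolding Q_iff inversions_def by auto
      qed
      \<comment> \<open>Starting from \<open>q\<close> the move jumps over \<open>p\<close> in
        addition.\<close>
      have sgn: "move_sign ?S p w = - move_sign ?S q w" if "(y, w) \<in> Q" for y w
      proof -
        have "{j \<in> levels ?S. w < j \<and> j < q} = insert p {j \<in> levels ?S. w < j \<and> j < p}"
        proof (intro equalityI subsetI)
          fix j assume j: "j \<in> {j \<in> levels ?S. w < j \<and> j < q}"
          then obtain i where i: "1 \<le> i" "j = f i" using f_ex by blast
          then have "Suc a \<le> i" using j f_le[of i a] a by (cases "i \<le> a") (auto simp: q_def)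
          then have "j \<le> p" using i f_le[of "Suc a" i] by (simp add: p_def)
          then show "j \<in> insert p {j \<in> levels ?S. w < j \<and> j < p}" using j by auto
        next
          fix j assume "j \<in> insert p {j \<in> levels ?S. w < j \<and> j < p}"
          moreover have "w < p" using swap[OF that, of p] unfolding Q_iff inversions_def by auto
          ultimately show "j \<in> {j \<in> levels ?S. w < j \<and> j < q}"
            using pq f_mem[of "Suc a"] by (auto simp: p_def)
        qed
        moreover have "finite {j \<in> levels ?S. w < j \<and> j < p}"
          by (rule finite_subset[of _ "{w..p}"]) auto
        ultimately show ?thesis by (simp add: move_sign_def)
      qed
      have "(\<Sum>(y, w)\<in>Q. move_sign ?S y w) = (\<Sum>(y, w)\<in>Q. - move_sign ?S y w)"
      proof (rule sum.reindex_bij_witness[of _ "\<lambda>(y, w). (p + q - y, w)" "\<lambda>(y, w). (p + q - y, w)"])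
        fix x assume x: "x \<in> Q"
        obtain y w where yw: "x = (y, w)" by fastforce
        have m: "y = p \<or> y = q" using mem x yw by blast
        show "(case x of (y, w) \<Rightarrow> (p + q - y, w)) \<in> Q" "(case x of (y, w) \<Rightarrow> (p + q - y, w)) \<in> Q"
          using swap[of y w "p + q - y"] x m by (auto simp: yw)
        show "(case (case x of (y, w) \<Rightarrow> (p + q - y, w)) of (y, w) \<Rightarrow> - move_sign ?S y w)
            = (case x of (y, w) \<Rightarrow> move_sign ?S y w)"
          using sgn[of y w] x m by (auto simp: yw)
      qed auto
      then show ?thesis by (simp add: split_def sum_negf)
    qed simp
    then show ?thesis using False unfolding Q_def by simp
  qed
qed

text \<open>The power of \<open>x\<close> from the mode and the one left in \<open>H\<close> always
  make up \<open>x ^ (psize l - psize m)\<close>, so the recursion for \<open>H\<close> reduces to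
  the signed count of moves in \<open>sum_interlace\<close>. The minus sign of the modes cancels
  that of \<open>a_op\<close>.\<close>

theorem vexp_one_variable:
  "vexp (\<lambda>k. - (x ^ k)) (delta (row_state m)) (row_state l) =
    (if hstrip l m then x ^ (psize l - psize m) else 0)"
proof -
  define H where "H S = (if interlace S (row_state m) then x ^ (energy S - psize m) else 0)" for S
  have "vexp (\<lambda>k. - (x ^ k)) (delta (row_state m)) t = H t" if "t \<in> range row_state" for t
  proof (rule vexp_unique[OF _ _ that])
    fix t assume "t \<in> range row_state"
    then obtain l where t: "t = row_state l" by auto
    let ?Q = "{(y, w) \<in> inversions t. interlace (move y w t) (row_state m)}"
    have "rsum (\<lambda>k. - (x ^ k)) H t = (\<Sum>(y, w)\<in>inversions t. x ^ nat (y - w) * (move_sign t y w * H (move y w t)))"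
      unfolding rsum_inversions sum_negf[symmetric]
      by (rule sum.cong) (auto simp: hop_sign)
    also have "\<dots> = (\<Sum>(y, w)\<in>?Q. x ^ nat (y - w) * (move_sign t y w * H (move y w t)))"
      by (rule sum.mono_neutral_right) (auto simp: finite_inversions H_def split: if_splits)
    also have "\<dots> = (\<Sum>(y, w)\<in>?Q. x ^ (psize l - psize m) * move_sign t y w)"
    proof (rule sum.cong[OF refl])
      fix p assume p: "p \<in> ?Q"
      obtain y w where yw: "p = (y, w)" by fastforce
      have inv: "y \<in> levels t" "w \<notin> levels t" "w < y" and il: "interlace (move y w t) (row_state m)"
        using p by (auto simp: yw inversions_def)
      obtain l' where l': "move y w t = row_state l'"
        using row_state_move[OF _ inv] t by auto
      have "psize m \<le> psize l'"
        using il contained_psize by (simp add: l' interlace_row_state hstrip_def)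
      moreover have "psize l = psize l' + nat (y - w)"
        using energy_move[OF inv] unfolding l' unfolding t energy_row_state .
      ultimately have "x ^ nat (y - w) * x ^ (energy (move y w t) - psize m) = x ^ (psize l - psize m)"
        by (simp add: l' energy_row_state add.commute flip: power_add)
      then show "(case p of (y, w) \<Rightarrow> x ^ nat (y - w) * (move_sign t y w * H (move y w t)))
          = (case p of (y, w) \<Rightarrow> x ^ (psize l - psize m) * move_sign t y w)"
        using il by (simp add: yw H_def ac_simps)
    qed
    also have "\<dots> = x ^ (psize l - psize m) * (\<Sum>(y, w)\<in>?Q. move_sign t y w)"
      by (simp add: sum_distrib_left split_def)
    also have "\<dots> = (of_nat (energy t) - of_nat (energy (row_state m))) * H t"
      unfolding t sum_interlace by (simp add: H_def interlace_row_state energy_row_state)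
    finally show "(of_nat (energy t) - of_nat (energy (row_state m))) * H t = rsum (\<lambda>k. - (x ^ k)) H t" ..
  next
    fix t assume "t \<in> range row_state" "energy t \<le> energy (row_state m)"
    then obtain l where t: "t = row_state l" "psize l \<le> psize m" by (auto simp: energy_row_state)
    have "hstrip m m" using part_mono[of _ "Suc _" m] by (auto simp: hstrip_def contained_def)
    moreover have "hstrip l m \<Longrightarrow> l = m" using contained_psize_eq[of m l] t by (simp add: hstrip_def)
    ultimately show "H t = delta (row_state m) t"
      by (auto simp: H_def t interlace_row_state energy_row_state delta_def row_state_inject)
  qed
  then show ?thesis by (simp add: H_def interlace_row_state energy_row_state)
qed

section \<open>Tableaux with bounded entries\<close>

definition ssyt_le :: "nat \<Rightarrow> partition \<Rightarrow> partition \<Rightarrow> (nat \<times> nat \<Rightarrow> nat) set" where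
  "ssyt_le N l e = {T \<in> ssyt l e. \<forall>c\<in>skew_cells l e. T c \<le> N}"

text \<open>Entries bounded by \<open>N\<close> leave finitely many tableaux, so no summability
  enters before \<open>schur_le_tendsto\<close>.\<close>

definition schur_le :: "nat \<Rightarrow> partition \<Rightarrow> partition \<Rightarrow> (nat \<Rightarrow> complex) \<Rightarrow> complex" where
  "schur_le N l e x =
     (if contained e l then (\<Sum>T\<in>ssyt_le N l e. \<Prod>c\<in>skew_cells l e. x (T c)) else 0)"

lemma ssyt_leD:
  assumes "T \<in> ssyt_le N l e"
  shows "T \<in> skew_cells l e \<rightarrow>\<^sub>E {1..}" "\<And>c. c \<in> skew_cells l e \<Longrightarrow> T c \<le> N"
    "\<And>i j j'. (i, j) \<in> skew_cells l e \<Longrightarrow> (i, j') \<in> skew_cells l e \<Longrightarrow> j < j' \<Longrightarrow> T (i, j) \<le> T (i, j')"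
    "\<And>i i' j. (i, j) \<in> skew_cells l e \<Longrightarrow> (i', j) \<in> skew_cells l e \<Longrightarrow> i < i' \<Longrightarrow> T (i, j) < T (i', j)"
  using assms unfolding ssyt_le_def ssyt_def by blast+

lemma ssyt_leI:
  assumes "T \<in> skew_cells l e \<rightarrow>\<^sub>E {1..}" "\<And>c. c \<in> skew_cells l e \<Longrightarrow> T c \<le> N"
    "\<And>i j j'. (i, j) \<in> skew_cells l e \<Longrightarrow> (i, j') \<in> skew_cells l e \<Longrightarrow> j < j' \<Longrightarrow> T (i, j) \<le> T (i, j')"
    "\<And>i i' j. (i, j) \<in> skew_cells l e \<Longrightarrow> (i', j) \<in> skew_cells l e \<Longrightarrow> i < i' \<Longrightarrow> T (i, j) < T (i', j)"
  shows "T \<in> ssyt_le N l e"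
  using assms unfolding ssyt_le_def ssyt_def by blast

lemma finite_ssyt_le: "finite (ssyt_le N l e)"
proof (rule finite_subset)
  show "ssyt_le N l e \<subseteq> skew_cells l e \<rightarrow>\<^sub>E {1..N}"
    unfolding ssyt_le_def ssyt_def by (auto simp: PiE_def Pi_def)
qed (simp add: finite_PiE finite_cells)

lemma skew_cells_inj:
  assumes "contained e m" "contained e m'" "skew_cells m e = skew_cells m' e"
  shows "m = m'"
proof (rule part_eqI)
  fix i j :: nat assume ij: "1 \<le> i" "1 \<le> j"
  have "(i, j) \<in> skew_cells m e \<longleftrightarrow> (i, j) \<in> skew_cells m' e" using assms(3) by simp
  moreover have "part e i \<le> part m i" "part e i \<le> part m' i" using assms(1,2) by (auto simp: contained_def)
  ultimately show "j \<le> part m i \<longleftrightarrow> j \<le> part m' i" using ij by (auto simp: skew_cells_def)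
qed

lemma finite_contained: "finite {m. contained m l}"
proof (rule finite_imageD)
  have "cells ` {m. contained m l} \<subseteq> Pow (cells l)"
    by (auto simp: cells_iff contained_def) (meson le_trans)
  then show "finite (cells ` {m. contained m l})"
    by (rule finite_subset) (simp add: finite_cells)
  show "inj_on cells {m. contained m l}"
    by (rule inj_onI, rule skew_cells_inj[of empty_part]) (auto simp: contained_def)
qed

lemma initial_interval:
  fixes A :: "nat set"
  assumes "finite A" "\<And>j. j \<in> A \<Longrightarrow> b < j" "\<And>i j. j \<in> A \<Longrightarrow> b < i \<Longrightarrow> i \<le> j \<Longrightarrow> i \<in> A"
  shows "A = {b<..b + card A}"
proof (cases "A = {}")
  case False
  have "A = {b<..Max A}"
  proof (intro equalityI subsetI)
    show "j \<in> {b<..Max A}" if "j \<in> A" for j using assms(2)[OF that] Max_ge[OF assms(1) that] by simp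
    show "j \<in> A" if "j \<in> {b<..Max A}" for j
      using assms(3)[OF Max_in[OF assms(1) False], of j] that by simp
  qed
  moreover from this have "card A = Max A - b" using card_greaterThanAtMost[of b "Max A"] by (simp only:)
  moreover have "b < Max A" using assms(2) Max_in[OF assms(1) False] by blast
  ultimately show ?thesis by simp
qed simp

text \<open>The entries up to \<open>N\<close> form an initial part of each row, since rows increase
  weakly, and these parts shrink downwards, since columns increase strictly. No column contains
  \<open>Suc N\<close> twice, so the remaining cells form a horizontal strip.\<close>

lemma inner_shape:
  assumes c: "contained e l" and T: "T \<in> ssyt_le (Suc N) l e"
  shows "\<exists>m. contained e m \<and> hstrip l m \<and> skew_cells m e = {c \<in> skew_cells l e. T c \<le> N}"
proof -
  note T' = ssyt_leD[OF T]
  define A where "A i = {j. part e i < j \<and> j \<le> part l i \<and> T (i, j) \<le> N}" for i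
  define p where "p i = (if i = 0 then 0 else part e i + card (A i))" for i
  have le: "part e i \<le> part l i" for i using c by (simp add: contained_def)
  have cell: "(i, j) \<in> skew_cells l e \<longleftrightarrow> 1 \<le> i \<and> part e i < j \<and> j \<le> part l i" for i j
    by (simp add: skew_cells_def)
  have A: "A i = {part e i<..p i}" if "1 \<le> i" for i
  proof -
    have "A i = {part e i<..part e i + card (A i)}"
    proof (rule initial_interval)
      show "finite (A i)" by (rule finite_subset[of _ "{..part l i}"]) (auto simp: A_def)
      fix k j assume kj: "j \<in> A i" "part e i < k" "k \<le> j"
      then have "T (i, k) \<le> T (i, j)"
        using T'(3)[of i k j] that by (cases "k = j") (auto simp: cell A_def)
      then show "k \<in> A i" using kj by (auto simp: A_def)
    qed (simp add: A_def)
    then show ?thesis using that by (simp add: p_def)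
  qed
  have ep: "part e i \<le> p i" for i by (simp add: p_def)
  have pl: "p i \<le> part l i" for i
  proof (cases "1 \<le> i \<and> part e i < p i")
    case True
    then have "p i \<in> A i" using A[of i] by simp
    then show ?thesis by (simp add: A_def)
  next
    case False
    then show ?thesis using ep[of i] le[of i] by (cases "i = 0") (auto simp: p_def)
  qed
  have mono: "p k \<le> p i" if ik: "1 \<le> i" "i \<le> k" for i k
  proof (cases "p k \<le> part e i \<or> i = k")
    case True
    then show ?thesis using ep[of i] by auto
  next
    case False
    then have "i < k" "part e i < p k" using ik by auto
    moreover have "part e k \<le> part e i" by (rule part_mono[OF ik])
    ultimately have pk: "p k \<in> A k" using A[of k] ik by simp
    then have "p k \<le> part l i" using part_mono[OF ik, of l] by (simp add: A_def)
    then have "(i, p k) \<in> skew_cells l e" "(k, p k) \<in> skew_cells l e"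
      using pk ik \<open>part e i < p k\<close> by (auto simp: cell A_def)
    then have "T (i, p k) < T (k, p k)" using T'(4) \<open>i < k\<close> by blast
    then have "p k \<in> A i" using pk \<open>p k \<le> part l i\<close> \<open>part e i < p k\<close> by (auto simp: A_def)
    then show ?thesis using A[OF ik(1)] by simp
  qed
  have "finite {i. p i \<noteq> 0}"
  proof (rule finite_subset)
    show "{i. p i \<noteq> 0} \<subseteq> {i. part l i \<noteq> 0}" using pl by (metis (mono_tags, lifting) Collect_mono bot_nat_0.extremum_unique)
    show "finite {i. part l i \<noteq> 0}" using part[of l] by blast
  qed
  with mono have "part (Abs_partition p) = p"
    by (subst Abs_partition_inverse) (auto simp: p_def)
  moreover have "part l (Suc i) \<le> p i" if "1 \<le> i" for i
  proof (rule ccontr)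
    assume "\<not> part l (Suc i) \<le> p i"
    then have j: "p i < part l (Suc i)" by simp
    moreover have "part l (Suc i) \<le> part l i" "part e (Suc i) \<le> part e i" using part_mono[of i "Suc i"] that by auto
    ultimately have c: "(i, part l (Suc i)) \<in> skew_cells l e" "(Suc i, part l (Suc i)) \<in> skew_cells l e"
      using ep[of i] that by (auto simp: cell)
    have "part l (Suc i) \<notin> A i" using A[OF that] j by simp
    then have "N < T (i, part l (Suc i))" using c by (auto simp: A_def cell)
    moreover have "T (i, part l (Suc i)) < T (Suc i, part l (Suc i))" using T'(4)[OF c] by simp
    ultimately show False using T'(2)[OF c(2)] by simp
  qed
  moreover have "(i, j) \<in> skew_cells l e \<and> T (i, j) \<le> N \<longleftrightarrow> 1 \<le> i \<and> part e i < j \<and> j \<le> p i" for i j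
  proof (cases "1 \<le> i")
    case True
    have "j \<in> A i \<longleftrightarrow> j \<in> {part e i<..p i}" unfolding A[OF True] ..
    then show ?thesis using True by (simp add: cell A_def)
  qed (simp add: cell)
  ultimately show ?thesis
    using ep pl by (intro exI[of _ "Abs_partition p"])
      (auto simp: contained_def hstrip_def, auto simp: skew_cells_def)
qed

text \<open>The converse of \<open>inner_shape\<close>: a horizontal strip has at most one cell in
  each column, so it can be filled with \<open>Suc N\<close>. The value \<open>undefined\<close>
  elsewhere keeps the filling extensional.\<close>

lemma extend_tableau:
  assumes em: "contained e m" and lm: "hstrip l m" and T: "T \<in> ssyt_le N m e"
  defines "T' \<equiv> (\<lambda>c. if c \<in> skew_cells m e then T c else if c \<in> skew_cells l e then Suc N else undefined)"
  shows "T' \<in> ssyt_le (Suc N) l e" "{c \<in> skew_cells l e. T' c \<le> N} = skew_cells m e"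
    "restrict T' (skew_cells m e) = T"
proof -
  note D = ssyt_leD[OF T]
  have sub: "skew_cells m e \<subseteq> skew_cells l e"
    using lm by (auto simp: hstrip_def contained_def skew_cells_def intro: le_trans)
  have out: "part m i < j" if "(i, j) \<in> skew_cells l e" "(i, j) \<notin> skew_cells m e" for i j
    using that by (auto simp: skew_cells_def)
  have out': "part l i' \<le> part m i" if "1 \<le> i" "i < i'" for i i'
    using lm that part_mono[of "Suc i" i' l] by (auto simp: hstrip_def intro: le_trans)
  show "T' \<in> ssyt_le (Suc N) l e"
  proof (rule ssyt_leI)
    show "T' \<in> skew_cells l e \<rightarrow>\<^sub>E {1..}"
      using D(1) sub by (auto simp: T'_def PiE_def Pi_def extensional_def)
    show "T' c \<le> Suc N" if "c \<in> skew_cells l e" for c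
      using D(2)[of c] that by (auto simp: T'_def)
    show "T' (i, j) \<le> T' (i, j')" if "(i, j) \<in> skew_cells l e" "(i, j') \<in> skew_cells l e" "j < j'" for i j j'
    proof (cases "(i, j') \<in> skew_cells m e")
      case True
      then have "(i, j) \<in> skew_cells m e" using that by (auto simp: skew_cells_def)
      then show ?thesis using D(3) True that by (simp add: T'_def)
    next
      case False
      then show ?thesis using D(2) that by (auto simp: T'_def intro: le_SucI)
    qed
    show "T' (i, j) < T' (i', j)" if c: "(i, j) \<in> skew_cells l e" "(i', j) \<in> skew_cells l e" "i < i'" for i i' j
    proof -
      have "(i, j) \<in> skew_cells m e"
        using out[OF c(1)] out'[of i i'] c by (force simp: skew_cells_def)
      then show ?thesis using D(2,4) c by (auto simp: T'_def less_Suc_eq_le)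
    qed
  qed
  show "{c \<in> skew_cells l e. T' c \<le> N} = skew_cells m e"
    using sub D(2) by (auto simp: T'_def)
  show "restrict T' (skew_cells m e) = T"
    using D(1) by (auto simp: T'_def fun_eq_iff PiE_def extensional_def)
qed

text \<open>The branching rule: cutting off the entries \<open>Suc N\<close> is a bijection onto the
  pairs of an inner shape and a tableau of that shape with bound \<open>N\<close>.\<close>

lemma schur_le_Suc:
  "schur_le (Suc N) l e x =
    (\<Sum>m | hstrip l m. x (Suc N) ^ (psize l - psize m) * schur_le N m e x)"
proof (cases "contained e l")
  case False
  have "\<not> contained e m" if "hstrip l m" for m
    using that False unfolding hstrip_def contained_def by (meson le_trans)
  then show ?thesis using False by (simp add: schur_le_def)
next
  case True
  define M where "M = {m. hstrip l m \<and> contained e m}"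
  have finM: "finite {m. hstrip l m}" "finite M"
    by (rule finite_subset[OF _ finite_contained[of l]], auto simp: hstrip_def M_def)+
  \<comment> \<open>The shape of the entries up to \<open>N\<close>; by
    \<open>skew_cells_inj\<close> there is only one such shape containing \<open>e\<close>.\<close>
  define sh where "sh T = (SOME m. contained e m \<and> hstrip l m \<and>
      skew_cells m e = {c \<in> skew_cells l e. T c \<le> N})" for T
  have sh: "contained e (sh T)" "hstrip l (sh T)" "skew_cells (sh T) e = {c \<in> skew_cells l e. T c \<le> N}"
    if "T \<in> ssyt_le (Suc N) l e" for T
    using someI_ex[OF inner_shape[OF True that]] by (simp_all add: sh_def)
  let ?ext = "\<lambda>(m, T) c. if c \<in> skew_cells m e then T c else if c \<in> skew_cells l e then Suc N else undefined"
  have "(\<Sum>m | hstrip l m. x (Suc N) ^ (psize l - psize m) * schur_le N m e x) =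
      (\<Sum>m\<in>M. \<Sum>T\<in>ssyt_le N m e. x (Suc N) ^ (psize l - psize m) * (\<Prod>c\<in>skew_cells m e. x (T c)))"
    by (rule sum.mono_neutral_cong_right[OF finM(1)])
      (auto simp: M_def schur_le_def sum_distrib_left)
  also have "\<dots> = (\<Sum>(m, T)\<in>Sigma M (\<lambda>m. ssyt_le N m e).
      x (Suc N) ^ (psize l - psize m) * (\<Prod>c\<in>skew_cells m e. x (T c)))"
    by (rule sum.Sigma) (auto simp: finM finite_ssyt_le)
  also have "\<dots> = (\<Sum>T\<in>ssyt_le (Suc N) l e. \<Prod>c\<in>skew_cells l e. x (T c))"
  proof (rule sum.reindex_bij_witness[of _ "\<lambda>T. (sh T, restrict T (skew_cells (sh T) e))" ?ext])
    fix p assume p: "p \<in> Sigma M (\<lambda>m. ssyt_le N m e)"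
    obtain m T where mT: "p = (m, T)" by fastforce
    have m: "contained e m" "hstrip l m" and T: "T \<in> ssyt_le N m e" using p by (auto simp: mT M_def)
    note ext = extend_tableau[OF m T]
    show "?ext p \<in> ssyt_le (Suc N) l e" using ext(1) by (simp add: mT)
    have "sh (?ext p) = m"
      by (rule skew_cells_inj[OF sh(1) m(1)]) (use ext sh(3)[OF ext(1)] in \<open>simp_all add: mT\<close>)
    then show "(sh (?ext p), restrict (?ext p) (skew_cells (sh (?ext p)) e)) = p"
      using ext(3) by (simp add: mT)
    have sub: "skew_cells m e \<subseteq> skew_cells l e" using ext(2) by blast
    have "(\<Prod>c\<in>skew_cells l e. x (?ext p c)) =
        (\<Prod>c\<in>skew_cells l e - skew_cells m e. x (?ext p c)) * (\<Prod>c\<in>skew_cells m e. x (?ext p c))"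
      by (rule prod.subset_diff[OF sub finite_cells])
    also have "(\<Prod>c\<in>skew_cells m e. x (?ext p c)) = (\<Prod>c\<in>skew_cells m e. x (T c))"
      by (rule prod.cong) (auto simp: mT)
    also have "(\<Prod>c\<in>skew_cells l e - skew_cells m e. x (?ext p c)) = (\<Prod>c\<in>skew_cells l e - skew_cells m e. x (Suc N))"
      by (rule prod.cong) (auto simp: mT)
    also have "\<dots> = x (Suc N) ^ (psize l - psize m)"
    proof -
      have "psize l - psize m = card (skew_cells l e) - card (skew_cells m e)"
        using card_skew_cells[OF True] card_skew_cells[OF m(1)] by linarith
      then show ?thesis using card_Diff_subset[OF finite_cells sub] by (simp add: prod_constant)
    qed
    finally show "(\<Prod>c\<in>skew_cells l e. x (?ext p c)) =
        (case p of (m, T) \<Rightarrow> x (Suc N) ^ (psize l - psize m) * (\<Prod>c\<in>skew_cells m e. x (T c)))"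
      by (simp add: mT)
  next
    fix T assume T: "T \<in> ssyt_le (Suc N) l e"
    note D = ssyt_leD[OF T] and s = sh[OF T]
    have in_s: "c \<in> skew_cells (sh T) e \<longleftrightarrow> c \<in> skew_cells l e \<and> T c \<le> N" for c using s(3) by blast
    show "(sh T, restrict T (skew_cells (sh T) e)) \<in> Sigma M (\<lambda>m. ssyt_le N m e)"
    proof -
      have "restrict T (skew_cells (sh T) e) \<in> ssyt_le N (sh T) e"
        by (rule ssyt_leI) (use D in \<open>auto simp: in_s PiE_def Pi_def\<close>)
      then show ?thesis using s by (simp add: M_def)
    qed
    show "?ext (sh T, restrict T (skew_cells (sh T) e)) = T"
    proof
      fix c
      show "?ext (sh T, restrict T (skew_cells (sh T) e)) c = T c"
        using D(2)[of c] PiE_arb[OF D(1), of c] by (auto simp: in_s)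
    qed
  qed
  finally show ?thesis using True by (simp add: schur_le_def)
qed

lemma schur_le_diag: "schur_le N l l x = 1"
proof -
  have "skew_cells l l = {}" by (auto simp: skew_cells_def)
  then have "ssyt_le N l l = {\<lambda>_. undefined}" by (auto simp: ssyt_le_def ssyt_def)
  then show ?thesis by (simp add: schur_le_def \<open>skew_cells l l = {}\<close> contained_def)
qed

lemma schur_le_0: "schur_le 0 l e x = (if l = e then 1 else 0)"
proof (cases "l = e \<or> \<not> contained e l")
  case True
  then show ?thesis using schur_le_diag[of 0 l] by (auto simp: schur_le_def contained_def)
next
  case False
  then obtain c where c: "c \<in> skew_cells l e" using skew_cells_empty_iff[of e l] by blast
  have "ssyt_le 0 l e = {}"
  proof (rule ccontr)
    assume "ssyt_le 0 l e \<noteq> {}"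
    then obtain T where T: "T \<in> ssyt_le 0 l e" by blast
    have "T c \<in> {1..}" by (rule PiE_mem[OF ssyt_leD(1)[OF T] c])
    then show False using ssyt_leD(2)[OF T c] by simp
  qed
  then show ?thesis using False by (simp add: schur_le_def)
qed

section \<open>Skew Schur functions as matrix elements\<close>

lemma tendsto_sum_exhaust:
  fixes f :: "'a \<Rightarrow> complex"
  assumes "f summable_on A" "\<And>N::nat. finite (F N)" "\<And>N. F N \<subseteq> A"
    and "\<And>a. a \<in> A \<Longrightarrow> \<exists>N0. \<forall>N\<ge>N0. a \<in> F N"
  shows "(\<lambda>N. sum f (F N)) \<longlonglongrightarrow> infsum f A"
proof -
  have "(sum f \<longlongrightarrow> infsum f A) (finite_subsets_at_top A)"
    using has_sum_infsum[OF assms(1)] by (simp add: has_sum_def)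
  moreover have "filterlim F (finite_subsets_at_top A) sequentially"
    unfolding filterlim_finite_subsets_at_top
  proof (intro allI impI)
    fix X assume X: "finite X \<and> X \<subseteq> A"
    have "eventually (\<lambda>N. \<forall>a\<in>X. a \<in> F N) sequentially"
      by (rule eventually_ball_finite) (use X assms(4) in \<open>auto simp: eventually_sequentially\<close>)
    then show "eventually (\<lambda>N. finite (F N) \<and> X \<subseteq> F N \<and> F N \<subseteq> A) sequentially"
      by eventually_elim (use assms(2,3) in auto)
  qed
  ultimately show ?thesis by (rule filterlim_compose)
qed

lemma ssyt_ex_bound: "finite X \<Longrightarrow> X \<subseteq> ssyt l e \<Longrightarrow> \<exists>N0. \<forall>N\<ge>N0. X \<subseteq> ssyt_le N l e"
proof -
  assume X: "finite X" "X \<subseteq> ssyt l e"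
  let ?V = "(\<lambda>(T, c). T c) ` (X \<times> skew_cells l e)"
  have fin: "finite ?V" using X finite_cells by simp
  have "X \<subseteq> ssyt_le N l e" if "Max (insert 0 ?V) \<le> N" for N
  proof
    fix T assume T: "T \<in> X"
    have "T c \<le> N" if "c \<in> skew_cells l e" for c
    proof -
      have "T c \<in> ?V" using T that by force
      then have "T c \<le> Max (insert 0 ?V)" using fin by (intro Max_ge) auto
      then show ?thesis using \<open>Max (insert 0 ?V) \<le> N\<close> by simp
    qed
    then show "T \<in> ssyt_le N l e" using T X by (auto simp: ssyt_le_def)
  qed
  then show ?thesis by blast
qed

text \<open>Dropping the tableau conditions adds only nonnegative norms, and the sum over all
  fillings factors over the cells. This bounds every finite partial sum by a power of the total of
  the norms.\<close>

lemma ssyt_summable: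
  fixes x :: "nat \<Rightarrow> complex"
  assumes "(\<lambda>i. norm (x i)) summable_on {1..}"
  shows "(\<lambda>T. \<Prod>c\<in>skew_cells l e. x (T c)) summable_on ssyt l e"
proof (rule abs_summable_summable, rule nonneg_bdd_above_summable_on)
  let ?C = "\<Sum>\<^sub>\<infinity>i\<in>{1..}. norm (x i)"
  show "bdd_above (sum (\<lambda>T. norm (\<Prod>c\<in>skew_cells l e. x (T c))) ` {F. F \<subseteq> ssyt l e \<and> finite F})"
  proof (rule bdd_aboveI2)
    fix X assume X: "X \<in> {F. F \<subseteq> ssyt l e \<and> finite F}"
    then obtain N where N: "X \<subseteq> ssyt_le N l e" using ssyt_ex_bound[of X l e] by blast
    have "(\<Sum>T\<in>X. norm (\<Prod>c\<in>skew_cells l e. x (T c))) \<le>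
        (\<Sum>T\<in>skew_cells l e \<rightarrow>\<^sub>E {1..N}. norm (\<Prod>c\<in>skew_cells l e. x (T c)))"
    proof (rule sum_mono2)
      show "finite (skew_cells l e \<rightarrow>\<^sub>E {1..N})" by (simp add: finite_PiE finite_cells)
      show "X \<subseteq> skew_cells l e \<rightarrow>\<^sub>E {1..N}"
        using N unfolding ssyt_le_def ssyt_def by (auto simp: PiE_def Pi_def)
    qed simp
    also have "\<dots> = (\<Prod>c\<in>skew_cells l e. \<Sum>i\<in>{1..N}. norm (x i))"
      by (subst prod_sum_PiE) (simp_all add: finite_cells prod_norm)
    also have "\<dots> \<le> (\<Prod>c\<in>skew_cells l e. ?C)"
      by (intro prod_mono conjI sum_nonneg finite_sum_le_infsum assms) auto
    finally show "(\<Sum>T\<in>X. norm (\<Prod>c\<in>skew_cells l e. x (T c))) \<le> (\<Prod>c\<in>skew_cells l e. ?C)" .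
  qed
qed simp

lemma schur_le_tendsto:
  assumes "(\<lambda>i. norm (x i)) summable_on {1..}"
  shows "(\<lambda>N. schur_le N l e x) \<longlonglongrightarrow> skew_schur l e x"
proof (cases "contained e l")
  case True
  have "(\<lambda>N. \<Sum>T\<in>ssyt_le N l e. \<Prod>c\<in>skew_cells l e. x (T c)) \<longlonglongrightarrow>
      (\<Sum>\<^sub>\<infinity>T\<in>ssyt l e. \<Prod>c\<in>skew_cells l e. x (T c))"
  proof (rule tendsto_sum_exhaust[OF ssyt_summable[OF assms] finite_ssyt_le])
    show "ssyt_le N l e \<subseteq> ssyt l e" for N by (auto simp: ssyt_le_def)
    show "\<exists>N0. \<forall>N\<ge>N0. T \<in> ssyt_le N l e" if "T \<in> ssyt l e" for T
      using ssyt_ex_bound[of "{T}" l e] that by simp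
  qed
  then show ?thesis using True by (simp add: schur_le_def skew_schur_def)
qed (simp add: schur_le_def skew_schur_def)

section \<open>Power sums and Newton's recursion\<close>

definition psum :: "(nat \<Rightarrow> complex) \<Rightarrow> nat \<Rightarrow> complex" where
  "psum x k = (\<Sum>\<^sub>\<infinity>i\<in>{1..}. x i ^ k)"

lemma abs_summable_power:
  fixes x :: "nat \<Rightarrow> complex"
  assumes "(\<lambda>i. norm (x i)) summable_on {1..}" "1 \<le> k"
  shows "(\<lambda>i. norm (x i ^ k)) summable_on {1..}"
proof (rule summable_on_comparison_test)
  let ?C = "\<Sum>\<^sub>\<infinity>i\<in>{1..}. norm (x i)"
  show "(\<lambda>i. ?C ^ (k - 1) * norm (x i)) summable_on {1..}"
    by (rule summable_on_cmult_right[OF assms(1)])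
  fix i :: nat assume "i \<in> {1..}"
  then have "sum (\<lambda>i. norm (x i)) {i} \<le> ?C"
    by (intro finite_sum_le_infsum assms) auto
  then have "norm (x i) ^ (k - 1) \<le> ?C ^ (k - 1)" by (intro power_mono) auto
  moreover have "norm (x i ^ k) = norm (x i) ^ (k - 1) * norm (x i)"
    using assms(2) by (cases k) (simp_all add: norm_power norm_mult)
  ultimately show "norm (x i ^ k) \<le> ?C ^ (k - 1) * norm (x i)"
    by (simp add: mult_right_mono)
qed simp

lemma psum_tendsto:
  assumes "(\<lambda>i. norm (x i)) summable_on {1..}" "1 \<le> k"
  shows "(\<lambda>N. \<Sum>i=1..N. x i ^ k) \<longlonglongrightarrow> psum x k"
  unfolding psum_def
  by (rule tendsto_sum_exhaust[OF abs_summable_summable[OF abs_summable_power[OF assms]]]) auto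

text \<open>Outside \<open>range row_state\<close> the partition \<open>inv row_state S\<close> is
  arbitrary; the recursions for this vector concern states in that range, which the modes do not
  leave.\<close>

definition schur_state :: "nat \<Rightarrow> partition \<Rightarrow> (nat \<Rightarrow> complex) \<Rightarrow> maya vec" where
  "schur_state N e x S = schur_le N (inv row_state S) e x"

lemma inv_row_state [simp]: "inv row_state (row_state l) = l"
  by (rule inv_f_f) (simp add: inj_def row_state_inject)

text \<open>The matrix elements of the one-variable exponential are exactly the strip weights in
  \<open>schur_le_Suc\<close>.\<close>

lemma schur_state_Suc:
  assumes "t \<in> range row_state"
  shows "vexp (\<lambda>k. - (x (Suc N) ^ k)) (schur_state N e x) t = schur_state (Suc N) e x t"
proof -
  obtain l where t: "t = row_state l" using assms by auto
  let ?V = "vexp (\<lambda>k. - (x (Suc N) ^ k))" and ?G = "schur_state N e x"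
  have fin: "finite {m. hstrip l m}"
    by (rule finite_subset[OF _ finite_contained[of l]]) (auto simp: hstrip_def)
  have "?V ?G t = (\<Sum>s | ?V (delta s) t \<noteq> 0. ?V (delta s) t * ?G s)"
    by (rule lfin_eval[OF lfin_vexp])
  also have "\<dots> = (\<Sum>s\<in>row_state ` {m. hstrip l m}. ?V (delta s) t * ?G s)"
  proof (rule sum.mono_neutral_left)
    show "{s. ?V (delta s) t \<noteq> 0} \<subseteq> row_state ` {m. hstrip l m}"
    proof
      fix s assume s: "s \<in> {s. ?V (delta s) t \<noteq> 0}"
      then obtain m where m: "s = row_state m" using vexp_Z_closed[OF assms] by auto
      then show "s \<in> row_state ` {m. hstrip l m}"
        using s vexp_one_variable[of "x (Suc N)" m l] by (auto simp: t split: if_splits)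
    qed
  qed (use fin in auto)
  also have "\<dots> = (\<Sum>m | hstrip l m. ?V (delta (row_state m)) t * ?G (row_state m))"
    by (rule sum.reindex_cong[of row_state]) (auto simp: inj_on_def row_state_inject)
  also have "\<dots> = (\<Sum>m | hstrip l m. x (Suc N) ^ (psize l - psize m) * schur_le N m e x)"
    by (rule sum.cong) (auto simp: t vexp_one_variable schur_state_def)
  finally show ?thesis by (simp add: t schur_state_def schur_le_Suc)
qed

text \<open>Induction on the number of variables: by \<open>schur_state_Suc\<close> a new variable
  applies a one-variable exponential, and \<open>vexp_deriv\<close> adds its modes to the
  recursion.\<close>

lemma newton_schur_state:
  assumes "t \<in> range row_state"
  shows "(of_nat (energy t) - of_nat (psize e)) * schur_state N e x t =
    rsum (\<lambda>k. - (\<Sum>i=1..N. x i ^ k)) (schur_state N e x) t"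
  using assms
proof (induction N arbitrary: t)
  case 0
  then show ?case
    by (auto simp: rsum_inversions schur_state_def schur_le_0 energy_row_state)
next
  case (Suc N)
  let ?V = "vexp (\<lambda>k. - (x (Suc N) ^ k))" and ?G = "schur_state N e x" and ?G' = "schur_state (Suc N) e x"
  have "of_nat (energy t) * ?V ?G t = ?V (\<lambda>s. of_nat (energy s) * ?G s) t + rsum (\<lambda>k. - (x (Suc N) ^ k)) (?V ?G) t"
    by (rule vexp_deriv)
  also have "?V (\<lambda>s. of_nat (energy s) * ?G s) t =
      ?V (\<lambda>s. of_nat (psize e) * ?G s + rsum (\<lambda>k. - (\<Sum>i=1..N. x i ^ k)) ?G s) t"
    by (rule vexp_cong_Z[OF Suc.prems]) (use Suc.IH in \<open>simp add: algebra_simps\<close>)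
  also have "\<dots> = of_nat (psize e) * ?V ?G t + rsum (\<lambda>k. - (\<Sum>i=1..N. x i ^ k)) (?V ?G) t"
    by (simp only: lfin_add[OF lfin_vexp] lfin_scale[OF lfin_vexp] vexp_rsum)
  finally have "(of_nat (energy t) - of_nat (psize e)) * ?V ?G t =
      rsum (\<lambda>k. - (\<Sum>i=1..N. x i ^ k)) (?V ?G) t + rsum (\<lambda>k. - (x (Suc N) ^ k)) (?V ?G) t"
    by (simp add: algebra_simps)
  also have "\<dots> = rsum (\<lambda>k. - (\<Sum>i=1..Suc N. x i ^ k)) (?V ?G) t"
    by (subst rsum_add[symmetric]) simp
  also have "\<dots> = rsum (\<lambda>k. - (\<Sum>i=1..Suc N. x i ^ k)) ?G' t"
    by (rule rsum_cong_Z[OF Suc.prems]) (rule schur_state_Suc)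
  finally show ?case by (simp only: schur_state_Suc[OF Suc.prems])
qed

text \<open>The limit is taken in the recursion and not in the exponential: for fixed
  \<open>t\<close> the recursion is a finite sum over inversions, so it passes to infinitely many
  variables term by term.\<close>

theorem vexp_skew_schur:
  assumes "(\<lambda>i. norm (x i)) summable_on {1..}"
  shows "vexp (\<lambda>k. - psum x k) (delta (row_state e)) (row_state l) = skew_schur l e x"
proof -
  define G where "G S = skew_schur (inv row_state S) e x" for S
  have lim: "(\<lambda>N. schur_state N e x S) \<longlonglongrightarrow> G S" for S
    unfolding schur_state_def G_def by (rule schur_le_tendsto[OF assms])
  have "vexp (\<lambda>k. - psum x k) (delta (row_state e)) t = G t" if "t \<in> range row_state" for t
  proof (rule vexp_unique[OF _ _ that])
    fix t assume t: "t \<in> range row_state"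
    have "(\<lambda>N. rsum (\<lambda>k. - (\<Sum>i=1..N. x i ^ k)) (schur_state N e x) t)
        \<longlonglongrightarrow> - (\<Sum>(y, w)\<in>inversions t. - psum x (nat (y - w)) * (move_sign t y w * G (move y w t)))"
      unfolding rsum_inversions split_def
    proof (intro tendsto_minus tendsto_sum tendsto_mult)
      fix p assume p: "p \<in> inversions t"
      then show "(\<lambda>N. \<Sum>i=1..N. x i ^ nat (fst p - snd p)) \<longlonglongrightarrow> psum x (nat (fst p - snd p))"
        by (intro psum_tendsto[OF assms]) (auto simp: inversions_def)
      have "hop (fst p) (snd p) F t = move_sign t (fst p) (snd p) * F (move (fst p) (snd p) t)" for F
        using hop_sign[of "fst p" "snd p" t F] p by simp
      then show "(\<lambda>N. hop (fst p) (snd p) (schur_state N e x) t)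
          \<longlonglongrightarrow> move_sign t (fst p) (snd p) * G (move (fst p) (snd p) t)"
        by (simp only:) (intro tendsto_mult tendsto_const lim)
    qed
    also have "- (\<Sum>(y, w)\<in>inversions t. - psum x (nat (y - w)) * (move_sign t y w * G (move y w t)))
        = rsum (\<lambda>k. - psum x k) G t"
      unfolding rsum_inversions by (intro arg_cong[of _ _ uminus] sum.cong) (auto simp: hop_sign)
    finally have "(\<lambda>N. rsum (\<lambda>k. - (\<Sum>i=1..N. x i ^ k)) (schur_state N e x) t)
        \<longlonglongrightarrow> rsum (\<lambda>k. - psum x k) G t" .
    moreover have "(\<lambda>N. rsum (\<lambda>k. - (\<Sum>i=1..N. x i ^ k)) (schur_state N e x) t)
        \<longlonglongrightarrow> (of_nat (energy t) - of_nat (psize e)) * G t"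
      unfolding newton_schur_state[OF t, symmetric] by (intro tendsto_mult tendsto_const lim)
    ultimately have "rsum (\<lambda>k. - psum x k) G t = (of_nat (energy t) - of_nat (psize e)) * G t"
      by (rule LIMSEQ_unique)
    then show "(of_nat (energy t) - of_nat (energy (row_state e))) * G t = rsum (\<lambda>k. - psum x k) G t"
      by (simp add: energy_row_state)
  next
    fix t assume "t \<in> range row_state" "energy t \<le> energy (row_state e)"
    then obtain l where t: "t = row_state l" "psize l \<le> psize e" by (auto simp: energy_row_state)
    have "(\<lambda>N. schur_le N l e x) = (\<lambda>N. if l = e then 1 else 0)"
    proof (cases "l = e")
      case False
      then have "\<not> contained e l" using contained_psize_eq[of e l] t(2) by blast
      then show ?thesis using False by (simp add: schur_le_def)
    qed (simp add: schur_le_diag)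
    then have lim: "(\<lambda>N::nat. if l = e then 1 else 0) \<longlonglongrightarrow> skew_schur l e x"
      using schur_le_tendsto[OF assms, of l e] by simp
    have "skew_schur l e x = (if l = e then 1 else 0)"
      by (rule LIMSEQ_unique[OF lim tendsto_const])
    then show "G t = delta (row_state e) t" by (simp add: G_def t delta_def row_state_inject)
  qed
  then show ?thesis by (simp add: G_def)
qed


subsection \<open>Particle-hole symmetry\<close>

text \<open>Exchanges particles and holes and reflects the levels about -1/2. On partitions this is
  conjugation, see \<open>flip_row_state\<close>.\<close>

lift_definition flip :: "maya \<Rightarrow> maya" is "\<lambda>S. {k. - k - 1 \<notin> S}"
proof -
  fix S :: "int set" assume fin: "finite {k \<in> S. 0 \<le> k} \<and> finite {k. k < 0 \<and> k \<notin> S}"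
  have "{k \<in> {k. - k - 1 \<notin> S}. 0 \<le> k} \<subseteq> (\<lambda>k. - k - 1) ` {k. k < 0 \<and> k \<notin> S}"
    "{k. k < 0 \<and> k \<notin> {k. - k - 1 \<notin> S}} \<subseteq> (\<lambda>k. - k - 1) ` {k \<in> S. 0 \<le> k}"
    by (auto intro!: image_eqI[of _ _ "- _ - 1"])
  then show "finite {k \<in> {k. - k - 1 \<notin> S}. 0 \<le> k} \<and> finite {k. k < 0 \<and> k \<notin> {k. - k - 1 \<notin> S}}"
    using fin by (meson finite_imageI finite_subset)
qed

lemma levels_flip [simp]: "levels (flip S) = {k. - k - 1 \<notin> levels S}"
  by (rule flip.rep_eq)

lemma flip_flip [simp]: "flip (flip S) = S"
  by (rule maya_eqI) simp

lemma flip_row_state: "flip (row_state l) = ket_state l"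
proof (rule maya_eqI, rule set_eqI)
  fix k
  have "k \<in> levels (flip (row_state l)) \<longleftrightarrow> (\<exists>i\<ge>1. - k - 1 = int i - int (part (conj_part l) i) - 1)"
    by (simp add: levels_row_state level_set_compl)
  also have "\<dots> \<longleftrightarrow> k \<in> levels (ket_state l)"
    unfolding ket_state_def levels_row_state level_set_def by force
  finally show "k \<in> levels (flip (row_state l)) \<longleftrightarrow> k \<in> levels (ket_state l)" .
qed

lemma flip_inversions: "(y, w) \<in> inversions (flip S) \<longleftrightarrow> (- w - 1, - y - 1) \<in> inversions S"
  by (auto simp: inversions_def)

lemma energy_flip [simp]: "energy (flip S) = energy S"
proof -
  have "bij_betw (\<lambda>(y, w). (- w - 1, - y - 1)) (inversions (flip S)) (inversions S)"
    by (rule bij_betw_byWitness[where f' = "\<lambda>(y, w). (- w - 1, - y - 1)"])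
      (auto simp: inversions_def)
  then show ?thesis unfolding energy_def by (rule bij_betw_same_card)
qed

lemma flip_move: "(y, w) \<in> inversions S \<Longrightarrow> flip (move y w S) = move (- w - 1) (- y - 1) (flip S)"
  by (rule maya_eqI) (auto simp: inversions_def)

text \<open>Up to reflection, each of the \<open>y - w - 1\<close> levels strictly between is
  occupied in exactly one of the two states, so the two signs multiply to the parity of
  \<open>y - w - 1\<close>.\<close>

lemma move_sign_flip:
  assumes "(y, w) \<in> inversions S"
  shows "move_sign (flip S) (- w - 1) (- y - 1) = - ((-1) ^ nat (y - w) * move_sign S y w)"
proof -
  have lt: "w < y" using assms by (simp add: inversions_def)
  let ?A = "{j \<in> levels S. w < j \<and> j < y}"
  have "{j \<in> levels (flip S). - y - 1 < j \<and> j < - w - 1} = (\<lambda>j. - j - 1) ` ({w<..<y} - ?A)"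
    by (auto intro!: image_eqI[of _ _ "- _ - 1"])
  then have "card {j \<in> levels (flip S). - y - 1 < j \<and> j < - w - 1} = card ({w<..<y} - ?A)"
    by (simp add: card_image inj_on_def)
  also have "\<dots> = card {w<..<y} - card ?A"
    by (rule card_Diff_subset) (auto intro: finite_subset[of _ "{w<..<y}"])
  finally have "card {j \<in> levels (flip S). - y - 1 < j \<and> j < - w - 1} + card ?A + 1 = nat (y - w)"
  proof -
    assume c: "card {j \<in> levels (flip S). - y - 1 < j \<and> j < - w - 1} = card {w<..<y} - card ?A"
    have "card ?A \<le> card {w<..<y}" by (rule card_mono) auto
    then show ?thesis using lt unfolding c by simp
  qed
  then have "(-1) ^ nat (y - w) * move_sign S y w =
      (-1) ^ (card {j \<in> levels (flip S). - y - 1 < j \<and> j < - w - 1} + card ?A + 1) * move_sign S y w" by simp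
  also have "\<dots> = - move_sign (flip S) (- w - 1) (- y - 1) * (move_sign S y w * move_sign S y w)"
    by (simp add: move_sign_def power_add)
  also have "move_sign S y w * move_sign S y w = 1"
    by (simp add: move_sign_def flip: power_add mult_2)
  finally show ?thesis by simp
qed

text \<open>The power of -1 in \<open>move_sign_flip\<close> is absorbed by the energy sign; the
  minus sign that remains is the change of sign of the modes.\<close>

lemma vexp_flip:
  assumes "t \<in> range row_state"
  shows "vexp (\<lambda>k. - z k) (delta (flip e)) t = (-1) ^ (energy t + energy e) * vexp z (delta e) (flip t)"
proof (rule vexp_unique[OF _ _ assms])
  define G where "G S = (-1) ^ (energy S + energy e) * vexp z (delta e) (flip S)" for S
  fix S :: maya
  have "rsum (\<lambda>k. - z k) G S = (\<Sum>(y, w)\<in>inversions S. z (nat (y - w)) * (move_sign S y w * G (move y w S)))"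
    unfolding rsum_inversions sum_negf[symmetric] by (rule sum.cong) (auto simp: hop_sign)
  also have "\<dots> = (\<Sum>(y, w)\<in>inversions (flip S). - ((-1) ^ (energy S + energy e) *
      (z (nat (y - w)) * hop y w (vexp z (delta e)) (flip S))))"
  proof (rule sum.reindex_bij_witness[of _ "\<lambda>(y, w). (- w - 1, - y - 1)" "\<lambda>(y, w). (- w - 1, - y - 1)"])
    fix p assume p: "p \<in> inversions S"
    obtain y w where yw: "p = (y, w)" by fastforce
    have inv: "(- w - 1, - y - 1) \<in> inversions (flip S)"
      using p by (simp add: yw flip_inversions)
    have "energy S = energy (move y w S) + nat (y - w)"
      using energy_move[of y S w] p by (auto simp: yw inversions_def)
    then have "(-1) ^ (energy S + energy e) = (-1) ^ (energy (move y w S) + energy e) * ((-1) ^ nat (y - w) :: complex)"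
      by (simp add: power_add)
    moreover have "(-1) ^ nat (y - w) * (-1) ^ nat (y - w) = (1 :: complex)"
      by (simp flip: power_add mult_2)
    ultimately have A: "move_sign S y w * (-1) ^ (energy (move y w S) + energy e) =
        - ((-1) ^ (energy S + energy e) * move_sign (flip S) (- w - 1) (- y - 1))"
      unfolding move_sign_flip[OF p[unfolded yw]] by (simp add: ac_simps)
    have B: "hop (- w - 1) (- y - 1) (vexp z (delta e)) (flip S)
        = move_sign (flip S) (- w - 1) (- y - 1) * vexp z (delta e) (flip (move y w S))"
      unfolding hop_sign[OF inv] flip_move[OF p[unfolded yw]] ..
    have "z (nat (y - w)) * (move_sign S y w * G (move y w S)) = z (nat (y - w)) * vexp z (delta e) (flip (move y w S))
        * (move_sign S y w * (-1) ^ (energy (move y w S) + energy e))"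
      by (simp only: G_def ac_simps)
    also have "\<dots> = - ((-1) ^ (energy S + energy e) * (z (nat (y - w)) *
        hop (- w - 1) (- y - 1) (vexp z (delta e)) (flip S)))"
      unfolding A B by (simp add: ac_simps)
    finally show "(case (case p of (y, w) \<Rightarrow> (- w - 1, - y - 1)) of (y, w) \<Rightarrow>
        - ((-1) ^ (energy S + energy e) * (z (nat (y - w)) * hop y w (vexp z (delta e)) (flip S))))
        = (case p of (y, w) \<Rightarrow> z (nat (y - w)) * (move_sign S y w * G (move y w S)))"
      by (simp add: yw)
  qed (auto simp: inversions_def)
  also have "\<dots> = (-1) ^ (energy S + energy e) * rsum z (vexp z (delta e)) (flip S)"
    unfolding rsum_inversions by (simp add: split_def sum_negf sum_distrib_left)
  also have "\<dots> = (of_nat (energy S) - of_nat (energy e)) * G S"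
    unfolding G_def vexp_delta_deriv[symmetric] by simp
  finally show "(of_nat (energy S) - of_nat (energy (flip e))) * ((-1) ^ (energy S + energy e) * vexp z (delta e) (flip S))
      = rsum (\<lambda>k. - z k) (\<lambda>S. (-1) ^ (energy S + energy e) * vexp z (delta e) (flip S)) S"
    unfolding G_def[abs_def] by simp
next
  fix S :: maya assume "energy S \<le> energy (flip e)"
  moreover have "flip S = e \<longleftrightarrow> S = flip e" by (metis flip_flip)
  ultimately show "(-1) ^ (energy S + energy e) * vexp z (delta e) (flip S) = delta (flip e) S"
    by (auto simp: vexp_delta_below delta_def simp flip: mult_2)
qed

theorem vexp_skew_schur_neg:
  assumes "(\<lambda>i. norm (x i)) summable_on {1..}"
  shows "vexp (\<lambda>k. - psum x k) (delta (ket_state e)) (ket_state l) = skew_schur (conj_part l) (conj_part e) x"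
  unfolding ket_state_def by (rule vexp_skew_schur[OF assms])

theorem vexp_skew_schur_pos:
  assumes "(\<lambda>i. norm (x i)) summable_on {1..}"
  shows "vexp (psum x) (delta (ket_state e)) (ket_state l) = (-1) ^ (psize l + psize e) * skew_schur l e x"
proof -
  have "ket_state l \<in> range row_state" by (simp add: ket_state_def)
  then have "vexp (\<lambda>k. - (- psum x k)) (delta (flip (row_state e))) (ket_state l)
      = (-1) ^ (energy (ket_state l) + energy (row_state e)) * vexp (\<lambda>k. - psum x k) (delta (row_state e)) (flip (ket_state l))"
    by (rule vexp_flip)
  moreover have "flip (ket_state l) = row_state l" by (simp flip: flip_row_state)
  ultimately show ?thesis
    by (simp add: flip_row_state energy_ket_state energy_row_state vexp_skew_schur[OF assms])
qed

section \<open>Diagonal operators\<close>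

lemma nord_diag:
  "nord_psid_psi k (- k - 1) F S =
    (if k < 0 \<and> k \<notin> levels S then F S else if 0 \<le> k \<and> k \<in> levels S then - F S else 0)"
proof -
  have "add_level k (del_level k S) = S" if "k \<in> levels S" using that by (intro maya_eqI) auto
  moreover have "del_level k (add_level k S) = S" if "k \<notin> levels S" using that by (intro maya_eqI) auto
  ultimately show ?thesis
    by (auto simp: nord_psid_psi_def psi_apply psid_def lsgn_add_level lsgn_del_level)
qed

definition particles :: "maya \<Rightarrow> int set" where
  "particles S = {k \<in> levels S. 0 \<le> k}"

definition holes :: "maya \<Rightarrow> int set" where
  "holes S = {k. k < 0 \<and> k \<notin> levels S}"

lemma finite_particles: "finite (particles S)" and finite_holes: "finite (holes S)"
  using levels[of S] by (simp_all add: particles_def holes_def)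

text \<open>Normal ordering makes the sea contribute 0, so only the finitely many holes and
  particles remain, with opposite signs.\<close>

lemma infsum_nord:
  "(\<Sum>\<^sub>\<infinity>k. f k * nord_psid_psi k (- k - 1) F S) = (sum f (holes S) - sum f (particles S)) * F S"
proof -
  have disj: "holes S \<inter> particles S = {}" by (auto simp: particles_def holes_def)
  have "(\<Sum>\<^sub>\<infinity>k. f k * nord_psid_psi k (- k - 1) F S) =
      (\<Sum>k\<in>holes S \<union> particles S. f k * nord_psid_psi k (- k - 1) F S)"
    by (rule infsum_finite_support)
      (auto simp: finite_particles finite_holes nord_diag, auto simp: particles_def holes_def)
  also have "\<dots> = (\<Sum>k\<in>holes S. f k * nord_psid_psi k (- k - 1) F S)
      + (\<Sum>k\<in>particles S. f k * nord_psid_psi k (- k - 1) F S)"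
    by (rule sum.union_disjoint) (auto simp: finite_particles finite_holes disj)
  also have "(\<Sum>k\<in>holes S. f k * nord_psid_psi k (- k - 1) F S) = (\<Sum>k\<in>holes S. f k * F S)"
    by (rule sum.cong) (auto simp: nord_diag holes_def)
  also have "(\<Sum>k\<in>particles S. f k * nord_psid_psi k (- k - 1) F S) = (\<Sum>k\<in>particles S. - (f k * F S))"
    by (rule sum.cong) (auto simp: nord_diag particles_def)
  finally show ?thesis by (simp add: sum_negf sum_distrib_right left_diff_distrib)
qed

lemma w_op_diag:
  "w_op F S = ((\<Sum>k\<in>holes S. (of_int k + 1 / 2)\<^sup>2) - (\<Sum>k\<in>particles S. (of_int k + 1 / 2)\<^sup>2)) * F S"
  unfolding w_op_def by (rule infsum_nord)

definition b_val :: "complex \<Rightarrow> int \<Rightarrow> maya \<Rightarrow> complex" where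
  "b_val q n S = (\<Sum>k\<in>particles S. q powi (n * (k + 1))) - (\<Sum>k\<in>holes S. q powi (n * (k + 1)))
     + 1 / (1 - q powi (- n))"

lemma b_op_diag: "b_op q n F S = b_val q n S * F S"
  by (simp add: b_op_def infsum_nord b_val_def algebra_simps)

lemma L0_op_diag: "L0_op F S = of_nat (energy S) * F S"
proof -
  have "L0_op F S = (\<Sum>n\<in>int ` {1..energy S}. a_op (- n) (a_op n F) S)"
    unfolding L0_op_def
  proof (rule infsum_finite_support)
    fix n assume n: "n \<in> {1..} - int ` {1..energy S}"
    have "nat n \<notin> {1..energy S}"
    proof
      assume "nat n \<in> {1..energy S}"
      then have "int (nat n) \<in> int ` {1..energy S}" by (rule imageI)
      then show False using n by simp
    qed
    then have "energy S < nat n" "1 \<le> nat n" using n by auto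
    then show "a_op (- n) (a_op n F) S = 0" using a_zero[of "nat n" S "a_op n F"] n by simp
  qed auto
  also have "\<dots> = (\<Sum>k=1..energy S. a_op (- int k) (a_op (int k) F) S)"
    by (simp add: sum.reindex)
  finally show ?thesis by (simp only: a_op_number)
qed

lemma exp_Ln_powi: "c \<noteq> 0 \<Longrightarrow> exp (Ln c * of_int n) = c powi n"
  using exp_power_int[of "Ln c" n] by (simp add: mult.commute)

text \<open>An integral eigenvalue makes the result independent of the branch of \<open>Ln\<close>.
  Integrality is demanded only at the state under consideration.\<close>

lemma op_pow_diag:
  assumes "c \<noteq> 0" "\<And>F S. A F S = d S * F S" "d S = of_int n"
  shows "op_pow c A F S = c powi n * F S"
proof -
  have "op_pow c A F S = exp (Ln c * d S) * F S"
    unfolding op_pow_def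
    by (rule op_exp_diag[where d = "\<lambda>S. Ln c * d S"]) (simp add: assms(2))
  then show ?thesis using assms by (simp add: exp_Ln_powi)
qed


subsection \<open>The eigenvalue of the cut-and-join operator\<close>

lemma holes_ket_state: "holes (ket_state l) = (\<lambda>i. int i - int (part l i) - 1) ` {1..pdiag l}"
  and particles_ket_state: "particles (ket_state l) = (\<lambda>i. int (part (conj_part l) i) - int i) ` {1..pdiag l}"
proof -
  have neg: "int i - int (part l i) - 1 < 0" "0 \<le> int (part (conj_part l) i) - int i" if "i \<in> {1..pdiag l}" for i
    using that unfolding diag_set using le_conj_self_iff[of i l] by auto
  define H P where "H = (\<lambda>i. int i - int (part l i) - 1) ` {1..pdiag l}"
    and "P = (\<lambda>i. int (part (conj_part l) i) - int i) ` {1..pdiag l}"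
  have H: "x < 0" if "x \<in> H" for x using that neg(1) unfolding H_def by blast
  have P: "0 \<le> x" if "x \<in> P" for x using that neg(2) unfolding P_def by blast
  have lev: "levels (ket_state l) = ({k. k < 0} - H) \<union> P"
    unfolding levels_ket_state ket_levels_def H_def P_def ..
  have "holes (ket_state l) = H" unfolding holes_def lev using H P by (auto simp: not_less dest: leD)
  then show "holes (ket_state l) = (\<lambda>i. int i - int (part l i) - 1) ` {1..pdiag l}" by (simp only: H_def)
  have "particles (ket_state l) = P" unfolding particles_def lev using H P by (auto dest: leD)
  then show "particles (ket_state l) = (\<lambda>i. int (part (conj_part l) i) - int i) ` {1..pdiag l}" by (simp only: P_def)
qed

lemma pdiag_conj [simp]: "pdiag (conj_part l) = pdiag l"
proof -
  have "{i. 1 \<le> i \<and> i \<le> part (conj_part l) i} = {i. 1 \<le> i \<and> i \<le> part l i}"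
    using le_conj_self_iff[of _ l] by blast
  then show ?thesis by (simp add: pdiag_def)
qed

text \<open>With the Frobenius coordinates \<open>part l i - i\<close>, this is twice the sum of the
  contents on and above the diagonal; see \<open>sum_contents_upper\<close>.\<close>

definition arms :: "partition \<Rightarrow> int" where
  "arms l = (\<Sum>i=1..pdiag l. (int (part l i) - int i) * (int (part l i) - int i + 1))"

lemma sum_contents_row: "i \<le> L \<Longrightarrow> (\<Sum>j=i..L. 2 * (int j - int i)) = (int L - int i) * (int L - int i + 1)"
proof (induction L rule: nat_induct_at_least)
  case (Suc L)
  then show ?case by (simp add: algebra_simps)
qed simp

lemma sum_contents_upper: "(\<Sum>(i, j)\<in>{(i, j) \<in> cells l. i \<le> j}. 2 * (int j - int i)) = arms l"
proof -
  have "{(i, j) \<in> cells l. i \<le> j} = (SIGMA i:{1..pdiag l}. {i..part l i})"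
    unfolding diag_set by (auto simp: cells_iff)
  then have "(\<Sum>(i, j)\<in>{(i, j) \<in> cells l. i \<le> j}. 2 * (int j - int i))
      = (\<Sum>i=1..pdiag l. \<Sum>j=i..part l i. 2 * (int j - int i))"
    by (simp add: sum.Sigma)
  also have "\<dots> = arms l"
    unfolding arms_def diag_set by (rule sum.cong[OF refl], rule sum_contents_row) simp
  finally show ?thesis .
qed

text \<open>\<open>kappa\<close> is twice the sum of the contents \<open>j - i\<close>.
  Transposition carries the cells below the diagonal to those above it in the conjugate and changes
  the sign; diagonal cells have content 0.\<close>

lemma kappa_arms: "kappa l = arms l - arms (conj_part l)"
proof -
  let ?c = "\<lambda>(i, j). 2 * (int j - int i)"
  have row: "int L * (int L - 2 * int i + 1) = (\<Sum>j=1..L. 2 * (int j - int i))" for L i :: nat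
    by (induction L) (simp_all add: algebra_simps)
  have "kappa l = (\<Sum>i | part l i \<noteq> 0. \<Sum>j=1..part l i. 2 * (int j - int i))"
    unfolding kappa_def row ..
  also have "\<dots> = sum ?c (cells l)"
    unfolding cells_Sigma using part[of l] by (subst sum.Sigma) auto
  also have "\<dots> = sum ?c {(i, j) \<in> cells l. i \<le> j} + sum ?c {(i, j) \<in> cells l. j < i}"
    by (subst sum.union_disjoint[symmetric])
      (auto intro!: sum.cong finite_subset[OF _ finite_cells[of l empty_part]])
  also have "sum ?c {(i, j) \<in> cells l. j < i} = sum ?c {(i, j) \<in> cells l. j \<le> i}"
    by (rule sum.mono_neutral_left) (auto intro!: finite_subset[OF _ finite_cells[of l empty_part]])
  also have "\<dots> = (\<Sum>(i, j)\<in>{(i, j) \<in> cells (conj_part l). i \<le> j}. - (2 * (int j - int i)))"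
    by (rule sum.reindex_bij_witness[of _ prod.swap prod.swap])
      (auto simp: cells_iff le_conj_part_iff)
  also have "\<dots> = - arms (conj_part l)"
    unfolding sum_contents_upper[symmetric] by (simp add: split_def flip: sum_negf)
  finally show ?thesis unfolding sum_contents_upper by simp
qed

lemma kappa_conj: "kappa (conj_part l) = - kappa l"
  by (simp add: kappa_arms)

lemma w_op_ket_state:
  "(\<Sum>k\<in>holes (ket_state l). (of_int k + 1 / 2)\<^sup>2) - (\<Sum>k\<in>particles (ket_state l). (of_int k + 1 / 2)\<^sup>2)
    = (of_int (kappa l) :: complex)"
proof -
  \<comment> \<open>The constants 1/4 will cancel between holes and particles, both of which number
    \<open>pdiag l\<close>.\<close>
  have sq: "(of_int a + 1 / 2)\<^sup>2 = (of_int (a * (a + 1)) + 1 / 4 :: complex)" for a :: int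
    by (simp add: power2_eq_square field_simps)
  have inj: "inj_on (\<lambda>i. int i - int (part l i) - 1) {1..pdiag l}"
    "inj_on (\<lambda>i. int (part (conj_part l) i) - int i) {1..pdiag l}"
  proof -
    show "inj_on (\<lambda>i. int i - int (part l i) - 1) {1..pdiag l}"
      by (rule inj_onI, rule level_inj[of _ _ l]) auto
    show "inj_on (\<lambda>i. int (part (conj_part l) i) - int i) {1..pdiag l}"
      by (rule inj_onI, rule level_inj[of _ _ "conj_part l"]) auto
  qed
  have "(\<Sum>k\<in>holes (ket_state l). (of_int k + 1 / 2)\<^sup>2) = (\<Sum>k\<in>holes (ket_state l). of_int (k * (k + 1)) + 1 / 4 :: complex)"
    by (simp only: sq)
  also have "\<dots> = (\<Sum>i=1..pdiag l. of_int ((int (part l i) - int i) * (int (part l i) - int i + 1)) + 1 / 4)"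
    unfolding holes_ket_state sum.reindex[OF inj(1)] o_def
    by (rule sum.cong) (simp_all add: algebra_simps)
  also have "\<dots> = of_int (arms l) + of_nat (pdiag l) / 4"
    by (simp add: arms_def sum.distrib)
  finally have h: "(\<Sum>k\<in>holes (ket_state l). (of_int k + 1 / 2)\<^sup>2) = (of_int (arms l) + of_nat (pdiag l) / 4 :: complex)" .
  have "(\<Sum>k\<in>particles (ket_state l). (of_int k + 1 / 2)\<^sup>2) = (\<Sum>k\<in>particles (ket_state l). of_int (k * (k + 1)) + 1 / 4 :: complex)"
    by (simp only: sq)
  also have "\<dots> = of_int (arms (conj_part l)) + of_nat (pdiag l) / 4"
    unfolding particles_ket_state sum.reindex[OF inj(2)] o_def
    by (simp add: arms_def sum.distrib)
  finally show ?thesis using h by (simp add: kappa_arms)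
qed


subsection \<open>The eigenvalues of the torus generators\<close>

lemma has_sum_modify:
  fixes f :: "'a \<Rightarrow> complex"
  assumes "(f has_sum s) P" "finite (P - U)" "finite (U - P)"
  shows "(f has_sum (s - sum f (P - U) + sum f (U - P))) U"
proof -
  have "(f has_sum (s - sum f (P - U))) (P - (P - U))"
    by (rule has_sum_Diff[OF assms(1) has_sum_finite[OF assms(2)]]) auto
  then have "(f has_sum (s - sum f (P - U) + sum f (U - P))) ((P - (P - U)) \<union> (U - P))"
    by (rule has_sum_Un_disjoint[OF _ has_sum_finite[OF assms(3)]]) auto
  moreover have "(P - (P - U)) \<union> (U - P) = U" by auto
  ultimately show ?thesis by simp
qed

lemma has_sum_geometric:
  fixes Q :: complex
  assumes "norm Q < 1"
  shows "((\<lambda>i::nat. Q ^ i) has_sum (1 / (1 - Q))) UNIV"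
  by (rule norm_summable_imp_has_sum)
    (use assms geometric_sums[of Q] summable_geometric[of "norm Q"] in \<open>auto simp: norm_power\<close>)

text \<open>The empty levels differ from the nonnegative ones by finitely many particles and holes,
  so the sum is the geometric series of the sea with a finite correction.\<close>

lemma has_sum_holes:
  fixes Q :: complex
  assumes "Q \<noteq> 0" "norm Q < 1"
  shows "((\<lambda>k. Q powi (k + 1)) has_sum
    (Q / (1 - Q) - (\<Sum>k\<in>particles S. Q powi (k + 1)) + (\<Sum>k\<in>holes S. Q powi (k + 1)))) (- levels S)"
proof -
  have "((\<lambda>i::nat. Q * Q ^ i) has_sum (Q * (1 / (1 - Q)))) UNIV"
    by (rule has_sum_cmult_right[OF has_sum_geometric[OF assms(2)]])
  moreover have "((\<lambda>i::nat. Q * Q ^ i) has_sum s) UNIV \<longleftrightarrow> ((\<lambda>k. Q powi (k + 1)) has_sum s) {0..}" for s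
    by (rule has_sum_reindex_bij_witness[of _ nat int])
      (auto simp: power_int_def nat_add_distrib)
  ultimately have "((\<lambda>k. Q powi (k + 1)) has_sum (Q / (1 - Q))) {0..}" by simp
  moreover have "{0..} - (- levels S) = particles S" "- levels S - {0..} = holes S"
    by (auto simp: particles_def holes_def)
  ultimately show ?thesis
    using has_sum_modify[where f = "\<lambda>k. Q powi (k + 1)" and s = "Q / (1 - Q)" and P = "{0..}" and U = "- levels S"]
    by (simp add: finite_particles finite_holes)
qed

lemma has_sum_levels:
  fixes Q :: complex
  assumes "Q \<noteq> 0" "norm Q < 1"
  shows "((\<lambda>k. Q powi (- k - 1)) has_sum
    (1 / (1 - Q) - (\<Sum>k\<in>holes S. Q powi (- k - 1)) + (\<Sum>k\<in>particles S. Q powi (- k - 1)))) (levels S)"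
proof -
  have "((\<lambda>i::nat. Q ^ i) has_sum s) UNIV \<longleftrightarrow> ((\<lambda>k. Q powi (- k - 1)) has_sum s) {..<0}" for s
    by (rule has_sum_reindex_bij_witness[of _ "\<lambda>k. nat (- k - 1)" "\<lambda>i. - int i - 1"])
      (auto simp: power_int_def)
  then have "((\<lambda>k. Q powi (- k - 1)) has_sum (1 / (1 - Q))) {..<0}"
    using has_sum_geometric[OF assms(2)] by simp
  moreover have "{..<0} - levels S = holes S" "levels S - {..<0} = particles S"
    by (auto simp: particles_def holes_def)
  ultimately show ?thesis
    using has_sum_modify[where f = "\<lambda>k. Q powi (- k - 1)" and s = "1 / (1 - Q)" and P = "{..<0}" and U = "levels S"]
    by (simp add: finite_particles finite_holes)
qed

lemma has_sum_row_state_holes: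
  "(f has_sum s) (- levels (row_state l)) \<longleftrightarrow>
    ((\<lambda>i. f (int i - int (part (conj_part l) i) - 1)) has_sum s) {1..}"
proof -
  have "- levels (row_state l) = (\<lambda>i. int i - int (part (conj_part l) i) - 1) ` {1..}"
    using level_set_compl[of _ l] by (auto simp: levels_row_state)
  moreover have "inj_on (\<lambda>i. int i - int (part (conj_part l) i) - 1) {1..}"
    by (rule inj_onI, rule level_inj[of _ _ "conj_part l"]) auto
  ultimately show ?thesis by (simp add: has_sum_reindex o_def)
qed

lemma has_sum_row_state_levels:
  "(f has_sum s) (levels (row_state l)) \<longleftrightarrow> ((\<lambda>j. f (int (part l j) - int j)) has_sum s) {1..}"
proof -
  have "levels (row_state l) = (\<lambda>j. int (part l j) - int j) ` {1..}"
    by (auto simp: levels_row_state level_set_def)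
  moreover have "inj_on (\<lambda>j. int (part l j) - int j) {1..}"
    by (rule inj_onI, rule level_inj[of _ _ l]) auto
  ultimately show ?thesis by (simp add: has_sum_reindex o_def)
qed

text \<open>The empty levels of the state are labelled by the rows of \<open>l\<close>, so summing
  over them gives the power sum. The constant in \<open>b_op\<close> is minus the geometric series
  of the sea, by the identity Q / (1 - Q) = - 1 / (1 - 1 / Q).\<close>

lemma b_val_pos:
  assumes "qh \<noteq> 0" "norm qh < 1" "1 \<le> k"
  shows "psum (q_spec qh l) k = - (qh powi (- int k) * b_val (qh\<^sup>2) (int k) (ket_state l))"
proof -
  define Q where "Q = qh ^ (2 * k)"
  have Q: "Q \<noteq> 0" "norm Q < 1"
    using assms by (auto simp: Q_def norm_power power_less_one_iff)
  have pw: "Q powi j = qh powi (2 * int k * j)" for j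
  proof -
    have "Q = qh powi (2 * int k)"
      using power_int_of_nat[of qh "2 * k"] by (simp add: Q_def)
    then show ?thesis by (simp only: power_int_mult)
  qed
  have pw': "(qh\<^sup>2) powi (int k * j) = Q powi j" for j
  proof -
    have "qh\<^sup>2 = qh powi 2" by simp
    then show ?thesis unfolding pw by (simp only: power_int_mult[symmetric] mult.assoc)
  qed
  let ?s = "Q / (1 - Q) - (\<Sum>j\<in>particles (ket_state l). Q powi (j + 1)) + (\<Sum>j\<in>holes (ket_state l). Q powi (j + 1))"
  have "((\<lambda>i. Q powi (int i - int (part l i) - 1 + 1)) has_sum ?s) {1..}"
    using has_sum_holes[OF Q, of "ket_state l"] unfolding ket_state_def has_sum_row_state_holes conj_conj .
  then have "((\<lambda>i. qh powi (- int k) * Q powi (int i - int (part l i) - 1 + 1)) has_sum (qh powi (- int k) * ?s)) {1..}"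
    by (rule has_sum_cmult_right)
  moreover have "qh powi (- int k) * Q powi (int i - int (part l i) - 1 + 1) = q_spec qh l i ^ k" for i
  proof -
    have "qh powi (- int k) * Q powi (int i - int (part l i) - 1 + 1)
        = qh powi (- int k + 2 * int k * (int i - int (part l i)))"
      unfolding pw diff_add_cancel using assms(1) by (intro power_int_add[symmetric] disjI1)
    also have "\<dots> = qh powi ((2 * (int i - int (part l i)) - 1) * int k)"
      by (simp add: algebra_simps)
    finally show ?thesis by (simp only: q_spec_def power_int_mult power_int_of_nat)
  qed
  moreover have "?s = - b_val (qh\<^sup>2) (int k) (ket_state l)"
  proof -
    have "Q / (1 - Q) = - (1 / (1 - Q powi (- 1)))"
    proof -
      have "Q \<noteq> 1" using Q(2) by auto
      then show ?thesis using Q(1) by (simp add: power_int_minus field_simps)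
    qed
    moreover have "(qh\<^sup>2) powi (- int k) = Q powi (- 1)" using pw'[of "- 1"] by simp
    ultimately show ?thesis by (simp add: b_val_def pw')
  qed
  ultimately show ?thesis
    unfolding psum_def by (simp add: infsumI)
qed

text \<open>For negative modes it is the sum over the occupied levels that converges; these are
  labelled by the rows of the conjugate.\<close>

lemma b_val_neg:
  assumes "qh \<noteq> 0" "norm qh < 1" "1 \<le> k"
  shows "psum (q_spec qh (conj_part l)) k = qh powi (int k) * b_val (qh\<^sup>2) (- int k) (ket_state l)"
proof -
  define Q where "Q = qh ^ (2 * k)"
  have Q: "Q \<noteq> 0" "norm Q < 1"
    using assms by (auto simp: Q_def norm_power power_less_one_iff)
  have pw: "Q powi j = qh powi (2 * int k * j)" for j
  proof -
    have "Q = qh powi (2 * int k)"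
      using power_int_of_nat[of qh "2 * k"] by (simp add: Q_def)
    then show ?thesis by (simp only: power_int_mult)
  qed
  have pw': "(qh\<^sup>2) powi (int k * j) = Q powi j" for j
  proof -
    have "qh\<^sup>2 = qh powi 2" by simp
    then show ?thesis unfolding pw by (simp only: power_int_mult[symmetric] mult.assoc)
  qed
  let ?s = "1 / (1 - Q) - (\<Sum>j\<in>holes (ket_state l). Q powi (- j - 1)) + (\<Sum>j\<in>particles (ket_state l). Q powi (- j - 1))"
  have "((\<lambda>i. Q powi (- (int (part (conj_part l) i) - int i) - 1)) has_sum ?s) {1..}"
    using has_sum_levels[OF Q, of "ket_state l"] unfolding ket_state_def has_sum_row_state_levels .
  then have "((\<lambda>i. qh powi (int k) * Q powi (- (int (part (conj_part l) i) - int i) - 1)) has_sum (qh powi (int k) * ?s)) {1..}"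
    by (rule has_sum_cmult_right)
  moreover have "qh powi (int k) * Q powi (- (int (part (conj_part l) i) - int i) - 1) = q_spec qh (conj_part l) i ^ k" for i
  proof -
    have "qh powi (int k) * Q powi (- (int (part (conj_part l) i) - int i) - 1)
        = qh powi (int k + 2 * int k * (- (int (part (conj_part l) i) - int i) - 1))"
      unfolding pw using assms(1) by (simp only: power_int_add simp_thms)
    also have "\<dots> = qh powi ((2 * (int i - int (part (conj_part l) i)) - 1) * int k)"
      by (simp add: algebra_simps)
    finally show ?thesis by (simp only: q_spec_def power_int_mult power_int_of_nat)
  qed
  moreover have "?s = b_val (qh\<^sup>2) (- int k) (ket_state l)"
  proof -
    have "(qh\<^sup>2) powi (- int k * (j + 1)) = Q powi (- j - 1)" for j
    proof -
      have "- int k * (j + 1) = int k * (- j - 1)" by (simp add: algebra_simps)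
      then show ?thesis by (simp only: pw')
    qed
    moreover have "(qh\<^sup>2) powi (int k) = Q" using pw'[of 1] by simp
    ultimately show ?thesis by (simp add: b_val_def)
  qed
  ultimately show ?thesis
    unfolding psum_def by (simp add: infsumI)
qed

section \<open>Normalisation and specialisations\<close>

text \<open>The logarithms of the factors are summable, so the product is the exponential of a
  convergent series.\<close>

lemma vac_norm_nonzero:
  assumes "norm q < 1"
  shows "vac_norm q \<noteq> 0"
proof -
  define g where "g n = (- of_nat (Suc n) / 2) * Ln (1 - q ^ Suc n)" for n
  have neq: "1 - q ^ Suc n \<noteq> 0" for n
  proof
    assume "1 - q ^ Suc n = 0"
    then have "norm (q ^ Suc n) = 1" by (metis eq_iff_diff_eq_0 norm_one)
    moreover have "norm (q ^ Suc n) < 1"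
      using assms by (simp add: norm_power power_less_one_iff del: power_Suc)
    ultimately show False by simp
  qed
  have f: "(1 - q ^ Suc n) powr (- of_nat (Suc n) / 2) = exp (g n)" for n
    using neq[of n] by (simp add: powr_def g_def del: power_Suc of_nat_Suc)
  have "summable (\<lambda>n. of_nat (Suc n) * norm q ^ n)"
    using geometric_deriv_sums[of "norm q"] assms by (auto simp: sums_iff)
  then have "summable (\<lambda>n. norm q * (of_nat (Suc n) * norm q ^ n))"
    by (rule summable_mult)
  moreover have "eventually (\<lambda>n. norm (g n) \<le> norm q * (of_nat (Suc n) * norm q ^ n)) sequentially"
  proof -
    have "(\<lambda>n. norm q ^ Suc n) \<longlonglongrightarrow> 0"
      using assms LIMSEQ_power_zero[of "norm q"] by (subst filterlim_sequentially_Suc) auto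
    then have "eventually (\<lambda>n. norm q ^ Suc n < 1 / 2) sequentially"
      by (rule order_tendstoD) simp
    then show ?thesis
    proof eventually_elim
      fix n assume n: "norm q ^ Suc n < 1 / 2"
      have "norm (Ln (1 + - (q ^ Suc n))) \<le> 2 * norm (- (q ^ Suc n))"
        by (rule norm_Ln_le) (use n in \<open>simp add: norm_power norm_mult\<close>)
      then have "norm (Ln (1 - q ^ Suc n)) \<le> 2 * norm q ^ Suc n"
        by (simp add: norm_power norm_mult)
      then have "norm (g n) \<le> (of_nat (Suc n) / 2) * (2 * norm q ^ Suc n)"
        unfolding g_def norm_mult by (intro mult_mono) (auto simp: norm_divide simp del: of_nat_Suc)
      then show "norm (g n) \<le> norm q * (of_nat (Suc n) * norm q ^ n)"
        by (simp add: ac_simps del: of_nat_Suc)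
    qed
  qed
  ultimately have "summable g"
    by (rule summable_comparison_test_ev[rotated])
  then have "(\<lambda>n. \<Sum>i\<le>n. g i) \<longlonglongrightarrow> suminf g"
    by (rule summable_LIMSEQ')
  then have "(\<lambda>n. exp (\<Sum>i\<le>n. g i)) \<longlonglongrightarrow> exp (suminf g)"
    by (rule tendsto_exp)
  then have "convergent_prod (\<lambda>n. exp (g n))"
    unfolding convergent_prod_def raw_has_prod_def
    by (intro exI[of _ 0] exI[of _ "exp (suminf g)"]) (simp add: exp_sum)
  then have "prodinf (\<lambda>n. exp (g n)) \<noteq> 0"
    by (rule prodinf_nonzero) simp
  then show ?thesis unfolding vac_norm_def f .
qed

section \<open>Principal specialisations\<close>

lemma geometric_summable_on:
  fixes r :: real
  assumes "0 \<le> r" "r < 1"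
  shows "(\<lambda>i::nat. r ^ i) summable_on A"
proof -
  have "(\<lambda>i::nat. r ^ i) summable_on UNIV"
    by (rule norm_summable_imp_summable_on) (use assms in \<open>simp add: norm_power\<close>)
  then show ?thesis by (rule summable_on_subset_banach) simp
qed

lemma q_spec_summable:
  assumes "qh \<noteq> 0" "norm qh < 1"
  shows "(\<lambda>i. norm (q_spec qh l i)) summable_on {1..}"
proof (rule summable_on_comparison_test)
  let ?C = "norm qh powi (- (2 * int (part l 1)) - 1)"
  show "(\<lambda>i. ?C * ((norm qh)\<^sup>2) ^ i) summable_on {1..}"
    by (intro summable_on_cmult_right geometric_summable_on)
      (use assms in \<open>auto simp: power_less_one_iff abs_square_less_1\<close>)
  fix i :: nat assume i: "i \<in> {1..}"
  have "norm (q_spec qh l i) = norm qh powi (2 * (int i - int (part l i)) - 1)"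
    by (simp add: q_spec_def norm_power_int)
  also have "\<dots> \<le> norm qh powi (- (2 * int (part l 1)) - 1 + int (2 * i))"
    by (rule power_int_decreasing) (use assms i part_mono[of 1 i l] in auto)
  also have "\<dots> = ?C * ((norm qh)\<^sup>2) ^ i"
    using assms by (subst power_int_add) (auto simp flip: power_mult simp del: of_nat_mult)
  finally show "norm (q_spec qh l i) \<le> ?C * ((norm qh)\<^sup>2) ^ i" .
qed simp

lemma summable_scale:
  fixes x :: "nat \<Rightarrow> complex"
  assumes "(\<lambda>i. norm (x i)) summable_on {1..}"
  shows "(\<lambda>i. norm (c * x i)) summable_on {1..}"
  unfolding norm_mult by (rule summable_on_cmult_right[OF assms])

lemma psum_scale: "psum (\<lambda>i. c * x i) k = c ^ k * psum x k"
  unfolding psum_def power_mult_distrib by (rule infsum_cmult_right')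

text \<open>Homogeneity of degree \<open>psize l - psize e\<close>, written without subtraction so
  that it includes the case where \<open>e\<close> is not contained in \<open>l\<close> and both
  sides vanish.\<close>

lemma skew_schur_scale:
  "c ^ psize e * skew_schur l e (\<lambda>i. c * x i) = c ^ psize l * skew_schur l e x"
proof (cases "contained e l")
  case True
  have "skew_schur l e (\<lambda>i. c * x i) = c ^ card (skew_cells l e) * skew_schur l e x"
    using True by (simp add: skew_schur_def prod.distrib prod_constant infsum_cmult_right')
  then show ?thesis
    using card_skew_cells[OF True] by (simp flip: mult.assoc power_add) (simp add: add.commute)
qed (simp add: skew_schur_def)

lemma skew_schur_scale_inverse:
  assumes "c \<noteq> 0"
  shows "skew_schur l e (\<lambda>i. c * x i) = c powi (int (psize l) - int (psize e)) * skew_schur l e x"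
  using skew_schur_scale[of c e l x] assms by (simp add: power_int_diff field_simps)

lemma skew_schur_cong:
  assumes "\<And>i. 1 \<le> i \<Longrightarrow> x i = y i"
  shows "skew_schur l e x = skew_schur l e y"
proof -
  have "(\<Prod>c\<in>skew_cells l e. x (T c)) = (\<Prod>c\<in>skew_cells l e. y (T c))" if "T \<in> ssyt l e" for T
  proof (rule prod.cong[OF refl])
    fix c assume "c \<in> skew_cells l e"
    then have "T c \<in> {1..}" using that unfolding ssyt_def by blast
    then show "x (T c) = y (T c)" using assms by simp
  qed
  then show ?thesis unfolding skew_schur_def by (auto intro!: infsum_cong)
qed

lemma psize_empty [simp]: "psize empty_part = 0"
  by (simp add: psize_0)

text \<open>The powers of q with exponents i - 1/2 lie halfway between the sequences of the two
  S-dual vacua, with exponents i - 1 and i.\<close>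

lemma skew_schur_rho:
  assumes "qh \<noteq> 0" "qh\<^sup>2 = q"
  shows "skew_schur l empty_part (q_spec qh empty_part) = qh ^ psize l * skew_schur l empty_part (\<lambda>i. q ^ (i - 1))"
    and "skew_schur l empty_part (\<lambda>i. q ^ i) = qh ^ psize l * skew_schur l empty_part (q_spec qh empty_part)"
proof -
  have rho: "q_spec qh empty_part i = qh * q ^ (i - 1)" "q ^ i = qh * q_spec qh empty_part i" if "1 \<le> i" for i
  proof -
    have "q_spec qh empty_part i = qh powi (1 + int (2 * (i - 1)))"
      using that by (simp add: q_spec_def of_nat_diff algebra_simps)
    also have "\<dots> = qh * q ^ (i - 1)"
      using assms(1) by (subst power_int_add) (auto simp: power_mult assms(2) simp del: of_nat_mult)
    finally show q: "q_spec qh empty_part i = qh * q ^ (i - 1)" .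
    have "qh * (qh * q ^ (i - 1)) = q * q ^ (i - 1)" using assms(2) by (simp add: power2_eq_square)
    also have "\<dots> = q ^ i" using that by (cases i) auto
    finally show "q ^ i = qh * q_spec qh empty_part i" by (simp add: q)
  qed
  have "skew_schur l empty_part (q_spec qh empty_part) = skew_schur l empty_part (\<lambda>i. qh * q ^ (i - 1))"
    by (rule skew_schur_cong) (rule rho)
  then show "skew_schur l empty_part (q_spec qh empty_part) = qh ^ psize l * skew_schur l empty_part (\<lambda>i. q ^ (i - 1))"
    using skew_schur_scale[of qh empty_part l] by simp
  have "skew_schur l empty_part (\<lambda>i. q ^ i) = skew_schur l empty_part (\<lambda>i. qh * q_spec qh empty_part i)"
    by (rule skew_schur_cong) (rule rho)
  then show "skew_schur l empty_part (\<lambda>i. q ^ i) = qh ^ psize l * skew_schur l empty_part (q_spec qh empty_part)"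
    using skew_schur_scale[of qh empty_part l] by simp
qed

section \<open>Matrix elements of the S-dual vacua\<close>

lemma infsum_int_nat: "(\<Sum>\<^sub>\<infinity>n\<in>{1..}. f n) = (\<Sum>\<^sub>\<infinity>k\<in>{1..}. f (int k))"
  by (rule infsum_reindex_bij_witness[of _ int nat]) auto

lemma infsum_int_cut:
  assumes "\<And>k. K < k \<Longrightarrow> f (int k) = 0"
  shows "(\<Sum>\<^sub>\<infinity>n\<in>{1..}. f n) = (\<Sum>k=1..K. f (int k))"
  unfolding infsum_int_nat by (rule infsum_finite_support) (use assms in auto)

lemma S_ket_ket_state:
  assumes "norm q < 1"
  shows "S_ket q (ket_state l) = vac_norm q * skew_schur (conj_part l) empty_part (\<lambda>i. q ^ (i - 1))"
proof -
  let ?x = "\<lambda>i::nat. q ^ (i - 1)"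
  have ps: "(\<Sum>\<^sub>\<infinity>l\<in>{1..}. q powi ((l - 1) * int k)) = psum ?x k" for k
    unfolding infsum_int_nat psum_def
  proof (rule infsum_cong)
    fix i :: nat assume "i \<in> {1..}"
    then obtain j where "i = Suc j" by (cases i) auto
    then show "q powi ((int i - 1) * int k) = (q ^ (i - 1)) ^ k" by (simp add: power_int_mult)
  qed
  have "(\<lambda>F T. - (\<Sum>\<^sub>\<infinity>n\<in>{1..}. a_op (- n) F T / of_int n * (\<Sum>\<^sub>\<infinity>l\<in>{1..}. q powi ((l - 1) * n))))
      = rsum (\<lambda>k. - psum ?x k / of_nat k)"
  proof (intro ext)
    fix F T
    have "(\<Sum>\<^sub>\<infinity>n\<in>{1..}. a_op (- n) F T / of_int n * (\<Sum>\<^sub>\<infinity>l\<in>{1..}. q powi ((l - 1) * n)))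
        = (\<Sum>k=1..energy T. a_op (- int k) F T / of_nat k * psum ?x k)"
      by (subst infsum_int_cut[where K = "energy T"]) (simp_all add: a_zero ps)
    then show "- (\<Sum>\<^sub>\<infinity>n\<in>{1..}. a_op (- n) F T / of_int n * (\<Sum>\<^sub>\<infinity>l\<in>{1..}. q powi ((l - 1) * n)))
        = rsum (\<lambda>k. - psum ?x k / of_nat k) F T"
      by (simp add: rsum_eq[OF order_refl] sum_negf ac_simps)
  qed
  then have "S_ket q (ket_state l) = vac_norm q * vexp (\<lambda>k. - psum ?x k) (delta (ket_state empty_part)) (ket_state l)"
    by (simp add: S_ket_def vexp_def ket_eq)
  moreover have "(\<lambda>i. norm (?x i)) summable_on {1..}"
  proof -
    have "(\<lambda>i. norm q ^ i) summable_on ((\<lambda>i. i - 1) ` {1..})"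
      by (rule geometric_summable_on) (use assms in auto)
    then have "(\<lambda>i. norm q ^ (i - 1)) summable_on {1..}"
      by (subst (asm) summable_on_reindex) (auto simp: inj_on_def o_def)
    then show ?thesis by (simp add: norm_power)
  qed
  ultimately show ?thesis by (simp add: vexp_skew_schur_neg)
qed

text \<open>\<open>transposed_exp_single\<close> moves the lowering exponential onto the state. Its
  modes are positive power sums, and these bring the sign of
  \<open>vexp_skew_schur_pos\<close>.\<close>

lemma S_bra_ket_state:
  assumes "norm q < 1"
  shows "S_bra q (\<lambda>s. c * delta (ket_state l) s) =
    vac_norm q * c * ((-1) ^ psize l * skew_schur l empty_part (\<lambda>i. q ^ i))"
proof -
  let ?A = "\<lambda>F T. \<Sum>\<^sub>\<infinity>n\<in>{1..}. a_op n F T / of_int n * (\<Sum>\<^sub>\<infinity>l\<in>{1..}. q powi (l * n))"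
  have ps: "(\<Sum>\<^sub>\<infinity>l\<in>{1..}. q powi (l * int k)) = psum (\<lambda>i. q ^ i) k" for k
    unfolding infsum_int_nat psum_def
    by (rule infsum_cong) (auto simp: power_int_mult)
  have "op_exp ?A (\<lambda>s. c * delta (ket_state l) s) sea = c * vexp (psum (\<lambda>i. q ^ i)) (delta sea) (ket_state l)"
  proof (rule transposed_exp_single)
    fix F u K assume z: "\<And>k. K < k \<Longrightarrow> a_op (int k) F u = 0"
    show "?A F u = (\<Sum>k=1..K. psum (\<lambda>i. q ^ i) k / of_nat k * a_op (int k) F u)"
      by (subst infsum_int_cut[where K = K]) (simp_all add: z ps ac_simps)
  qed
  also have "vexp (psum (\<lambda>i. q ^ i)) (delta sea) (ket_state l) = (-1) ^ psize l * skew_schur l empty_part (\<lambda>i. q ^ i)"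
  proof -
    have "(\<lambda>i. norm (q ^ i)) summable_on {1..}"
      unfolding norm_power by (rule geometric_summable_on) (use assms in auto)
    then show ?thesis using vexp_skew_schur_pos[of "\<lambda>i. q ^ i" empty_part l] by (simp add: ket_state_empty)
  qed
  finally show ?thesis by (simp add: S_bra_def bra_eq ket_state_empty)
qed


section \<open>Factorisation of the vertex operators\<close>

text \<open>\<open>\<iota>\<close> fixes the state of the first copy and lists the others with the
  raised copy first: copies 2 and 3 for \<open>Phi_star\<close>, copies 3 and 2 for
  \<open>Phi\<close>. The diagonal operators of the first copy become the scalars \<open>y\<close>
  and \<open>z\<close>.\<close>

lemma embed_exp:
  assumes X: "\<And>F t u. X F (\<iota> (t, u)) = (\<Sum>\<^sub>\<infinity>n\<in>{1..}. 1 / of_int n *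
      (y n * a_op n (\<lambda>u. F (\<iota> (t, u))) u + a_op (- n) (\<lambda>t. a_op n (\<lambda>u. F (\<iota> (t, u))) u) t
        + z n * a_op (- n) (\<lambda>t. F (\<iota> (t, u))) t))"
    and F: "\<And>p. F (\<iota> p) = c * delta (sea, ket_state n) p"
  shows "op_exp X F (\<iota> (ket_state m, sea)) = c * (\<Sum>e | vexp (\<lambda>k. z (int k)) (delta e) (ket_state m) \<noteq> 0.
      vexp (\<lambda>k. z (int k)) (delta e) (ket_state m) * vexp (\<lambda>k. y (int k)) (delta e) (ket_state n))"
proof -
  define X' where "X' G = (\<lambda>(t, u). \<Sum>\<^sub>\<infinity>n\<in>{1..}. 1 / of_int n *
      (y n * a_op n (\<lambda>u. G (t, u)) u + a_op (- n) (\<lambda>t. a_op n (\<lambda>u. G (t, u)) u) t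
        + z n * a_op (- n) (\<lambda>t. G (t, u)) t))" for G
  have "(X ^^ j) F (\<iota> p) = (X' ^^ j) (\<lambda>p. c * delta (sea, ket_state n) p) p" for j p
  proof (induction j arbitrary: p)
    case (Suc j)
    obtain t u where p: "p = (t, u)" by fastforce
    show ?case by (simp add: p X Suc) (simp add: X'_def)
  qed (simp add: F)
  then have "op_exp X F (\<iota> (ket_state m, sea)) = op_exp X' (\<lambda>p. c * delta (sea, ket_state n) p) (ket_state m, sea)"
    by (simp add: op_exp_def)
  also have "\<dots> = c * (\<Sum>e | vexp (\<lambda>k. z (int k)) (delta e) (ket_state m) \<noteq> 0.
      vexp (\<lambda>k. z (int k)) (delta e) (ket_state m) * vexp (\<lambda>k. y (int k)) (delta e) (ket_state n))"
  proof (rule transposed_exp)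
    show "ket_state m \<in> range row_state" by (simp add: ket_state_def)
    fix F :: "(maya \<times> maya) vec" and t u K
    assume zero: "\<And>k. K < k \<Longrightarrow> a_op (int k) (\<lambda>u. F (t, u)) u = 0" and K: "energy t \<le> K"
    show "X' F (t, u) = (\<Sum>k=1..K. 1 / of_nat k * (y (int k) * a_op (int k) (\<lambda>u. F (t, u)) u
        + a_op (- int k) (\<lambda>t. a_op (int k) (\<lambda>u. F (t, u)) u) t
        + z (int k) * a_op (- int k) (\<lambda>t. F (t, u)) t))"
      unfolding X'_def prod.case
      by (subst infsum_int_cut[where K = K]) (use K in \<open>simp_all add: zero a_zero\<close>)
  qed
  finally show ?thesis .
qed

text \<open>The parametrisation \<open>h\<close> will follow the sign of the modes,
  \<open>ket_state\<close> for positive and \<open>row_state\<close> for negative power sums, so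
  that the intermediate partition appears without conjugation.\<close>

lemma sum_states:
  assumes "t \<in> range row_state" "inj h" "range h = range row_state"
  shows "(\<Sum>e | vexp z (delta e) t \<noteq> 0. vexp z (delta e) t * g e)
    = (\<Sum>\<^sub>\<infinity>p. vexp z (delta (h p)) t * g (h p))"
proof -
  let ?A = "{e. vexp z (delta e) t \<noteq> 0}"
  have fin: "finite ?A" by (rule lfin_finite[OF lfin_vexp])
  have sub: "?A \<subseteq> range h" using vexp_Z_closed[OF assms(1)] assms(3) by auto
  have "(\<Sum>\<^sub>\<infinity>p. vexp z (delta (h p)) t * g (h p)) = (\<Sum>p\<in>h -` ?A. vexp z (delta (h p)) t * g (h p))"
    by (rule infsum_finite_support[OF finite_vimageI[OF fin assms(2)]]) auto
  also have "\<dots> = (\<Sum>e\<in>h ` (h -` ?A). vexp z (delta e) t * g e)"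
    by (subst sum.reindex) (use assms(2) in \<open>auto intro: inj_on_subset\<close>)
  also have "h ` (h -` ?A) = ?A" using sub by auto
  finally show ?thesis by simp
qed

lemma inj_row_state: "inj row_state" and inj_ket_state: "inj ket_state"
  by (simp_all add: inj_def row_state_inject ket_state_inject)

lemma range_ket_state: "range ket_state = range row_state"
proof -
  have "row_state l = ket_state (conj_part l)" for l by (simp add: ket_state_def)
  then have "range row_state \<subseteq> range ket_state" by (metis image_subsetI rangeI)
  then show ?thesis by (auto simp: ket_state_def)
qed

text \<open>Cancels the sign of a power of \<open>- u\<close> or \<open>- v\<close> against the sign
  of the framing factor.\<close>

lemma minus_one_powi_power: "((-1) powi N) ^ L * ((-1) ^ L) powi N = (1 :: complex)"
proof -
  have "((-1) powi N) ^ L = ((-1) powi (N * int L) :: complex)"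
    by (simp add: power_int_mult)
  moreover have "((-1) ^ L) powi N = ((-1) powi (N * int L) :: complex)"
    by (metis mult.commute power_int_mult power_int_of_nat)
  ultimately show ?thesis by (simp add: power_int_minus_one_mult_self)
qed

lemma framing_powi: "framing qh l powi N = ((-1) ^ psize l) powi N * qh powi (N * kappa l)"
  by (simp add: framing_def power_int_mult_distrib mult.commute flip: power_int_mult)

lemma minus_powi: "(- u) powi N = (-1) powi N * u powi N" for u :: complex
  using power_int_mult_distrib[of "-1" u N] by simp

lemma op_pow_apply:
  assumes "\<And>F S. A F S = d S * F S"
  shows "op_pow c A F S = exp (Ln c * d S) * F S"
  unfolding op_pow_def by (rule op_exp_diag[where d = "\<lambda>S. Ln c * d S"]) (simp add: assms)

lemma b_modes_pos:
  assumes "qh \<noteq> 0" "norm qh < 1" "\<beta> \<noteq> 0" "1 \<le> k"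
  shows "\<beta> powi (- int k) * qh powi (- int k) * b_val (qh\<^sup>2) (int k) (ket_state l)
    = - psum (\<lambda>i. inverse \<beta> * q_spec qh l i) k"
  using b_val_pos[OF assms(1,2,4), of l]
  by (simp add: psum_scale power_int_minus power_inverse ac_simps)

lemma b_modes_neg:
  assumes "qh \<noteq> 0" "norm qh < 1" "1 \<le> k"
  shows "\<beta> powi int k * qh powi int k * b_val (qh\<^sup>2) (- int k) (ket_state l)
    = psum (\<lambda>i. \<beta> * q_spec qh (conj_part l) i) k"
  using b_val_neg[OF assms, of l] by (simp add: psum_scale ac_simps)

lemma vexp_cong_modes:
  assumes "\<And>k. 1 \<le> k \<Longrightarrow> z k = z' k"
  shows "vexp z = vexp z'"
proof -
  have "rsum (\<lambda>k. z k / of_nat k) = rsum (\<lambda>k. z' k / of_nat k)"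
    by (intro ext) (simp add: rsum_eq[OF order_refl] assms)
  then show ?thesis by (simp add: vexp_def)
qed

text \<open>Both exponentials carry positive power sums, so \<open>vexp_skew_schur_pos\<close>
  yields skew functions of \<open>m\<close> and \<open>n\<close> themselves. This matches the vertex
  at \<open>conj_part n\<close>, which conjugates its first argument.\<close>

lemma Phi_star_factorisation:
  fixes q qh u v :: complex and N :: int
  assumes "qh \<noteq> 0" "norm qh < 1" and q: "qh\<^sup>2 = q" and "u \<noteq> 0" "v \<noteq> 0"
  defines "\<alpha> \<equiv> qh * u powi N / v" and "\<beta> \<equiv> - (qh powi (- 1) * u)"
  defines "X \<equiv> (\<lambda>F s. \<Sum>\<^sub>\<infinity>n\<in>{1..}. 1 / of_int n *
               (- (\<beta> powi (- n) * qh powi (- n) * on1 (b_op q n) (on3 (a_op n) F) s)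
                + on2 (a_op (- n)) (on3 (a_op n) F) s
                + \<beta> powi n * qh powi n * on1 (b_op q (- n)) (on2 (a_op (- n)) F) s))"
  shows "Phi_star qh N u v l m n =
            inverse (vac_norm q) *
            bra3 (bra l) (bra m) (bra empty_part)
              (op_exp X
                (on1 (op_pow qh (\<lambda>F s. of_int N * w_op F s))
                  (on1 (op_pow (\<alpha> * qh) L0_op)
                    (tensor3 (S_ket q) (ket empty_part) (ket n)))))"
proof -
  have nq: "norm q < 1"
    using assms(2) by (simp add: q[symmetric] norm_power power_less_one_iff)
  have \<beta>: "\<beta> \<noteq> 0" and \<alpha>: "\<alpha> * qh \<noteq> 0" using assms(1,4,5) by (simp_all add: \<beta>_def \<alpha>_def)
  define S where "S = skew_schur (conj_part l) empty_part (\<lambda>i. q ^ (i - 1))"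
  define c where "c = qh powi (N * kappa l) * ((\<alpha> * qh) ^ psize l * (vac_norm q * S))"
  let ?F = "on1 (op_pow qh (\<lambda>F s. of_int N * w_op F s)) (on1 (op_pow (\<alpha> * qh) L0_op)
      (tensor3 (S_ket q) (ket empty_part) (ket n)))"
  let ?x = "\<lambda>i. \<beta> * q_spec qh (conj_part l) i" and ?y = "\<lambda>i. inverse \<beta> * q_spec qh l i"
  let ?z = "\<lambda>k. \<beta> powi k * qh powi k * b_val q (- k) (ket_state l)"
    and ?w = "\<lambda>k. - (\<beta> powi (- k) * qh powi (- k) * b_val q k (ket_state l))"
  \<comment> \<open>At \<open>ket_state l\<close> all operators on the first copy are scalars; they
    are collected in \<open>c\<close>.\<close>
  have F: "?F (ket_state l, t, u) = c * delta (sea, ket_state n) (t, u)" for t u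
  proof -
    have "op_pow (\<alpha> * qh) L0_op G (ket_state l) = (\<alpha> * qh) powi int (psize l) * G (ket_state l)" for G
      by (rule op_pow_diag[OF \<alpha>, where d = "\<lambda>s. of_nat (energy s)"]) (simp_all add: L0_op_diag energy_ket_state)
    moreover have "op_pow qh (\<lambda>F s. of_int N * w_op F s) G (ket_state l) = qh powi (N * kappa l) * G (ket_state l)" for G
      by (rule op_pow_diag[OF assms(1), where d = "\<lambda>S. of_int N * ((\<Sum>k\<in>holes S. (of_int k + 1 / 2)\<^sup>2)
          - (\<Sum>k\<in>particles S. (of_int k + 1 / 2)\<^sup>2))"])
        (simp_all add: w_op_diag w_op_ket_state mult.assoc[symmetric])
    ultimately show ?thesis
      by (simp add: on1_def tensor3_def S_ket_ket_state[OF nq] ket_eq ket_state_empty delta_pair c_def S_def)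
  qed
  have "op_exp X ?F (ket_state l, ket_state m, sea) = c * (\<Sum>e | vexp (\<lambda>k. ?z (int k)) (delta e) (ket_state m) \<noteq> 0.
      vexp (\<lambda>k. ?z (int k)) (delta e) (ket_state m) * vexp (\<lambda>k. ?w (int k)) (delta e) (ket_state n))"
  proof (rule embed_exp[where \<iota> = "\<lambda>p. (ket_state l, p)"])
    show "X F (ket_state l, t, u) = (\<Sum>\<^sub>\<infinity>n\<in>{1..}. 1 / of_int n *
      (?w n * a_op n (\<lambda>u. F (ket_state l, t, u)) u + a_op (- n) (\<lambda>t. a_op n (\<lambda>u. F (ket_state l, t, u)) u) t
        + ?z n * a_op (- n) (\<lambda>t. F (ket_state l, t, u)) t))" for F t u
      unfolding X_def by (rule infsum_cong) (simp add: on1_def on2_def on3_def b_op_diag)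
    show "?F (ket_state l, p) = c * delta (sea, ket_state n) p" for p
      using F by (cases p) simp
  qed
  also have "vexp (\<lambda>k. ?z (int k)) = vexp (psum ?x)"
    by (rule vexp_cong_modes) (simp only: b_modes_neg[OF assms(1,2)] q[symmetric])
  also have "vexp (\<lambda>k. ?w (int k)) = vexp (psum ?y)"
    by (rule vexp_cong_modes) (simp only: b_modes_pos[OF assms(1,2) \<beta>] q[symmetric] minus_minus)
  also have "(\<Sum>e | vexp (psum ?x) (delta e) (ket_state m) \<noteq> 0. vexp (psum ?x) (delta e) (ket_state m) * vexp (psum ?y) (delta e) (ket_state n))
      = (\<Sum>\<^sub>\<infinity>p. vexp (psum ?x) (delta (ket_state p)) (ket_state m) * vexp (psum ?y) (delta (ket_state p)) (ket_state n))"
    by (rule sum_states[OF _ inj_ket_state range_ket_state]) (simp add: ket_state_def)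
  also have "\<dots> = (\<Sum>\<^sub>\<infinity>p. ((-1) ^ (psize m + psize n) * \<beta> powi (int (psize m) - int (psize n))) *
      (skew_schur n p (q_spec qh l) * skew_schur m p (q_spec qh (conj_part l))))"
  proof (rule infsum_cong)
    fix p
    \<comment> \<open>The variables of the two skew functions are scaled by inverse factors, so the
      powers of \<open>\<beta>\<close> that belong to \<open>p\<close> cancel; its signs cancel
      next.\<close>
    have "\<beta> powi (int (psize m) - int (psize p)) * inverse \<beta> powi (int (psize n) - int (psize p))
        = \<beta> powi (int (psize m) - int (psize n))"
      using \<beta> by (simp add: power_int_diff power_int_inverse field_simps)
    moreover have "(-1) ^ (psize m + psize p) * (-1) ^ (psize n + psize p) = ((-1) ^ (psize m + psize n) :: complex)"
    proof -
      have "(-1) ^ psize p * (-1) ^ psize p = (1 :: complex)" by (simp flip: power_add mult_2)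
      then show ?thesis by (simp add: power_add ac_simps)
    qed
    moreover have "vexp (psum ?x) (delta (ket_state p)) (ket_state m) * vexp (psum ?y) (delta (ket_state p)) (ket_state n) =
        ((-1) ^ (psize m + psize p) * (-1) ^ (psize n + psize p)) *
        (\<beta> powi (int (psize m) - int (psize p)) * inverse \<beta> powi (int (psize n) - int (psize p))) *
        (skew_schur n p (q_spec qh l) * skew_schur m p (q_spec qh (conj_part l)))"
      using \<beta> by (simp only: vexp_skew_schur_pos summable_scale q_spec_summable assms(1,2)
          skew_schur_scale_inverse inverse_nonzero_iff_nonzero not_False_eq_True ac_simps)
    ultimately show "vexp (psum ?x) (delta (ket_state p)) (ket_state m) * vexp (psum ?y) (delta (ket_state p)) (ket_state n) =
        ((-1) ^ (psize m + psize n) * \<beta> powi (int (psize m) - int (psize n))) *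
        (skew_schur n p (q_spec qh l) * skew_schur m p (q_spec qh (conj_part l)))"
      by simp
  qed
  finally have exp: "op_exp X ?F (ket_state l, ket_state m, sea) =
      c * (((-1) ^ (psize m + psize n) * \<beta> powi (int (psize m) - int (psize n))) *
      (\<Sum>\<^sub>\<infinity>p. skew_schur n p (q_spec qh l) * skew_schur m p (q_spec qh (conj_part l))))"
    (is "_ = _ * (?r * ?\<Sigma>)")
    by (simp only: infsum_cmult_right')
  have top: "top_vertex qh (conj_part n) m l = qh powi kappa m * (qh ^ psize l * S) * ?\<Sigma>"
    unfolding top_vertex_def skew_schur_rho(1)[OF assms(1) q] S_def by simp
  \<comment> \<open>The surplus \<open>qh ^ psize l\<close> comes from
    \<open>skew_schur_rho\<close>, which compares the specialisation in the vertex with that of the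
    S-dual vacuum.\<close>
  have l: "((- u) powi N / (qh powi (- 1) * v)) ^ psize l * framing qh l powi N * qh ^ psize l
      = qh powi (N * kappa l) * (\<alpha> * qh) ^ psize l"
  proof -
    have "((- u) powi N / (qh powi (- 1) * v)) = (-1) powi N * (u powi N * qh / v)"
      using assms(1) by (simp add: minus_powi[of u] field_simps)
    then have "((- u) powi N / (qh powi (- 1) * v)) ^ psize l * framing qh l powi N * qh ^ psize l
        = (((-1) powi N) ^ psize l * ((-1) ^ psize l) powi N) *
          (qh powi (N * kappa l) * ((u powi N * qh / v) ^ psize l * qh ^ psize l))"
      by (simp only: framing_powi power_mult_distrib ac_simps)
    also have "\<dots> = qh powi (N * kappa l) * ((u powi N * qh / v) * qh) ^ psize l"
      by (simp only: minus_one_powi_power mult_1 power_mult_distrib)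
    finally show ?thesis by (simp add: \<alpha>_def ac_simps)
  qed
  \<comment> \<open>The framing of \<open>m\<close> cancels the power with \<open>kappa\<close> in
    the vertex, and a sign remains.\<close>
  have m: "framing qh m powi (- 1) * qh powi kappa m = (-1) ^ psize m"
    using assms(1) by (simp add: framing_def power_int_minus field_simps flip: power_mult_distrib)
  have n: "(qh powi (- 1) * u) powi (- int (psize n)) = (-1) ^ psize n * \<beta> powi (- int (psize n))"
  proof -
    have "(qh powi (- 1) * u) powi (- int (psize n)) = (-1 * \<beta>) powi (- int (psize n))" by (simp add: \<beta>_def)
    also have "\<dots> = (-1) powi (- int (psize n)) * \<beta> powi (- int (psize n))" by (rule power_int_mult_distrib)
    also have "(-1) powi (- int (psize n)) = ((-1) ^ psize n :: complex)"
      by (simp only: power_int_minus power_int_of_nat power_inverse[symmetric]) simp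
    finally show ?thesis .
  qed
  have "Phi_star qh N u v l m n =
      (((- u) powi N / (qh powi (- 1) * v)) ^ psize l * framing qh l powi N * qh ^ psize l) *
      (framing qh m powi (- 1) * qh powi kappa m) * \<beta> ^ psize m *
      ((qh powi (- 1) * u) powi (- int (psize n))) * (S * ?\<Sigma>)"
    unfolding Phi_star_def top \<beta>_def by (simp only: ac_simps)
  also have "\<dots> = (qh powi (N * kappa l) * (\<alpha> * qh) ^ psize l * S) * (?r * ?\<Sigma>)"
    unfolding l m n using \<beta> by (simp add: power_add power_int_diff power_int_minus field_simps)
  also have "\<dots> = inverse (vac_norm q) * (c * (?r * ?\<Sigma>))"
    using vac_norm_nonzero[OF nq] by (simp add: c_def field_simps)
  finally show ?thesis
    by (simp add: exp bra3_def bra_eq ket_state_empty)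
qed

text \<open>Here the modes are negative power sums, so skew functions of the conjugates of
  \<open>m\<close> and \<open>n\<close> appear without sign. The sign in the base of the first
  factor of \<open>Phi\<close> is supplied by \<open>S_bra\<close>, hence the base
  \<open>\<alpha> * qh\<close> for the power of \<open>L0_op\<close>.\<close>

lemma Phi_factorisation:
  fixes q qh u v :: complex and N :: int
  assumes "qh \<noteq> 0" "norm qh < 1" and q: "qh\<^sup>2 = q" and "u \<noteq> 0" "v \<noteq> 0"
  defines "\<alpha> \<equiv> qh * u powi (- 1) * v powi N" and "\<beta> \<equiv> - (qh powi (- 1) * v)"
  defines "Y \<equiv> (\<lambda>F s. \<Sum>\<^sub>\<infinity>n\<in>{1..}. 1 / of_int n *
               (\<beta> powi (- n) * qh powi (- n) * on1 (b_op q n) (on2 (a_op n) F) s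
                + on2 (a_op n) (on3 (a_op (- n)) F) s
                - \<beta> powi n * qh powi n * on1 (b_op q (- n)) (on3 (a_op (- n)) F) s))"
  shows "Phi qh N u v l m n =
            inverse (vac_norm q) *
            bra3 (S_bra q) (bra empty_part) (bra n)
              (on1 (op_pow (\<alpha> * qh) (\<lambda>F s. - L0_op F s))
                (on1 (op_pow qh (\<lambda>F s. - (of_int N * w_op F s)))
                  (op_exp Y
                    (tensor3 (ket l) (ket m) (ket empty_part)))))"
proof -
  have nq: "norm q < 1"
    using assms(2) by (simp add: q[symmetric] norm_power power_less_one_iff)
  have \<beta>: "\<beta> \<noteq> 0" and \<alpha>: "\<alpha> * qh \<noteq> 0" using assms(1,4,5) by (simp_all add: \<beta>_def \<alpha>_def)
  let ?F = "tensor3 (ket l) (ket m) (ket empty_part)"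
  let ?x = "\<lambda>i. \<beta> * q_spec qh (conj_part l) i" and ?y = "\<lambda>i. inverse \<beta> * q_spec qh l i"
  let ?z = "\<lambda>s k. - (\<beta> powi k * qh powi k * b_val q (- k) s)"
    and ?w = "\<lambda>s k. \<beta> powi (- k) * qh powi (- k) * b_val q k s"
  \<comment> \<open>\<open>S_bra\<close> reads the first copy at many states, so the state
    \<open>s\<close> is kept arbitrary here.\<close>
  have expY: "op_exp Y ?F (s, sea, ket_state n) = delta (ket_state l) s * (\<Sum>e | vexp (\<lambda>k. ?z s (int k)) (delta e) (ket_state n) \<noteq> 0.
      vexp (\<lambda>k. ?z s (int k)) (delta e) (ket_state n) * vexp (\<lambda>k. ?w s (int k)) (delta e) (ket_state m))" for s
  proof -
    have "op_exp Y ?F ((\<lambda>(t, u). (s, u, t)) (ket_state n, sea)) =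
      delta (ket_state l) s * (\<Sum>e | vexp (\<lambda>k. ?z s (int k)) (delta e) (ket_state n) \<noteq> 0.
      vexp (\<lambda>k. ?z s (int k)) (delta e) (ket_state n) * vexp (\<lambda>k. ?w s (int k)) (delta e) (ket_state m))"
    proof (rule embed_exp)
      show "Y F ((\<lambda>(t, u). (s, u, t)) (t, u)) = (\<Sum>\<^sub>\<infinity>n\<in>{1..}. 1 / of_int n *
        (?w s n * a_op n (\<lambda>u. F ((\<lambda>(t, u). (s, u, t)) (t, u))) u
          + a_op (- n) (\<lambda>t. a_op n (\<lambda>u. F ((\<lambda>(t, u). (s, u, t)) (t, u))) u) t
          + ?z s n * a_op (- n) (\<lambda>t. F ((\<lambda>(t, u). (s, u, t)) (t, u))) t))" for F t u
        unfolding Y_def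
      proof (rule infsum_cong)
        \<comment> \<open>The modes of the mixed term stand in the opposite order to
          \<open>embed_exp\<close>; they act on different copies.\<close>
        fix k :: int assume "k \<in> {1..}"
        then have "lfin (a_op k)" "lfin (a_op (- k))" by (simp_all add: lfin_a_op)
        then have "a_op k (\<lambda>u. a_op (- k) (\<lambda>t. F (s, u, t)) t) u = a_op (- k) (\<lambda>t. a_op k (\<lambda>u. F (s, u, t)) u) t"
          by (rule lfin_swap)
        then show "1 / of_int k * (\<beta> powi (- k) * qh powi (- k) * on1 (b_op q k) (on2 (a_op k) F) ((\<lambda>(t, u). (s, u, t)) (t, u))
                + on2 (a_op k) (on3 (a_op (- k)) F) ((\<lambda>(t, u). (s, u, t)) (t, u))
                - \<beta> powi k * qh powi k * on1 (b_op q (- k)) (on3 (a_op (- k)) F) ((\<lambda>(t, u). (s, u, t)) (t, u)))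
          = 1 / of_int k * (?w s k * a_op k (\<lambda>u. F ((\<lambda>(t, u). (s, u, t)) (t, u))) u
          + a_op (- k) (\<lambda>t. a_op k (\<lambda>u. F ((\<lambda>(t, u). (s, u, t)) (t, u))) u) t
          + ?z s k * a_op (- k) (\<lambda>t. F ((\<lambda>(t, u). (s, u, t)) (t, u))) t)"
          by (simp add: on1_def on2_def on3_def b_op_diag)
      qed
      show "?F ((\<lambda>(t, u). (s, u, t)) p) = delta (ket_state l) s * delta (sea, ket_state m) p" for p
        by (cases p) (simp add: tensor3_def ket_eq ket_state_empty delta_pair)
    qed
    then show ?thesis by simp
  qed
  have z: "vexp (\<lambda>k. ?z (ket_state l) (int k)) = vexp (\<lambda>k. - psum ?x k)"
    by (rule vexp_cong_modes) (simp only: b_modes_neg[OF assms(1,2)] q[symmetric])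
  have w: "vexp (\<lambda>k. ?w (ket_state l) (int k)) = vexp (\<lambda>k. - psum ?y k)"
    by (rule vexp_cong_modes) (simp only: b_modes_pos[OF assms(1,2) \<beta>] q[symmetric])
  define \<Sigma> where "\<Sigma> = (\<Sum>\<^sub>\<infinity>p. skew_schur (conj_part n) p (q_spec qh (conj_part l)) * skew_schur (conj_part m) p (q_spec qh l))"
  define r where "r = \<beta> powi (int (psize n) - int (psize m))"
  have "op_exp Y ?F (ket_state l, sea, ket_state n) = (\<Sum>e | vexp (\<lambda>k. - psum ?x k) (delta e) (ket_state n) \<noteq> 0.
      vexp (\<lambda>k. - psum ?x k) (delta e) (ket_state n) * vexp (\<lambda>k. - psum ?y k) (delta e) (ket_state m))"
    unfolding expY z w by (simp add: delta_def)
  also have "\<dots> = (\<Sum>\<^sub>\<infinity>p. vexp (\<lambda>k. - psum ?x k) (delta (row_state p)) (ket_state n) * vexp (\<lambda>k. - psum ?y k) (delta (row_state p)) (ket_state m))"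
    by (rule sum_states[OF _ inj_row_state refl]) (simp add: ket_state_def)
  also have "\<dots> = (\<Sum>\<^sub>\<infinity>p. r *
      (skew_schur (conj_part n) p (q_spec qh (conj_part l)) * skew_schur (conj_part m) p (q_spec qh l)))"
  proof (rule infsum_cong)
    fix p
    have "\<beta> powi (int (psize n) - int (psize p)) * inverse \<beta> powi (int (psize m) - int (psize p)) = r"
      using \<beta> by (simp add: r_def power_int_diff power_int_inverse field_simps)
    moreover have "vexp (\<lambda>k. - psum ?x k) (delta (row_state p)) (ket_state n) * vexp (\<lambda>k. - psum ?y k) (delta (row_state p)) (ket_state m) =
        (\<beta> powi (int (psize n) - int (psize p)) * inverse \<beta> powi (int (psize m) - int (psize p))) *
        (skew_schur (conj_part n) p (q_spec qh (conj_part l)) * skew_schur (conj_part m) p (q_spec qh l))"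
      using \<beta> by (simp only: ket_state_def vexp_skew_schur summable_scale q_spec_summable assms(1,2) psize_conj
          skew_schur_scale_inverse inverse_nonzero_iff_nonzero not_False_eq_True ac_simps)
    ultimately show "vexp (\<lambda>k. - psum ?x k) (delta (row_state p)) (ket_state n) * vexp (\<lambda>k. - psum ?y k) (delta (row_state p)) (ket_state m) =
        r * (skew_schur (conj_part n) p (q_spec qh (conj_part l)) * skew_schur (conj_part m) p (q_spec qh l))"
      by simp
  qed
  also have "\<dots> = r * \<Sigma>" unfolding \<Sigma>_def by (rule infsum_cmult_right')
  finally have exp: "op_exp Y ?F (ket_state l, sea, ket_state n) = r * \<Sigma>" .
  define S where "S = skew_schur l empty_part (q_spec qh empty_part)"
  define C where "C = (\<alpha> * qh) powi (- int (psize l)) * (qh powi (- (N * kappa l)) * (r * \<Sigma>))"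
  let ?G = "on1 (op_pow (\<alpha> * qh) (\<lambda>F s. - L0_op F s)) (on1 (op_pow qh (\<lambda>F s. - (of_int N * w_op F s)))
      (op_exp Y ?F))"
  have G: "?G (s, sea, ket_state n) = C * delta (ket_state l) s" for s
  proof (cases "s = ket_state l")
    case True
    have "op_pow (\<alpha> * qh) (\<lambda>F s. - L0_op F s) H (ket_state l) = (\<alpha> * qh) powi (- int (psize l)) * H (ket_state l)" for H
      by (rule op_pow_diag[OF \<alpha>, where d = "\<lambda>s. - of_nat (energy s)"]) (simp_all add: L0_op_diag energy_ket_state)
    moreover have "op_pow qh (\<lambda>F s. - (of_int N * w_op F s)) H (ket_state l) = qh powi (- (N * kappa l)) * H (ket_state l)" for H
      by (rule op_pow_diag[OF assms(1), where d = "\<lambda>S. - (of_int N * ((\<Sum>k\<in>holes S. (of_int k + 1 / 2)\<^sup>2)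
          - (\<Sum>k\<in>particles S. (of_int k + 1 / 2)\<^sup>2)))"])
        (simp_all add: w_op_diag w_op_ket_state mult.assoc[symmetric])
    ultimately show ?thesis using True exp by (simp add: on1_def C_def delta_def)
  next
    case False
    have "op_pow (\<alpha> * qh) (\<lambda>F s. - L0_op F s) H s = exp (Ln (\<alpha> * qh) * (- of_nat (energy s))) * H s" for H
      by (rule op_pow_apply[where d = "\<lambda>s. - of_nat (energy s)"]) (simp add: L0_op_diag)
    moreover have "op_pow qh (\<lambda>F s. - (of_int N * w_op F s)) H s =
        exp (Ln qh * - (of_int N * ((\<Sum>k\<in>holes s. (of_int k + 1 / 2)\<^sup>2)
          - (\<Sum>k\<in>particles s. (of_int k + 1 / 2)\<^sup>2)))) * H s" for H
      by (rule op_pow_apply[where d = "\<lambda>S. - (of_int N * ((\<Sum>k\<in>holes S. (of_int k + 1 / 2)\<^sup>2)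
          - (\<Sum>k\<in>particles S. (of_int k + 1 / 2)\<^sup>2)))"]) (simp add: w_op_diag)
    moreover have "op_exp Y ?F (s, sea, ket_state n) = 0" unfolding expY using False by (simp add: delta_def)
    ultimately show ?thesis using False by (simp add: on1_def delta_def)
  qed
  have bra3: "bra3 (S_bra q) (bra empty_part) (bra n) ?G = vac_norm q * C * ((-1) ^ psize l * (qh ^ psize l * S))"
    unfolding bra3_def bra_eq ket_state_empty G S_bra_ket_state[OF nq] skew_schur_rho(2)[OF assms(1) q] S_def ..
  \<comment> \<open>\<open>kappa_conj\<close> inverts the power in the vertex, so that it cancels
    the framing of \<open>m\<close>.\<close>
  have top: "top_vertex qh n (conj_part m) (conj_part l) = qh powi (- kappa m) * S * \<Sigma>"
    unfolding top_vertex_def kappa_conj conj_conj S_def \<Sigma>_def ..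
  have l: "(- (qh powi (- 1) * u / (- v) powi N)) ^ psize l * framing qh l powi (- N)
      = (\<alpha> * qh) powi (- int (psize l)) * qh powi (- (N * kappa l)) * ((-1) ^ psize l * qh ^ psize l)"
  proof -
    have "(- v) powi N = inverse ((-1) powi (- N)) * v powi N"
      by (simp add: minus_powi[of v] power_int_minus)
    then have e: "- (qh powi (- 1) * u / (- v) powi N) = (-1) powi (- N) * ((-1) * (inverse (\<alpha> * qh) * qh))"
      using assms(1,4,5) by (simp add: \<alpha>_def power_int_minus field_simps)
    have "(- (qh powi (- 1) * u / (- v) powi N)) ^ psize l * framing qh l powi (- N)
        = (((-1) powi (- N)) ^ psize l * ((-1) ^ psize l) powi (- N)) *
          (inverse (\<alpha> * qh) ^ psize l * qh powi (- N * kappa l) * ((-1) ^ psize l * qh ^ psize l))"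
      unfolding e framing_powi power_mult_distrib by (simp only: ac_simps)
    also have "\<dots> = inverse (\<alpha> * qh) ^ psize l * qh powi (- N * kappa l) * ((-1) ^ psize l * qh ^ psize l)"
      by (simp only: minus_one_powi_power mult_1)
    also have "inverse (\<alpha> * qh) ^ psize l = (\<alpha> * qh) powi (- int (psize l))"
      by (simp only: power_int_minus power_int_of_nat power_inverse)
    finally show ?thesis by simp
  qed
  have m: "framing qh m * qh powi (- kappa m) = (-1) ^ psize m"
    using assms(1) by (simp add: framing_def power_int_minus)
  have m': "(qh powi (- 1) * v) powi (- int (psize m)) = (-1) ^ psize m * \<beta> powi (- int (psize m))"
  proof -
    have "(qh powi (- 1) * v) powi (- int (psize m)) = (-1 * \<beta>) powi (- int (psize m))" by (simp add: \<beta>_def)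
    also have "\<dots> = (-1) powi (- int (psize m)) * \<beta> powi (- int (psize m))" by (rule power_int_mult_distrib)
    also have "(-1) powi (- int (psize m)) = ((-1) ^ psize m :: complex)"
      by (simp only: power_int_minus power_int_of_nat power_inverse[symmetric]) simp
    finally show ?thesis .
  qed
  have sq: "(-1) ^ psize m * (-1) ^ psize m = (1 :: complex)" by (simp flip: power_add mult_2)
  have r: "\<beta> powi (- int (psize m)) * \<beta> ^ psize n = r"
    using \<beta> by (simp add: r_def power_int_diff power_int_minus field_simps)
  have "Phi qh N u v l m n =
      ((- (qh powi (- 1) * u / (- v) powi N)) ^ psize l * framing qh l powi (- N)) *
      (qh powi (- 1) * v) powi (- int (psize m)) * (framing qh m * qh powi (- kappa m)) * \<beta> ^ psize n * (S * \<Sigma>)"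
    unfolding Phi_def top \<beta>_def by (simp only: ac_simps)
  also have "\<dots> = ((\<alpha> * qh) powi (- int (psize l)) * qh powi (- (N * kappa l)) * ((-1) ^ psize l * qh ^ psize l)) *
      ((-1) ^ psize m * (-1) ^ psize m) * (\<beta> powi (- int (psize m)) * \<beta> ^ psize n) * (S * \<Sigma>)"
    unfolding l m m' by (simp only: ac_simps)
  also have "\<dots> = C * ((-1) ^ psize l * (qh ^ psize l * S))"
    unfolding sq r C_def mult_1_right by (simp only: ac_simps)
  also have "\<dots> = inverse (vac_norm q) * (vac_norm q * C * ((-1) ^ psize l * (qh ^ psize l * S)))"
    using vac_norm_nonzero[OF nq] by (simp add: field_simps)
  finally show ?thesis unfolding bra3 .
qed

theorem theorem4p9:
  fixes q qh u v :: complex and N :: int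
  assumes "0 < norm q" and "norm q < 1" and "qh\<^sup>2 = q"
    and "u \<noteq> 0" and "v \<noteq> 0"
  shows
    "let \<alpha> = qh * u powi N / v;
         \<beta> = - (qh powi (- 1) * u);
         \<alpha>' = qh * u powi (- 1) * v powi N;
         \<beta>' = - (qh powi (- 1) * v);
         X = (\<lambda>F s. \<Sum>\<^sub>\<infinity>n\<in>{1..}. 1 / of_int n *
               (- (\<beta> powi (- n) * qh powi (- n) * on1 (b_op q n) (on3 (a_op n) F) s)
                + on2 (a_op (- n)) (on3 (a_op n) F) s
                + \<beta> powi n * qh powi n * on1 (b_op q (- n)) (on2 (a_op (- n)) F) s));
         Y = (\<lambda>F s. \<Sum>\<^sub>\<infinity>n\<in>{1..}. 1 / of_int n *
               (\<beta>' powi (- n) * qh powi (- n) * on1 (b_op q n) (on2 (a_op n) F) s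
                + on2 (a_op n) (on3 (a_op (- n)) F) s
                - \<beta>' powi n * qh powi n * on1 (b_op q (- n)) (on3 (a_op (- n)) F) s))
     in
       (\<forall>l m n.
          Phi_star qh N u v l m n =
            inverse (vac_norm q) *
            bra3 (bra l) (bra m) (bra empty_part)
              (op_exp X
                (on1 (op_pow qh (\<lambda>F s. of_int N * w_op F s))
                  (on1 (op_pow (\<alpha> * qh) L0_op)
                    (tensor3 (S_ket q) (ket empty_part) (ket n)))))) \<and>
       (\<forall>l m n.
          Phi qh N u v l m n =
            inverse (vac_norm q) *
            bra3 (S_bra q) (bra empty_part) (bra n)
              (on1 (op_pow (\<alpha>' * qh) (\<lambda>F s. - L0_op F s))
                (on1 (op_pow qh (\<lambda>F s. - (of_int N * w_op F s)))
                  (op_exp Y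
                    (tensor3 (ket l) (ket m) (ket empty_part))))))"
proof -
  have "norm qh ^ 2 < 1 ^ 2" using assms(2) by (simp add: assms(3)[symmetric] norm_power)
  then have qh: "norm qh < 1" by (rule power_less_imp_less_base) simp
  have "qh \<noteq> 0" using assms(1,3) by auto
  note qh' = this qh assms(3-5)
  show ?thesis
    unfolding Let_def
    by (intro conjI allI Phi_star_factorisation[OF qh'] Phi_factorisation[OF qh'])
qed
end
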